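(* Let $\lambda_0$ be a parameter value, and for $\lambda$ in a neighbourhood $\Lambda$ of $\lambda_0$ let $$f_\lambda(x_1,x_2)=(\mu_1(\lambda)x_1,\mu_2(\lambda)x_2)+\sum_{|k|=2}^{\infty}a_k(\lambda)x^k,\qquad a_k(\lambda)\in\mathbb{C}^2,\ \mu_1(\lambda)\neq\mu_2(\lambda),$$ be a family of local analytic diffeomorphisms of $\mathbb{C}^2$ near $0$ fixing $0$, whose power series converge absolutely on a polydisk $D\subset\mathbb{C}^2$ at $0$. Suppose that $0$ is a hyperbolic fixed point of $f_\lambda$ and that $$\frac{\log|\mu_1(\lambda_0)|}{\log|\mu_2(\lambda_0)|}=-R$$ with $R>0$ irrational. Let $R=[a_1\ a_2\ \dots\ a_n\ \dots]$ be the continued fraction expansion of $R$, with convergents $\frac{q_n}{p_n}=[a_1\ a_2\ \dots\ a_n]$, $n\ge1$. Let $k\in\mathbb{N}$ be given and put $q=q_{2k+1}$, $p=p_{2k+1}$, $\tilde q=q_{2k+2}$, $\tilde p=p_{2k+2}$; write $u=x_1^{p}x_2^{q}$ and $\tilde u=x_1^{\tilde p}x_2^{\tilde q}$. Then (for $\lambda$ in a sufficiently small neighbourhood of $\lambda_0$) there is an analytic change of variables $h_\lambda$ near $0$ such that $g_\lambda=h_\lambda^{-1}\circ f_\lambda\circ h_\lambda$ has the form $$g_\lambda(x_1,x_2)=\Big(x_1\big[\mu_1(\lambda)+u\,b^1_1(u,\tilde u,\lambda)+\tilde u\,b^2_1(u,\tilde u,\lambda)\big],\ x_2\big[\mu_2(\lambda)+u\,b^1_2(u,\tilde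 u,\lambda)+\tilde u\,b^2_2(u,\tilde u,\lambda)\big]\Big),$$ where moreover: (i) the functions $b^i_j$ ($i,j=1,2$) are locally analytic near $(u,\tilde u)=(0,0)$; (ii) if the family $f_\lambda$ depends analytically on $\lambda$ near $\lambda_0$, then so do $h_\lambda$, $g_\lambda$ and $b^i_j$, $i,j=1,2$.
   Context: Multi-index notation: for $k=(k_1,k_2)\in\mathbb{N}^2$ (with $0\in\mathbb{N}$) and $x=(x_1,x_2)\in\mathbb{C}^2$, $x^k=x_1^{k_1}x_2^{k_2}$ and $|k|=k_1+k_2$. Parameter conventions: $\lambda$ ranges over a neighbourhood $\Lambda$ of $\lambda_0$ in a finite-dimensional parameter space; all statements are local in $\lambda$, so $\Lambda$ may be replaced by a smaller neighbourhood of $\lambda_0$. All coefficients of power series in $x$ (including $\mu_1,\mu_2,a_k$) are continuous functions of $\lambda\in\Lambda$, taken in a function space endowed with the supremum norm over $\Lambda$ (for example, functions analytic inside a polydisk and continuous up to the boundary). Convergence of a family of power series on a polydisk at $0$ is understood with respect to this norm, so that it is uniform in $\lambda$ and the polydisk does not depend on $\lambda$. The fixed point $0$ is hyperbolic if the eigenvalues $\mu_1(\lambda),\mu_2(\lambda)$ of the linear part have modulus different from $1$ (and they are nonzero since $f_\lambda$ is a diffeomorphism). An analytic change of variables near $0$ is a local analytic diffeomorphism of $(\mathbb{C}^2,0)$ fixing $0$. Continued fractions: $[a_1\ a_2\ \dots]$ denotes $a_1+\cfrac{1}{a_2+\cfrac{1}{a_3+\cdots}}$ with $a_1\ge0$ an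 integer and $a_n\ge1$ integers for $n\ge2$; the convergents $q_n/p_n=[a_1\ \dots\ a_n]$ are written in lowest terms with $p_n>0$ (so $q_1/p_1=a_1/1$). With this indexing the odd-indexed convergents are smaller than $R$ and the even-indexed ones are larger than $R$. *)

theory Defs
  imports "HOL-Analysis.Analysis"
begin

definition mpow :: "complex \<times> complex \<Rightarrow> nat \<times> nat \<Rightarrow> complex" where
  "mpow x k = fst x ^ fst k * snd x ^ snd k"

definition cscale :: "complex \<Rightarrow> complex \<times> complex \<Rightarrow> complex \<times> complex" where
  "cscale z w = (z * fst w, z * snd w)"

definition polydisk :: "real \<Rightarrow> real \<Rightarrow> (complex \<times> complex) set" where
  "polydisk r1 r2 = ball 0 r1 \<times> ball 0 r2"

definition analytic_at_zero :: "(complex \<times> complex \<Rightarrow> complex) \<Rightarrow> bool" where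
  "analytic_at_zero F \<longleftrightarrow>
     (\<exists>r>0. \<exists>c. \<forall>x\<in>polydisk r r. ((\<lambda>k. c k * mpow x k) has_sum F x) UNIV)"

definition analytic_map_at_zero :: "(complex \<times> complex \<Rightarrow> complex \<times> complex) \<Rightarrow> bool" where
  "analytic_map_at_zero F \<longleftrightarrow>
     analytic_at_zero (\<lambda>x. fst (F x)) \<and> analytic_at_zero (\<lambda>x. snd (F x))"

definition local_analytic_diffeo :: "(complex \<times> complex \<Rightarrow> complex \<times> complex) \<Rightarrow> bool" where
  "local_analytic_diffeo F \<longleftrightarrow> F 0 = 0 \<and> analytic_map_at_zero F \<and>
     (\<exists>G. G 0 = 0 \<and> analytic_map_at_zero G \<and>
          (\<forall>\<^sub>F x in nhds 0. G (F x) = x \<and> F (G x) = x))"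

text \<open>Absolute convergence on \<open>D\<close> of the power series with coefficients \<open>c k\<close>, \<open>k \<in> K\<close>, in the
  space of bounded continuous functions of the parameter with the supremum norm over \<open>\<Lambda>\<close>.
  Boundedness is required explicitly because \<open>SUP\<close> of an unbounded set of reals is unspecified.\<close>

definition sup_convergent ::
    "'p::topological_space set \<Rightarrow> (complex \<times> complex) set \<Rightarrow> (nat \<times> nat) set
      \<Rightarrow> (nat \<times> nat \<Rightarrow> 'p \<Rightarrow> 'b::real_normed_vector) \<Rightarrow> bool" where
  "sup_convergent \<Lambda> D K c \<longleftrightarrow>
     (\<forall>k\<in>K. continuous_on \<Lambda> (c k) \<and> bounded (c k ` \<Lambda>)) \<and>
     (\<forall>x\<in>D. (\<lambda>k. (SUP l\<in>\<Lambda>. norm (c k l)) * norm (mpow x k)) summable_on K)"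

text \<open>A family, indexed by \<open>\<Lambda>\<close>, of functions analytic near \<open>0\<close>, with coefficients
  continuous in the parameter and a polydisk of convergence that does not depend on it.\<close>

definition analytic_family ::
    "'p::topological_space set \<Rightarrow> ('p \<Rightarrow> complex \<times> complex \<Rightarrow> complex) \<Rightarrow> bool" where
  "analytic_family \<Lambda> F \<longleftrightarrow>
     (\<exists>r>0. \<exists>c. sup_convergent \<Lambda> (polydisk r r) UNIV c \<and>
        (\<forall>l\<in>\<Lambda>. \<forall>x\<in>polydisk r r. ((\<lambda>k. c k l * mpow x k) has_sum F l x) UNIV))"

definition analytic_map_family ::
    "'p::topological_space set \<Rightarrow> ('p \<Rightarrow> complex \<times> complex \<Rightarrow> complex \<times> complex) \<Rightarrow> bool" where
  "analytic_map_family \<Lambda> F \<longleftrightarrow>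
     analytic_family \<Lambda> (\<lambda>l x. fst (F l x)) \<and> analytic_family \<Lambda> (\<lambda>l x. snd (F l x))"

text \<open>The finite-dimensional parameter spaces \<open>\<complex>\<^sup>m\<close> and \<open>\<real>\<^sup>m\<close>, the latter as the set of
  real points of the former, so that complex analytic and real analytic dependence on the
  parameter are treated at once.\<close>

definition parameter_space :: "(complex ^ 'm) set \<Rightarrow> bool" where
  "parameter_space P \<longleftrightarrow> P = UNIV \<or> P = {l. \<forall>i. l $ i \<in> \<real>}"

text \<open>Analytic dependence on the parameter: \<open>F l x\<close> is, for \<open>l \<in> P\<close> near \<open>l0\<close> and \<open>x\<close> near \<open>0\<close>,
  the sum of an (absolutely) convergent power series in the coordinates of \<open>l - l0\<close> and \<open>x\<close> jointly.\<close>

definition jointly_analytic ::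
    "(complex ^ 'm) set \<Rightarrow> complex ^ 'm \<Rightarrow> (complex ^ 'm \<Rightarrow> complex \<times> complex \<Rightarrow> complex) \<Rightarrow> bool"
  where
  "jointly_analytic P l0 F \<longleftrightarrow>
     (\<exists>r>0. \<exists>c :: ('m \<Rightarrow> nat) \<times> (nat \<times> nat) \<Rightarrow> complex.
        \<forall>l\<in>P. (\<forall>i. norm (l $ i - l0 $ i) < r) \<longrightarrow>
          (\<forall>x\<in>polydisk r r.
             ((\<lambda>(j, k). c (j, k) * (\<Prod>i\<in>UNIV. (l $ i - l0 $ i) ^ j i) * mpow x k)
                has_sum F l x) UNIV))"

definition jointly_analytic_map ::
    "(complex ^ 'm) set \<Rightarrow> complex ^ 'm
      \<Rightarrow> (complex ^ 'm \<Rightarrow> complex \<times> complex \<Rightarrow> complex \<times> complex) \<Rightarrow> bool" where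
  "jointly_analytic_map P l0 F \<longleftrightarrow>
     jointly_analytic P l0 (\<lambda>l x. fst (F l x)) \<and> jointly_analytic P l0 (\<lambda>l x. snd (F l x))"

fun cfrac :: "nat list \<Rightarrow> real" where
  "cfrac [] = 0"
| "cfrac [a] = real a"
| "cfrac (a # b # as) = real a + 1 / cfrac (b # as)"

text \<open>Partial quotients and convergents are indexed from \<open>1\<close>; values at index \<open>0\<close> are irrelevant.\<close>

definition cfrac_expansion :: "(nat \<Rightarrow> nat) \<Rightarrow> real \<Rightarrow> bool" where
  "cfrac_expansion d R \<longleftrightarrow>
     (\<forall>n\<ge>2. d n \<ge> 1) \<and> (\<lambda>n. cfrac (map d [1..<Suc n])) \<longlonglongrightarrow> R"

definition cfrac_convergents :: "(nat \<Rightarrow> nat) \<Rightarrow> (nat \<Rightarrow> nat) \<Rightarrow> (nat \<Rightarrow> nat) \<Rightarrow> bool" where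
  "cfrac_convergents d q p \<longleftrightarrow>
     (\<forall>n\<ge>1. p n > 0 \<and> coprime (q n) (p n) \<and> real (q n) / real (p n) = cfrac (map d [1..<Suc n]))"

end

theory Submission
  imports Defs "HOL-Library.Function_Algebras"
begin

text \<open>
The theorem holds because the normal form keeps exactly the monomials that cause small divisors. A monomial
\<open>x\<^sup>k\<close> in component \<open>i\<close> can be removed if \<open>\<mu>\<^sup>k / \<mu>\<^sub>i = \<mu>\<^sup>m\<close> with \<open>m = k - e\<^sub>i\<close> is far from \<open>1\<close>. Since
\<open>log \<bar>\<mu>\<^sup>m\<bar> = (m\<^sub>2 - R m\<^sub>1) log \<bar>\<mu>\<^sub>2\<bar>\<close>, the modulus of \<open>\<mu>\<^sup>m\<close> is exponentially small for all \<open>m\<close> on one side of the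
cone spanned by \<open>(p, q)\<close> and \<open>(p', q')\<close>, and exponentially large on the other side: the convergents \<open>q / p\<close> and
\<open>q' / p'\<close> bracket \<open>R\<close>. As \<open>p q' - q p' = 1\<close>, the lattice points of the cone itself are the \<open>i (p, q) + j (p', q')\<close>
with unique naturals \<open>i, j\<close>, that is, the monomials in \<open>u\<close> and \<open>u'\<close>.

Convergence needs more than the absence of small divisors: in \<open>f \<circ> h = h \<circ> g\<close> the term \<open>\<phi> \<circ> g\<close>, with
\<open>h = id + \<phi>\<close>, loses a derivative when it is expanded in coefficients. It does not do so if \<open>\<phi>\<close> contains only
monomials with \<open>\<bar>\<mu>\<^sup>m\<bar>\<close> small, for then \<open>\<phi> \<mapsto> L\<^sup>-\<^sup>1 (\<phi> \<circ> g)\<close> is itself a contraction in the norm \<open>\<Sum> \<bar>\<phi>\<^sub>k\<bar>\<close>,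
and \<open>\<phi>\<close> together with \<open>g\<close> is the fixed point of a contraction (\<open>step_unit\<close>, \<open>step_germ\<close>). Hence the two sides of the
cone are cleared one after the other, the second one by applying the same step to the inverse map, for which the
large \<open>\<mu>\<^sup>m\<close> become small. The second step does not bring back what the first removed, because the exponents left over by the
first step form a monoid, and maps with exponents in a monoid are closed under substitution and inversion
(\<open>supported_cmp\<close>, \<open>inverse_germ\<close>). The two steps are combined in \<open>normal_form_germ\<close>; which side comes first
depends on which of \<open>\<mu>\<^sub>1\<close>, \<open>\<mu>\<^sub>2\<close> contracts (\<open>contracts_exists\<close>).

The parameter enters only through the coefficients. All of the above is done for power series with coefficients in an
arbitrary commutative Banach algebra, and a parameter value is a character of that algebra. Bounded continuous functions give
continuous dependence (\<open>continuous_normal_form\<close>); absolutely convergent power series in the parameter give analytic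
dependence (\<open>analytic_normal_form\<close>), and the latter form an \<open>l1\<close> algebra of the same kind as the power series in \<open>x\<close>.
\<close>

section \<open>The Banach algebra of absolutely summable families over a monoid\<close>

text \<open>The type is used twice: with index type \<open>nat \<times> nat\<close> for power series in \<open>x\<close> on the closed unit polydisk, and with index
type \<open>'m \<Rightarrow> nat\<close> for power series in the parameter. The weights of other polydisks are absorbed by rescaling the variables.\<close>

typedef (overloaded) ('i, 'a) l1 = "{f :: 'i \<Rightarrow> 'a::real_normed_vector. (\<lambda>i. norm (f i)) summable_on UNIV}"
  morphisms cf Abs_l1
  by (rule exI[of _ "\<lambda>_. 0"]) simp

setup_lifting type_definition_l1

lemma cf_abs_summable: "(\<lambda>i. norm (cf F i)) summable_on A"
  using cf[of F] by (auto intro: summable_on_subset_banach)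

lemma l1_eqI: "(\<And>i. cf F i = cf G i) \<Longrightarrow> F = G"
  by transfer auto

lemma abs_summable_add:
  fixes f g :: "'i \<Rightarrow> 'a::real_normed_vector"
  assumes "(\<lambda>i. norm (f i)) summable_on A" "(\<lambda>i. norm (g i)) summable_on A"
  shows "(\<lambda>i. norm (f i + g i)) summable_on A"
  by (rule summable_on_comparison_test[OF summable_on_add[OF assms]]) (auto intro: norm_triangle_ineq)

instantiation l1 :: (type, real_normed_vector) real_vector
begin

lift_definition zero_l1 :: "('a, 'b) l1" is "\<lambda>_. 0" by simp
lift_definition plus_l1 :: "('a, 'b) l1 \<Rightarrow> ('a, 'b) l1 \<Rightarrow> ('a, 'b) l1" is "\<lambda>f g i. f i + g i"
  by (rule abs_summable_add)
lift_definition uminus_l1 :: "('a, 'b) l1 \<Rightarrow> ('a, 'b) l1" is "\<lambda>f i. - f i" by simp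
lift_definition minus_l1 :: "('a, 'b) l1 \<Rightarrow> ('a, 'b) l1 \<Rightarrow> ('a, 'b) l1" is "\<lambda>f g i. f i - g i"
  using abs_summable_add[where g = "\<lambda>i. - _ i"] by simp
lift_definition scaleR_l1 :: "real \<Rightarrow> ('a, 'b) l1 \<Rightarrow> ('a, 'b) l1" is "\<lambda>c f i. c *\<^sub>R f i"
  by (simp add: summable_on_cmult_right)
instance
proof
  fix F G H :: "('a, 'b) l1" and a b :: real
  show "F + G + H = F + (G + H)" "F + G = G + F" "0 + F = F" "- F + F = 0" "F - G = F + - G"
    "a *\<^sub>R (F + G) = a *\<^sub>R F + a *\<^sub>R G" "(a + b) *\<^sub>R F = a *\<^sub>R F + b *\<^sub>R F"
    "a *\<^sub>R b *\<^sub>R F = (a * b) *\<^sub>R F" "1 *\<^sub>R F = F"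
    by (transfer; auto simp: algebra_simps)+
qed

end

instantiation l1 :: (type, real_normed_vector) real_normed_vector
begin

definition norm_l1 :: "('a, 'b) l1 \<Rightarrow> real" where "norm_l1 F = (\<Sum>\<^sub>\<infinity>i. norm (cf F i))"
definition dist_l1 :: "('a, 'b) l1 \<Rightarrow> ('a, 'b) l1 \<Rightarrow> real" where "dist_l1 F G = norm (F - G)"
definition sgn_l1 :: "('a, 'b) l1 \<Rightarrow> ('a, 'b) l1" where "sgn_l1 F = F /\<^sub>R norm F"
definition uniformity_l1 :: "(('a, 'b) l1 \<times> ('a, 'b) l1) filter"
  where "uniformity_l1 = (INF e\<in>{0 <..}. principal {(x, y). dist x y < e})"
definition open_l1 :: "('a, 'b) l1 set \<Rightarrow> bool"
  where "open_l1 S = (\<forall>x\<in>S. \<forall>\<^sub>F (x', y) in uniformity. x' = x \<longrightarrow> y \<in> S)"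

instance
proof
  fix F G :: "('a, 'b) l1" and a :: real
  show "dist F G = norm (F - G)" "sgn F = F /\<^sub>R norm F" by (simp_all add: dist_l1_def sgn_l1_def)
  show "norm F = 0 \<longleftrightarrow> F = 0"
  proof
    assume "norm F = 0"
    then have "norm (cf F i) = 0" for i
      unfolding norm_l1_def
      by (intro nonneg_infsum_le_0D[of "\<lambda>i. norm (cf F i)" UNIV]) (auto intro: cf_abs_summable)
    then show "F = 0" by (intro l1_eqI) (simp add: zero_l1.rep_eq)
  qed (simp add: norm_l1_def zero_l1.rep_eq)
  have "norm (F + G) \<le> (\<Sum>\<^sub>\<infinity>i. norm (cf F i) + norm (cf G i))"
    unfolding norm_l1_def
    by (intro infsum_mono summable_on_add cf_abs_summable) (simp add: plus_l1.rep_eq norm_triangle_ineq)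
  also have "\<dots> = norm F + norm G"
    unfolding norm_l1_def by (intro infsum_add cf_abs_summable)
  finally show "norm (F + G) \<le> norm F + norm G" .
  show "norm (a *\<^sub>R F) = \<bar>a\<bar> * norm F"
    by (simp add: norm_l1_def scaleR_l1.rep_eq infsum_cmult_right')
qed (rule uniformity_l1_def open_l1_def)+

end

lemma cf_zero [simp]: "cf 0 i = 0"
  and cf_plus [simp]: "cf (F + G) i = cf F i + cf G i"
  and cf_uminus [simp]: "cf (- F) i = - cf F i"
  and cf_minus [simp]: "cf (F - G) i = cf F i - cf G i"
  and cf_scaleR [simp]: "cf (c *\<^sub>R F) i = c *\<^sub>R cf F i"
  by (simp_all add: zero_l1.rep_eq plus_l1.rep_eq uminus_l1.rep_eq minus_l1.rep_eq scaleR_l1.rep_eq)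

lemma sum_norm_cf_le: "finite S \<Longrightarrow> (\<Sum>i\<in>S. norm (cf F i)) \<le> norm F"
  unfolding norm_l1_def by (rule finite_sum_le_infsum) (auto intro: cf_abs_summable)

lemma norm_cf_le: "norm (cf F i) \<le> norm F"
  using sum_norm_cf_le[of "{i}" F] by simp

lemma bounded_linear_cf: "bounded_linear (\<lambda>F. cf F i)"
  by (rule bounded_linear_intro[where K = 1]) (auto simp: norm_cf_le)

lemma abs_summable_finite_bound:
  fixes f :: "'i \<Rightarrow> 'a::real_normed_vector"
  assumes "\<And>S. finite S \<Longrightarrow> (\<Sum>i\<in>S. norm (f i)) \<le> B"
  shows "(\<lambda>i. norm (f i)) summable_on UNIV" "(\<Sum>\<^sub>\<infinity>i. norm (f i)) \<le> B"
proof -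
  show *: "(\<lambda>i. norm (f i)) summable_on UNIV"
    by (rule nonneg_bdd_above_summable_on) (auto intro!: bdd_aboveI2[where M = B] assms)
  show "(\<Sum>\<^sub>\<infinity>i. norm (f i)) \<le> B"
    by (rule infsum_le_finite_sums[OF *]) (auto intro: assms)
qed

instance l1 :: (type, banach) banach
proof
  fix X :: "nat \<Rightarrow> ('a, 'b) l1"
  assume X: "Cauchy X"
  define L where "L i = lim (\<lambda>n. cf (X n) i)" for i
  have L: "(\<lambda>n. cf (X n) i) \<longlonglongrightarrow> L i" for i
  proof -
    have "Cauchy (\<lambda>n. cf (X n) i)"
      by (rule bounded_linear.Cauchy[OF bounded_linear_cf X])
    then show ?thesis unfolding L_def by (simp add: Cauchy_convergent_iff convergent_LIMSEQ_iff)
  qed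
  have bound: "(\<Sum>i\<in>S. norm (cf (X m) i - L i)) \<le> e"
    if N: "\<forall>m\<ge>N. \<forall>n\<ge>N. norm (X m - X n) < e" and "m \<ge> N" "finite S" for N m e S
  proof (rule tendsto_upperbound)
    show "(\<lambda>n. \<Sum>i\<in>S. norm (cf (X m) i - cf (X n) i)) \<longlonglongrightarrow> (\<Sum>i\<in>S. norm (cf (X m) i - L i))"
      by (intro tendsto_intros L)
    show "\<forall>\<^sub>F n in sequentially. (\<Sum>i\<in>S. norm (cf (X m) i - cf (X n) i)) \<le> e"
      unfolding eventually_sequentially
    proof (intro exI[of _ N] allI impI)
      fix n assume "N \<le> n"
      then have "norm (X m - X n) < e" using N \<open>m \<ge> N\<close> by blast
      then show "(\<Sum>i\<in>S. norm (cf (X m) i - cf (X n) i)) \<le> e"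
        using sum_norm_cf_le[OF \<open>finite S\<close>, of "X m - X n"] by simp
    qed
  qed simp
  obtain N where N: "\<forall>m\<ge>N. \<forall>n\<ge>N. norm (X m - X n) < 1"
    using CauchyD[OF X, of 1] by auto
  have "(\<lambda>i. norm (cf (X N) i - L i)) summable_on UNIV"
    by (rule abs_summable_finite_bound(1)[where B = 1]) (use bound[OF N] in auto)
  then have "(\<lambda>i. norm (cf (X N) i + - (cf (X N) i - L i))) summable_on UNIV"
    by (intro abs_summable_add) (auto intro: cf_abs_summable simp: norm_minus_commute)
  then have Ls: "(\<lambda>i. norm (L i)) summable_on UNIV" by simp
  have cfL: "cf (Abs_l1 L) = L" using Ls by (simp add: Abs_l1_inverse)
  have "X \<longlonglongrightarrow> Abs_l1 L"
  proof (rule LIMSEQ_I)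
    fix r :: real assume "r > 0"
    then obtain N where N: "\<forall>m\<ge>N. \<forall>n\<ge>N. norm (X m - X n) < r / 2"
      using CauchyD[OF X, of "r/2"] by auto
    show "\<exists>no. \<forall>n\<ge>no. norm (X n - Abs_l1 L) < r"
    proof (intro exI[of _ N] allI impI)
      fix m assume "m \<ge> N"
      have "norm (X m - Abs_l1 L) \<le> r / 2"
        unfolding norm_l1_def using bound[OF N \<open>m \<ge> N\<close>]
        by (intro abs_summable_finite_bound(2)) (simp add: cfL)
      then show "norm (X m - Abs_l1 L) < r" using \<open>r > 0\<close> by simp
    qed
  qed
  then show "convergent X" by (rule convergentI)
qed

lift_definition single :: "'i \<Rightarrow> 'a::real_normed_vector \<Rightarrow> ('i, 'a) l1" is
  "\<lambda>i a j. if j = i then a else 0"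
proof -
  fix i :: 'i and a :: 'a
  have "(\<lambda>j. norm (if j = i then a else 0)) summable_on {i}" by simp
  then show "(\<lambda>j. norm (if j = i then a else 0)) summable_on UNIV"
    by (rule summable_on_cong_neutral[THEN iffD1, rotated -1]) auto
qed

lemma cf_single: "cf (single i a) j = (if j = i then a else 0)"
  by transfer simp

lemma norm_single [simp]: "norm (single i a) = norm a"
proof -
  have "(\<Sum>\<^sub>\<infinity>j. norm (cf (single i a) j)) = (\<Sum>\<^sub>\<infinity>j\<in>{i}. norm a)"
    by (rule infsum_cong_neutral) (auto simp: cf_single split: if_splits)
  then show ?thesis by (simp add: norm_l1_def)
qed

lemma bounded_linear_single: "bounded_linear (single i)"
  by (rule bounded_linear_intro[where K = 1]) (auto intro!: l1_eqI simp: cf_single)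

lemma single_zero [simp]: "single i 0 = 0"
  by (intro l1_eqI) (simp add: cf_single)

lemma l1_has_sum_single:
  fixes F :: "('i, 'a::banach) l1"
  shows "((\<lambda>i. single i (cf F i)) has_sum F) UNIV"
proof -
  let ?S = "\<Sum>\<^sub>\<infinity>i. single i (cf F i)"
  have "(\<lambda>i. single i (cf F i)) summable_on UNIV"
    by (rule abs_summable_summable) (simp add: cf_abs_summable)
  then have S: "((\<lambda>i. single i (cf F i)) has_sum ?S) UNIV" by simp
  have "?S = F"
  proof (rule l1_eqI)
    fix j
    have "((\<lambda>i. cf (single i (cf F i)) j) has_sum cf ?S j) UNIV"
      by (rule has_sum_bounded_linear[OF bounded_linear_cf S])
    moreover have "((\<lambda>i. cf (single i (cf F i)) j) has_sum cf F j) UNIV"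
      by (rule has_sum_finite_neutralI[of "{j}"]) (auto simp: cf_single)
    ultimately show "cf ?S j = cf F j" by (rule has_sum_unique)
  qed
  with S show ?thesis by simp
qed

text \<open>Identities between continuous multilinear maps, such as the ring laws and the multiplicativity of evaluation maps, reduce to monomials.\<close>

lemma bounded_linear_l1_eqI:
  fixes f g :: "('i, 'a::banach) l1 \<Rightarrow> 'b::real_normed_vector"
  assumes "bounded_linear f" "bounded_linear g" "\<And>i a. f (single i a) = g (single i a)"
  shows "f F = g F"
  using has_sum_bounded_linear[OF assms(1) l1_has_sum_single[of F]]
    has_sum_bounded_linear[OF assms(2) l1_has_sum_single[of F]]
  by (simp add: assms(3) has_sum_unique)

lemma has_sum_product:
  fixes f :: "'i \<Rightarrow> real" and g :: "'j \<Rightarrow> real"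
  assumes f: "(f has_sum a) UNIV" and g: "(g has_sum b) UNIV"
    and nonneg: "\<And>i. f i \<ge> 0" "\<And>i. g i \<ge> 0"
  shows "((\<lambda>(i, j). f i * g j) has_sum (a * b)) UNIV"
proof -
  have nf: "(\<lambda>i. norm (f i)) = f" "(\<lambda>i. norm (g i)) = g" using nonneg by auto
  have np: "norm ((\<lambda>(i, j). f i * g j) x) = (\<lambda>(i, j). f i * g j) x" for x
    using nonneg by (cases x) (auto simp: abs_mult)
  have sf: "f summable_on UNIV" "g summable_on UNIV" using f g by (auto dest: has_sum_imp_summable)
  have ng: "norm (f i * g j) = f i * g j" for i j using nonneg by simp
  have inf: "(\<Sum>\<^sub>\<infinity>j. f i * g j) = f i * b" for i
    using has_sum_cmult_right[OF g, of "f i"] by (rule infsumI)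
  have nfb: "norm (f i * b) = f i * b" for i
    using nonneg has_sum_nonneg[OF g] by simp
  have "(\<lambda>x. norm ((\<lambda>(i, j). f i * g j) x)) summable_on UNIV \<times> UNIV"
    unfolding Infinite_Sum.abs_summable_on_Sigma_iff prod.case ng inf nfb
    by (intro conjI ballI summable_on_cmult_right summable_on_cmult_left sf)
  then have 1: "(\<lambda>(i, j). f i * g j) summable_on UNIV \<times> UNIV"
    unfolding np .
  have "((\<lambda>(i, j). f i * g j) has_sum (a * b)) (UNIV \<times> UNIV)"
    by (rule has_sum_SigmaI[OF _ _ 1, where g = "\<lambda>i. f i * b"])
      (use has_sum_cmult_right[OF g] has_sum_cmult_left[OF f] in simp_all)
  then show ?thesis by simp
qed

class comm_banach_algebra = real_normed_algebra_1 + comm_ring_1 + banach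

instance complex :: comm_banach_algebra ..

text \<open>Multiplication is convolution, defined as a sum of monomials in the Banach space itself rather than coefficientwise, so that its
laws follow from those for monomials.\<close>

instantiation l1 :: (comm_monoid_add, comm_banach_algebra) "{times, one}"
begin

definition times_l1 :: "('a, 'b) l1 \<Rightarrow> ('a, 'b) l1 \<Rightarrow> ('a, 'b) l1"
  where "F * G = (\<Sum>\<^sub>\<infinity>(i, j). single (i + j) (cf F i * cf G j))"

definition one_l1 :: "('a, 'b) l1" where "1 = single 0 1"

instance ..

end

context
  fixes F G :: "('i::comm_monoid_add, 'a::comm_banach_algebra) l1"
begin

lemma has_sum_norm_times:
  "((\<lambda>(i, j). norm (cf F i) * norm (cf G j)) has_sum (norm F * norm G)) UNIV"
  by (rule has_sum_product) (auto simp: norm_l1_def intro!: has_sum_infsum cf_abs_summable)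

lemma times_l1_has_sum:
  "((\<lambda>(i, j). single (i + j) (cf F i * cf G j)) has_sum (F * G)) UNIV"
proof -
  have "(\<lambda>x. norm (case x of (i, j) \<Rightarrow> single (i + j) (cf F i * cf G j))) summable_on UNIV"
    by (rule summable_on_comparison_test[OF has_sum_imp_summable[OF has_sum_norm_times]])
      (auto simp: norm_mult_ineq)
  then show ?thesis
    unfolding times_l1_def by (rule has_sum_infsum[OF abs_summable_summable])
qed

lemma norm_times_l1: "norm (F * G) \<le> norm F * norm G"
  by (rule norm_infsum_le[OF times_l1_has_sum has_sum_norm_times]) (auto simp: norm_mult_ineq)

end

lemma bounded_bilinear_times_l1:
  "bounded_bilinear ((*) :: ('i::comm_monoid_add, 'a::comm_banach_algebra) l1 \<Rightarrow> _)"
proof -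
  have s: "single i (a + b) = single i a + single i b" "single i (c *\<^sub>R a) = c *\<^sub>R single i a"
    for i :: 'i and a b :: 'a and c
    using linear_simps(1,5)[OF bounded_linear_single[of i]] by auto
  show ?thesis
  proof
    fix F G H :: "('i, 'a) l1" and r :: real
    show "(F + G) * H = F * H + G * H"
      by (rule has_sum_unique[OF times_l1_has_sum])
        (use has_sum_add[OF times_l1_has_sum[of F H] times_l1_has_sum[of G H]] in
          \<open>simp add: case_prod_unfold distrib_right s\<close>)
    show "F * (G + H) = F * G + F * H"
      by (rule has_sum_unique[OF times_l1_has_sum])
        (use has_sum_add[OF times_l1_has_sum[of F G] times_l1_has_sum[of F H]] in
          \<open>simp add: case_prod_unfold distrib_left s\<close>)
    show "(r *\<^sub>R F) * G = r *\<^sub>R (F * G)" "F * (r *\<^sub>R G) = r *\<^sub>R (F * G)"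
      by (rule has_sum_unique[OF times_l1_has_sum];
        use has_sum_scaleR[OF times_l1_has_sum[of F G], of r] in \<open>simp add: case_prod_unfold s\<close>)+
    show "\<exists>K. \<forall>a b :: ('i, 'a) l1. norm (a * b) \<le> norm a * norm b * K"
      by (rule exI[of _ 1]) (simp add: norm_times_l1)
  qed
qed

lemma single_times_single:
  fixes a b :: "'a::comm_banach_algebra" and i j :: "'i::comm_monoid_add"
  shows "single i a * single j b = single (i + j) (a * b)"
  by (rule has_sum_unique[OF times_l1_has_sum], rule has_sum_finite_neutralI[of "{(i, j)}"])
    (auto simp: cf_single split: if_splits)

instance l1 :: (comm_monoid_add, comm_banach_algebra) comm_banach_algebra
proof
  interpret t: bounded_bilinear "(*) :: ('a, 'b) l1 \<Rightarrow> ('a, 'b) l1 \<Rightarrow> ('a, 'b) l1"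
    by (rule bounded_bilinear_times_l1)
  note bl = t.bounded_linear_left t.bounded_linear_right
    t.bounded_linear_left[THEN bounded_linear_compose] t.bounded_linear_right[THEN bounded_linear_compose]
  have comm: "F * G = G * F" for F G :: "('a, 'b) l1"
  proof (rule bounded_linear_l1_eqI[where f = "\<lambda>F. F * G" and g = "\<lambda>F. G * F"])
    fix i a
    show "single i a * G = G * single i a"
      by (rule bounded_linear_l1_eqI[where g = "\<lambda>G. G * single i a"])
        (auto intro!: bl simp: single_times_single ac_simps)
  qed (auto intro: bl)
  fix F G H :: "('a, 'b) l1" and r :: real
  show "F * G = G * F" by (rule comm)
  show "F * G * H = F * (G * H)"
  proof (rule bounded_linear_l1_eqI[where f = "\<lambda>F. F * G * H" and g = "\<lambda>F. F * (G * H)"])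
    fix i a
    show "single i a * G * H = single i a * (G * H)"
    proof (rule bounded_linear_l1_eqI[where f = "\<lambda>G. single i a * G * H" and g = "\<lambda>G. single i a * (G * H)"])
      fix j b
      show "single i a * single j b * H = single i a * (single j b * H)"
        by (rule bounded_linear_l1_eqI[where g = "\<lambda>H. single i a * (single j b * H)"])
          (auto intro!: bl simp: single_times_single ac_simps)
    qed (auto intro: bl)
  qed (auto intro: bl)
  show one: "1 * F = F"
    by (rule bounded_linear_l1_eqI[where g = "\<lambda>F. F"])
      (auto intro!: bl simp: single_times_single one_l1_def)
  show "F * 1 = F" "F * (G + H) = F * G + F * H"
    using one comm[of F 1] t.add_right by simp_all
  show "(F + G) * H = F * H + G * H" "r *\<^sub>R F * G = r *\<^sub>R (F * G)" "F * r *\<^sub>R G = r *\<^sub>R (F * G)"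
    by (simp_all add: t.add_left t.scaleR_left t.scaleR_right)
  show "norm (F * G) \<le> norm F * norm G" by (rule norm_times_l1)
  show "norm (1 :: ('a, 'b) l1) = 1" "(0 :: ('a, 'b) l1) \<noteq> 1"
    by (auto simp: one_l1_def dest: arg_cong[where f = norm])
qed

section \<open>Power series in two variables and substitution\<close>

type_synonym 'a ps2 = "(nat \<times> nat, 'a) l1"

definition weight :: "real \<Rightarrow> real \<Rightarrow> nat \<times> nat \<Rightarrow> real" where
  "weight s t k = s ^ fst k * t ^ snd k"

text \<open>Two radii are needed because the linear part contracts one coordinate and expands the other.\<close>

definition wconv :: "(nat \<times> nat \<Rightarrow> 'a::real_normed_vector) \<Rightarrow> real \<Rightarrow> real \<Rightarrow> bool" where
  "wconv c s t \<longleftrightarrow> (\<lambda>k. norm (c k) * weight s t k) summable_on UNIV"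

definition wsum :: "(nat \<times> nat \<Rightarrow> 'a::real_normed_vector) \<Rightarrow> real \<Rightarrow> real \<Rightarrow> real" where
  "wsum c s t = (\<Sum>\<^sub>\<infinity>k. norm (c k) * weight s t k)"

lemma weight_nonneg [simp]: "0 \<le> s \<Longrightarrow> 0 \<le> t \<Longrightarrow> 0 \<le> weight s t k"
  by (simp add: weight_def)

lemma weight_mono: "0 \<le> s \<Longrightarrow> 0 \<le> t \<Longrightarrow> s \<le> s' \<Longrightarrow> t \<le> t' \<Longrightarrow> weight s t k \<le> weight s' t' k"
  unfolding weight_def by (intro mult_mono power_mono) auto

lemma wconv_has_sum: "wconv c s t \<Longrightarrow> ((\<lambda>k. norm (c k) * weight s t k) has_sum wsum c s t) UNIV"
  unfolding wconv_def wsum_def by simp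

lemma wsum_nonneg: "0 \<le> s \<Longrightarrow> 0 \<le> t \<Longrightarrow> 0 \<le> wsum c s t"
  unfolding wsum_def by (rule infsum_nonneg) simp

lemma wconv_mono:
  assumes "wconv c s' t'" "0 \<le> s" "0 \<le> t" "s \<le> s'" "t \<le> t'"
  shows "wconv c s t" "wsum c s t \<le> wsum c s' t'"
proof -
  have le: "norm (c k) * weight s t k \<le> norm (c k) * weight s' t' k" for k
    using assms by (intro mult_left_mono weight_mono) auto
  show 1: "wconv c s t"
    using assms(1) unfolding wconv_def
    by (rule summable_on_comparison_test) (use assms le in auto)
  show "wsum c s t \<le> wsum c s' t'"
    unfolding wsum_def
    by (rule infsum_mono) (use 1 assms le in \<open>auto simp: wconv_def\<close>)
qed

text \<open>This is what allows \<open>\<phi> \<circ> g\<close> although \<open>g\<close> expands one coordinate: on the support of \<open>\<phi>\<close> the weights of the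
larger polydisk are bounded.\<close>

lemma wconv_cf:
  assumes "\<And>k. cf F k \<noteq> 0 \<Longrightarrow> weight s t k \<le> B" "0 \<le> s" "0 \<le> t"
  shows "wconv (cf F) s t" "wsum (cf F) s t \<le> B * norm F"
proof -
  have le: "norm (cf F k) * weight s t k \<le> norm (cf F k) * B" for k
    using assms by (cases "cf F k = 0") (auto intro: mult_left_mono)
  have s: "(\<lambda>k. norm (cf F k) * B) summable_on UNIV"
    by (intro summable_on_cmult_left cf_abs_summable)
  show 1: "wconv (cf F) s t"
    unfolding wconv_def by (rule summable_on_comparison_test[OF s le]) (use assms in auto)
  have "wsum (cf F) s t \<le> (\<Sum>\<^sub>\<infinity>k. norm (cf F k) * B)"
    unfolding wsum_def by (rule infsum_mono[OF _ s le]) (use 1 in \<open>simp add: wconv_def\<close>)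
  then show "wsum (cf F) s t \<le> B * norm F"
    by (simp add: infsum_cmult_right' norm_l1_def mult.commute[of _ B])
qed

text \<open>Substitution of two power series into the series with coefficients \<open>c\<close>. The coefficients are a plain function, since they often belong
to a series that converges on a polydisk different from the unit one.\<close>

definition cmp :: "(nat \<times> nat \<Rightarrow> 'a::comm_banach_algebra) \<Rightarrow> 'a ps2 \<Rightarrow> 'a ps2 \<Rightarrow> 'a ps2" where
  "cmp c H1 H2 = (\<Sum>\<^sub>\<infinity>k. single 0 (c k) * (H1 ^ fst k * H2 ^ snd k))"

lemma norm_monom_le:
  fixes H1 H2 :: "'a::real_normed_algebra_1"
  assumes "norm H1 \<le> s" "norm H2 \<le> t"
  shows "norm (H1 ^ fst k * H2 ^ snd k) \<le> weight s t k"
proof -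
  have "norm (H1 ^ fst k * H2 ^ snd k) \<le> norm H1 ^ fst k * norm H2 ^ snd k"
    by (intro order.trans[OF norm_mult_ineq] mult_mono norm_power_ineq) auto
  also have "\<dots> \<le> weight s t k"
    unfolding weight_def using assms order_trans[OF norm_ge_zero assms(1)]
    by (intro mult_mono power_mono) auto
  finally show ?thesis .
qed

context
  fixes c :: "nat \<times> nat \<Rightarrow> 'a::comm_banach_algebra"
    and s t :: real
  assumes c: "wconv c s t"
begin

lemma summable_norm_bound:
  fixes f :: "nat \<times> nat \<Rightarrow> 'b::banach"
  assumes "\<And>k. norm (f k) \<le> norm (c k) * weight s t k"
  shows "f summable_on UNIV" "norm (infsum f UNIV) \<le> wsum c s t"
proof -
  have "(\<lambda>k. norm (f k)) summable_on UNIV"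
    by (rule summable_on_comparison_test[OF c[unfolded wconv_def]]) (use assms in auto)
  then show "f summable_on UNIV" by (rule abs_summable_summable)
  then have "(f has_sum infsum f UNIV) UNIV" by simp
  then show "norm (infsum f UNIV) \<le> wsum c s t"
    by (rule norm_infsum_le[OF _ wconv_has_sum[OF c]]) (use assms in auto)
qed

lemma cmp_term_bound:
  assumes "norm H1 \<le> s" "norm H2 \<le> t"
  shows "norm (single (0::nat \<times> nat) (c k) * (H1 ^ fst k * H2 ^ snd k)) \<le> norm (c k) * weight s t k"
  by (rule order.trans[OF norm_mult_ineq]) (simp add: mult_left_mono norm_monom_le assms)

lemma cmp_has_sum:
  assumes "norm H1 \<le> s" "norm H2 \<le> t"
  shows "((\<lambda>k. single 0 (c k) * (H1 ^ fst k * H2 ^ snd k)) has_sum cmp c H1 H2) UNIV"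
  unfolding cmp_def by (rule has_sum_infsum[OF summable_norm_bound(1)]) (rule cmp_term_bound[OF assms])

lemma norm_cmp_le:
  assumes "norm H1 \<le> s" "norm H2 \<le> t"
  shows "norm (cmp c H1 H2) \<le> wsum c s t"
  unfolding cmp_def by (rule summable_norm_bound(2)) (rule cmp_term_bound[OF assms])

end

lemma cmp_diff:
  assumes "wconv c s t" "wconv c' s t" "norm H1 \<le> s" "norm H2 \<le> t"
  shows "cmp (\<lambda>k. c k - c' k) H1 H2 = cmp c H1 H2 - cmp c' H1 H2"
proof -
  have "((\<lambda>k. single 0 (c k) * (H1 ^ fst k * H2 ^ snd k) - single 0 (c' k) * (H1 ^ fst k * H2 ^ snd k))
    has_sum (cmp c H1 H2 - cmp c' H1 H2)) UNIV"
    using has_sum_add[OF cmp_has_sum[OF assms(1,3,4)] has_sum_uminusI[OF cmp_has_sum[OF assms(2,3,4)]]] by simp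
  moreover have "single 0 (c k) * (H1 ^ fst k * H2 ^ snd k) - single 0 (c' k) * (H1 ^ fst k * H2 ^ snd k)
    = single 0 (c k - c' k) * (H1 ^ fst k * H2 ^ snd k)" for k
    using linear_simps(2)[OF bounded_linear_single[of "0::nat \<times> nat"], of "c k" "c' k"]
    by (simp add: left_diff_distrib)
  ultimately show ?thesis unfolding cmp_def by (simp add: infsumI)
qed

text \<open>A Cauchy estimate in disguise: shrinking the radius by \<open>e\<close> trades the factor \<open>n\<close> of the derivative for \<open>1 / e\<close>.\<close>

lemma norm_power_diff_le:
  fixes a b :: "'a::{real_normed_algebra_1,comm_ring_1}"
  assumes "norm a \<le> s - e" "norm b \<le> s - e" "0 < e"
  shows "norm (a ^ n - b ^ n) \<le> s ^ n / e * norm (a - b)"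
proof (cases n)
  case (Suc m)
  have s: "0 \<le> s - e" using assms norm_ge_zero order_trans by blast
  have "norm (\<Sum>i<n. b ^ (n - Suc i) * a ^ i) \<le> (\<Sum>i<n. (s - e) ^ m)"
  proof (rule sum_norm_le)
    fix i assume "i \<in> {..<n}"
    then have "(s - e) ^ m = (s - e) ^ (n - Suc i) * (s - e) ^ i"
      by (simp add: power_add[symmetric] Suc)
    moreover have "norm (b ^ (n - Suc i) * a ^ i) \<le> (s - e) ^ (n - Suc i) * (s - e) ^ i"
      by (intro order.trans[OF norm_mult_ineq] mult_mono order.trans[OF norm_power_ineq] power_mono assms)
        (use s in auto)
    ultimately show "norm (b ^ (n - Suc i) * a ^ i) \<le> (s - e) ^ m" by simp
  qed
  also have "(\<Sum>i<n. (s - e) ^ m) = real n * (s - e) ^ m" by simp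
  also have "\<dots> \<le> s ^ n / e"
  proof -
    have "real n * (s - e) ^ m * e \<le> s ^ n"
    proof -
      \<comment> \<open>The linear term of the binomial expansion of \<open>(e + (s - e)) ^ n\<close>.\<close>
      have "s ^ n = (\<Sum>k\<le>n. of_nat (n choose k) * e ^ k * (s - e) ^ (n - k))"
        using binomial_ring[of e "s - e" n] by simp
      also have "\<dots> \<ge> (\<Sum>k\<in>{1}. of_nat (n choose k) * e ^ k * (s - e) ^ (n - k))"
        by (rule sum_mono2) (use s assms Suc in auto)
      finally show ?thesis by (simp add: Suc mult_ac)
    qed
    then show ?thesis using assms by (simp add: field_simps)
  qed
  finally have sum: "norm (\<Sum>i<n. b ^ (n - Suc i) * a ^ i) \<le> s ^ n / e" .
  have "norm (a ^ n - b ^ n) = norm ((\<Sum>i<n. b ^ (n - Suc i) * a ^ i) * (a - b))"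
    by (subst power_diff_sumr2) (simp add: mult.commute)
  also have "\<dots> \<le> s ^ n / e * norm (a - b)"
    by (rule order.trans[OF norm_mult_ineq mult_right_mono[OF sum]]) simp
  finally show ?thesis .
qed (use assms in simp)

lemma norm_monom_diff_le:
  fixes a b a' b' :: "'a::{real_normed_algebra_1,comm_ring_1}"
  assumes "norm a \<le> s - e" "norm a' \<le> s - e" "norm b \<le> t - e" "norm b' \<le> t - e" "0 < e"
  shows "norm (a ^ i * b ^ j - a' ^ i * b' ^ j) \<le> s ^ i * t ^ j / e * (norm (a - a') + norm (b - b'))"
proof -
  have s: "0 \<le> s" "0 \<le> t" using assms norm_ge_zero[of a] norm_ge_zero[of b] by linarith+
  have "norm (a ^ i * b ^ j - a' ^ i * b' ^ j) = norm ((a ^ i - a' ^ i) * b ^ j + a' ^ i * (b ^ j - b' ^ j))"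
    by (simp add: algebra_simps)
  also have "\<dots> \<le> norm (a ^ i - a' ^ i) * norm (b ^ j) + norm (a' ^ i) * norm (b ^ j - b' ^ j)"
    by (intro order.trans[OF norm_triangle_ineq] add_mono norm_mult_ineq)
  also have "\<dots> \<le> (s ^ i / e * norm (a - a')) * t ^ j + s ^ i * (t ^ j / e * norm (b - b'))"
  proof (intro add_mono mult_mono)
    show "norm (b ^ j) \<le> t ^ j" "norm (a' ^ i) \<le> s ^ i"
      by (intro order.trans[OF norm_power_ineq] power_mono; use assms in simp)+
  qed (use norm_power_diff_le[OF assms(1,2,5)] norm_power_diff_le[OF assms(3,4,5)] s assms(5) in auto)
  finally show ?thesis by (simp add: algebra_simps add_divide_distrib)
qed

lemma cmp_lipschitz:
  assumes c: "wconv c s t" and H: "norm H1 \<le> s - e" "norm H2 \<le> t - e" "norm G1 \<le> s - e" "norm G2 \<le> t - e"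
    and e: "0 < e"
  shows "norm (cmp c H1 H2 - cmp c G1 G2) \<le> wsum c s t / e * (norm (H1 - G1) + norm (H2 - G2))"
proof -
  let ?d = "(norm (H1 - G1) + norm (H2 - G2)) / e"
  have 1: "((\<lambda>k. single 0 (c k) * (H1 ^ fst k * H2 ^ snd k) - single 0 (c k) * (G1 ^ fst k * G2 ^ snd k))
    has_sum (cmp c H1 H2 - cmp c G1 G2)) UNIV"
    using has_sum_add[OF cmp_has_sum[OF c, of H1 H2] has_sum_uminusI[OF cmp_has_sum[OF c, of G1 G2]]] H e
    by simp
  have 2: "((\<lambda>k. norm (c k) * weight s t k * ?d) has_sum (wsum c s t * ?d)) UNIV"
    by (rule has_sum_cmult_left[OF wconv_has_sum[OF c]])
  have "norm (cmp c H1 H2 - cmp c G1 G2) \<le> wsum c s t * ?d"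
  proof (rule norm_infsum_le[OF 1 2])
    fix k :: "nat \<times> nat"
    have "norm (single 0 (c k) * (H1 ^ fst k * H2 ^ snd k) - single 0 (c k) * (G1 ^ fst k * G2 ^ snd k))
      = norm (single 0 (c k) * (H1 ^ fst k * H2 ^ snd k - G1 ^ fst k * G2 ^ snd k))"
      by (simp add: right_diff_distrib)
    also have "\<dots> \<le> norm (c k) * norm (H1 ^ fst k * H2 ^ snd k - G1 ^ fst k * G2 ^ snd k)"
      by (rule order.trans[OF norm_mult_ineq]) simp
    also have "\<dots> \<le> norm (c k) * (weight s t k * ?d)"
      using norm_monom_diff_le[of H1 s e G1 H2 t G2 "fst k" "snd k"] H e
      by (intro mult_left_mono) (auto simp: weight_def)
    finally show "norm (single 0 (c k) * (H1 ^ fst k * H2 ^ snd k) - single 0 (c k) * (G1 ^ fst k * G2 ^ snd k))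
      \<le> norm (c k) * weight s t k * ?d" by (simp add: mult.assoc)
  qed
  then show ?thesis by simp
qed

section \<open>Supports\<close>

lift_definition proj :: "'i set \<Rightarrow> ('i, 'a::real_normed_vector) l1 \<Rightarrow> ('i, 'a) l1" is
  "\<lambda>U f i. if i \<in> U then f i else 0"
  by (erule summable_on_comparison_test) auto

lemma cf_proj: "cf (proj U F) i = (if i \<in> U then cf F i else 0)"
  by transfer simp

lemma norm_proj_le: "norm (proj U F) \<le> norm F"
  unfolding norm_l1_def by (rule infsum_mono) (auto simp: cf_proj intro: cf_abs_summable
    cf_abs_summable[of "proj U F", unfolded cf_proj])

lemma proj_diff: "proj U (F - G) = proj U F - proj U G"
  and proj_add_compl: "proj U F + proj (- U) F = F"
  by (auto intro!: l1_eqI simp: cf_proj)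

definition supported :: "('i, 'a::real_normed_vector) l1 \<Rightarrow> 'i set \<Rightarrow> bool" where
  "supported F U \<longleftrightarrow> (\<forall>i. i \<notin> U \<longrightarrow> cf F i = 0)"

lemma supported_mono: "supported F U \<Longrightarrow> U \<subseteq> V \<Longrightarrow> supported F V"
  by (auto simp: supported_def)

lemma supported_proj: "supported F V \<Longrightarrow> supported (proj U F) (U \<inter> V)"
  by (auto simp: supported_def cf_proj)

lemma supported_ops:
  "supported F U \<Longrightarrow> supported G U \<Longrightarrow> supported (F + G) U"
  "supported F U \<Longrightarrow> supported G U \<Longrightarrow> supported (F - G) U"
  "supported F U \<Longrightarrow> supported (- F) U"
  "supported 0 U"
  by (auto simp: supported_def)

lemma supported_single: "supported (single i a) {i}"
  by (auto simp: supported_def cf_single)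

lemma closed_supported: "closed {F. supported F U}"
proof -
  have "{F. supported F U} = (\<Inter>i\<in>-U. (\<lambda>F. cf F i) -` {0})"
    by (auto simp: supported_def)
  also have "closed \<dots>"
    by (intro closed_INT ballI closed_vimage bounded_linear.continuous_on[OF bounded_linear_cf]) auto
  finally show ?thesis .
qed

lemma supported_has_sum:
  assumes "(f has_sum F) A" "\<And>j. j \<in> A \<Longrightarrow> supported (f j) U"
  shows "supported F U"
  unfolding supported_def
proof (intro allI impI)
  fix i assume "i \<notin> U"
  have "((\<lambda>j. cf (f j) i) has_sum cf F i) A"
    by (rule has_sum_bounded_linear[OF bounded_linear_cf assms(1)])
  moreover have "((\<lambda>j. cf (f j) i) has_sum 0) A"
    using assms(2) \<open>i \<notin> U\<close> by (intro has_sum_0) (auto simp: supported_def)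
  ultimately show "cf F i = 0" by (rule has_sum_unique)
qed

lemma supported_times:
  assumes "supported F U" "supported G V" "\<And>i j. i \<in> U \<Longrightarrow> j \<in> V \<Longrightarrow> i + j \<in> W"
  shows "supported (F * G) W"
  by (rule supported_has_sum[OF times_l1_has_sum])
    (use assms in \<open>force simp: supported_def cf_single\<close>)

definition toZ :: "nat \<times> nat \<Rightarrow> int \<times> int" where
  "toZ k = (int (fst k), int (snd k))"

text \<open>The monomial \<open>x\<^sup>k\<close> of component \<open>i\<close> of a map is described by the exponent \<open>k - e\<^sub>i\<close>, which may have an entry \<open>-1\<close>. In this
description the exponents of a composite are sums of exponents of its factors.\<close>

definition shifted :: "(int \<times> int) set \<Rightarrow> int \<times> int \<Rightarrow> (nat \<times> nat) set" where
  "shifted M a = {k. toZ k - a \<in> M}"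

abbreviation exps1 :: "(int \<times> int) set \<Rightarrow> (nat \<times> nat) set" where
  "exps1 M \<equiv> shifted (M - {0}) (1, 0)"

abbreviation exps2 :: "(int \<times> int) set \<Rightarrow> (nat \<times> nat) set" where
  "exps2 M \<equiv> shifted (M - {0}) (0, 1)"

text \<open>A nonzero exponent \<open>k - e\<^sub>i\<close> with entries of sum at least one belongs to a monomial of order at least two. The condition on the sum
also prevents nonzero exponents from adding up to zero, so that nonlinear terms never contribute to linear ones.\<close>

definition expset :: "(int \<times> int) set \<Rightarrow> bool" where
  "expset M \<longleftrightarrow> 0 \<in> M \<and> (\<forall>u\<in>M. \<forall>v\<in>M. u + v \<in> M) \<and> (\<forall>u\<in>M. u \<noteq> 0 \<longrightarrow> fst u + snd u \<ge> 1)"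

lemma toZ_add: "toZ (j + k) = toZ j + toZ k"
  by (simp add: toZ_def prod_eq_iff)

lemma expset_plus: "expset M \<Longrightarrow> u \<in> M \<Longrightarrow> v \<in> M \<Longrightarrow> u + v \<in> M"
  by (auto simp: expset_def)

lemma expset_ideal: 
  assumes "expset M" "u \<in> M" "v \<in> M - {0}"
  shows "u + v \<in> M - {0}"
proof -
  have "fst u + snd u \<ge> 0" "fst v + snd v \<ge> 1" using assms by (auto simp: expset_def)
  then have "u + v \<noteq> 0" by (auto simp: prod_eq_iff)
  then show ?thesis using assms expset_plus by blast
qed

lemma supported_shifted_times:
  assumes "expset M" "supported F (shifted M a)" "supported G (shifted M b)"
  shows "supported (F * G) (shifted M (a + b))"
proof (rule supported_times[OF assms(2,3)])
  fix i j assume "i \<in> shifted M a" "j \<in> shifted M b"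
  then have "(toZ i - a) + (toZ j - b) \<in> M"
    using expset_plus[OF assms(1)] by (auto simp: shifted_def)
  then show "i + j \<in> shifted M (a + b)"
    by (simp add: shifted_def toZ_add algebra_simps)
qed

lemma supported_one: "expset M \<Longrightarrow> supported (1 :: 'a::comm_banach_algebra ps2) (shifted M 0)"
  by (auto simp: supported_def one_l1_def cf_single shifted_def toZ_def expset_def zero_prod_def)

lemma supported_shifted_power:
  fixes H :: "'a::comm_banach_algebra ps2"
  assumes "expset M" "supported H (shifted M a)"
  shows "supported (H ^ n) (shifted M (int n * fst a, int n * snd a))"
proof (induction n)
  case 0
  then show ?case using supported_one[OF assms(1)] by (simp add: zero_prod_def)
next
  case (Suc n)
  have "a + (int n * fst a, int n * snd a) = (int (Suc n) * fst a, int (Suc n) * snd a)"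
    by (simp add: prod_eq_iff algebra_simps)
  then show ?case
    using supported_shifted_times[OF assms(1,2) Suc] by simp
qed

text \<open>The exponent of a monomial of \<open>H1\<^sup>i H2\<^sup>j\<close> differs from \<open>(i, j)\<close> by an element of the monoid \<open>M\<close>, and a sum of elements of
\<open>M\<close> vanishes only if all of them do.\<close>

lemma supported_cmp:
  fixes H1 H2 :: "'a::comm_banach_algebra ps2"
  assumes M: "expset M" and c: "\<And>k. k \<notin> shifted (M - {0}) a \<Longrightarrow> c k = 0"
    and H: "supported H1 (shifted M (1, 0))" "supported H2 (shifted M (0, 1))"
    and conv: "wconv c s t" "norm H1 \<le> s" "norm H2 \<le> t"
  shows "supported (cmp c H1 H2) (shifted (M - {0}) a)"
proof (rule supported_has_sum[OF cmp_has_sum[OF conv]])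
  fix k :: "nat \<times> nat"
  show "supported (single 0 (c k) * (H1 ^ fst k * H2 ^ snd k)) (shifted (M - {0}) a)"
  proof (cases "c k = 0")
    case True
    then show ?thesis by (simp add: supported_ops)
  next
    case False
    have "(int (fst k), 0) + (0, int (snd k)) = toZ k" by (simp add: toZ_def)
    then have *: "supported (H1 ^ fst k * H2 ^ snd k) (shifted M (toZ k))"
      using supported_shifted_times[OF M supported_shifted_power[OF M H(1), of "fst k"]
          supported_shifted_power[OF M H(2), of "snd k"]] by simp
    from False c have "k \<in> shifted (M - {0}) a" by blast
    then have "toZ k - a \<in> M - {0}" by (simp add: shifted_def)
    then have "i \<in> shifted (M - {0}) a" if "i \<in> shifted M (toZ k)" for i
      using expset_ideal[OF M, of "toZ i - toZ k" "toZ k - a"] that by (simp add: shifted_def)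
    then show ?thesis
      using supported_times[OF supported_single *] by auto
  qed
qed

section \<open>Evaluation at characters\<close>

text \<open>Evaluating the coefficients at a parameter value is a character. Only real linearity is demanded, in accordance with the real algebras of
the class.\<close>

definition character :: "('a::comm_banach_algebra \<Rightarrow> complex) \<Rightarrow> bool" where
  "character \<omega> \<longleftrightarrow> bounded_linear \<omega> \<and> (\<forall>a b. \<omega> (a * b) = \<omega> a * \<omega> b) \<and> \<omega> 1 = 1 \<and> (\<forall>a. norm (\<omega> a) \<le> norm a)"

definition ev :: "('a \<Rightarrow> complex) \<Rightarrow> (nat \<times> nat \<Rightarrow> 'a) \<Rightarrow> complex \<times> complex \<Rightarrow> complex" where
  "ev \<omega> c x = (\<Sum>\<^sub>\<infinity>k. \<omega> (c k) * mpow x k)"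

lemma norm_mpow_le: "norm (fst x) \<le> s \<Longrightarrow> norm (snd x) \<le> t \<Longrightarrow> norm (mpow x k) \<le> weight s t k"
  unfolding mpow_def by (rule norm_monom_le)

context
  fixes \<omega> :: "'a::comm_banach_algebra \<Rightarrow> complex"
  assumes \<omega>: "character \<omega>"
begin

lemma char_simps:
  "\<omega> (a + b) = \<omega> a + \<omega> b" "\<omega> (a - b) = \<omega> a - \<omega> b" "\<omega> (- a) = - \<omega> a" "\<omega> 0 = 0" "\<omega> 1 = 1"
  "\<omega> (a * b) = \<omega> a * \<omega> b" "\<omega> (r *\<^sub>R a) = r *\<^sub>R \<omega> a" "norm (\<omega> a) \<le> norm a"
  using \<omega> linear_simps[of \<omega>] unfolding character_def by auto

lemma ev_term_bound:
  assumes "norm (fst x) \<le> s" "norm (snd x) \<le> t"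
  shows "norm (\<omega> (c k) * mpow x k) \<le> norm (c k) * weight s t k"
  unfolding norm_mult by (intro mult_mono char_simps norm_mpow_le assms) auto

lemma ev_has_sum:
  assumes "wconv c s t" "norm (fst x) \<le> s" "norm (snd x) \<le> t"
  shows "((\<lambda>k. \<omega> (c k) * mpow x k) has_sum ev \<omega> c x) UNIV"
  unfolding ev_def
  by (rule has_sum_infsum[OF summable_norm_bound(1)[OF assms(1)]]) (rule ev_term_bound[OF assms(2,3)])

lemma norm_ev_le:
  assumes "wconv c s t" "norm (fst x) \<le> s" "norm (snd x) \<le> t"
  shows "norm (ev \<omega> c x) \<le> wsum c s t"
  unfolding ev_def
  by (rule summable_norm_bound(2)[OF assms(1)]) (rule ev_term_bound[OF assms(2,3)])

context
  fixes x :: "complex \<times> complex"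
  assumes x: "norm (fst x) \<le> 1" "norm (snd x) \<le> 1"
begin

lemma ev_cf_has_sum: "((\<lambda>k. \<omega> (cf F k) * mpow x k) has_sum ev \<omega> (cf F) x) UNIV"
  and norm_ev_cf_le: "norm (ev \<omega> (cf F) x) \<le> norm F"
proof -
  have w: "wconv (cf F) 1 1" "wsum (cf F) 1 1 \<le> 1 * norm F"
    by (rule wconv_cf[where B = 1]; simp add: weight_def)+
  show "((\<lambda>k. \<omega> (cf F k) * mpow x k) has_sum ev \<omega> (cf F) x) UNIV"
    by (rule ev_has_sum[OF w(1) x])
  show "norm (ev \<omega> (cf F) x) \<le> norm F" using norm_ev_le[OF w(1) x] w(2) by simp
qed

lemma ev_single: "ev \<omega> (cf (single k a)) x = \<omega> a * mpow x k"
  by (rule has_sum_unique[OF ev_cf_has_sum], rule has_sum_finite_neutralI[of "{k}"])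
    (auto simp: cf_single char_simps)

lemma ev_add: "ev \<omega> (cf (F + G)) x = ev \<omega> (cf F) x + ev \<omega> (cf G) x"
  by (rule has_sum_unique[OF ev_cf_has_sum])
    (use has_sum_add[OF ev_cf_has_sum[of F] ev_cf_has_sum[of G]] in \<open>simp add: char_simps distrib_right\<close>)

lemma bounded_linear_ev: "bounded_linear (\<lambda>F. ev \<omega> (cf F) x)"
proof (rule bounded_linear_intro[where K = 1])
  fix F :: "'a ps2" and r :: real
  show "ev \<omega> (cf (r *\<^sub>R F)) x = r *\<^sub>R ev \<omega> (cf F) x"
    by (rule has_sum_unique[OF ev_cf_has_sum])
      (use has_sum_scaleR[OF ev_cf_has_sum[of F], of r] in \<open>simp add: char_simps\<close>)
qed (auto simp: ev_add norm_ev_cf_le)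

text \<open>Both sides are bounded and bilinear and agree on monomials.\<close>

lemma ev_mult: "ev \<omega> (cf (F * G)) x = ev \<omega> (cf F) x * ev \<omega> (cf G) x"
proof (rule bounded_linear_l1_eqI[where f = "\<lambda>F. ev \<omega> (cf (F * G)) x"
      and g = "\<lambda>F. ev \<omega> (cf F) x * ev \<omega> (cf G) x"])
  fix i a
  show "ev \<omega> (cf (single i a * G)) x = ev \<omega> (cf (single i a)) x * ev \<omega> (cf G) x"
    by (rule bounded_linear_l1_eqI[where f = "\<lambda>G. ev \<omega> (cf (single i a * G)) x"
      and g = "\<lambda>G. ev \<omega> (cf (single i a)) x * ev \<omega> (cf G) x"])
      (auto intro!: bounded_linear_ev bounded_linear_compose[OF bounded_linear_ev bounded_linear_mult_right]
         bounded_linear_compose[OF bounded_linear_mult_right bounded_linear_ev]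
        simp: single_times_single ev_single char_simps mpow_def power_add)
qed (auto intro!: bounded_linear_ev bounded_linear_compose[OF bounded_linear_ev bounded_linear_mult_left]
         bounded_linear_compose[OF bounded_linear_mult_left bounded_linear_ev])

lemma ev_one: "ev \<omega> (cf 1) x = 1"
  by (simp add: one_l1_def ev_single char_simps mpow_def)

lemma ev_power: "ev \<omega> (cf (F ^ n)) x = ev \<omega> (cf F) x ^ n"
  by (induction n) (simp_all add: ev_one ev_mult)

lemma ev_cmp:
  assumes "wconv c s t" "norm H1 \<le> s" "norm H2 \<le> t"
  shows "ev \<omega> (cf (cmp c H1 H2)) x = ev \<omega> c (ev \<omega> (cf H1) x, ev \<omega> (cf H2) x)"
proof -
  have "((\<lambda>k. ev \<omega> (cf (single 0 (c k) * (H1 ^ fst k * H2 ^ snd k))) x) has_sum ev \<omega> (cf (cmp c H1 H2)) x) UNIV"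
    by (rule has_sum_bounded_linear[OF bounded_linear_ev cmp_has_sum[OF assms]])
  then have "((\<lambda>k. \<omega> (c k) * mpow (ev \<omega> (cf H1) x, ev \<omega> (cf H2) x) k) has_sum ev \<omega> (cf (cmp c H1 H2)) x) UNIV"
    by (simp add: ev_mult ev_power ev_single mpow_def)
  then show ?thesis by (simp add: ev_def infsumI)
qed

end
end

section \<open>A contraction principle\<close>

text \<open>The contraction is measured in a norm \<open>N\<close> that is only equivalent to the given one, since on a product space the Euclidean norm
is less convenient than the sum of the norms.\<close>

lemma contraction_fixpoint:
  fixes T :: "'x::banach \<Rightarrow> 'x" and N :: "'x \<Rightarrow> real"
  assumes S: "closed S" "x0 \<in> S" "\<And>x. x \<in> S \<Longrightarrow> T x \<in> S"
    and N: "\<And>x. norm x \<le> N x" "\<And>x. N x \<le> C * norm x"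
    and \<theta>: "0 \<le> \<theta>" "\<theta> < 1"
    and T: "\<And>x y. x \<in> S \<Longrightarrow> y \<in> S \<Longrightarrow> N (T x - T y) \<le> \<theta> * N (x - y)"
  shows "\<exists>x\<in>S. T x = x"
proof -
  define X where "X n = (T ^^ n) x0" for n
  have X: "X n \<in> S" for n by (induction n) (auto simp: X_def S)
  have X0: "X 0 = x0" by (simp add: X_def)
  have XS: "X (Suc n) = T (X n)" for n by (simp add: X_def)
  have d: "N (X (Suc n) - X n) \<le> \<theta> ^ n * N (X 1 - X 0)" for n
  proof (induction n)
    case (Suc n)
    have "N (X (Suc (Suc n)) - X (Suc n)) \<le> \<theta> * N (X (Suc n) - X n)"
      using T[OF X X, of "Suc n" n] by (simp add: XS)
    also have "\<dots> \<le> \<theta> * (\<theta> ^ n * N (X 1 - X 0))"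
      using Suc \<theta> by (intro mult_left_mono)
    finally show ?case by simp
  qed simp
  have "summable (\<lambda>n. X (Suc n) - X n)"
  proof (rule summable_comparison_test')
    show "summable (\<lambda>n. \<theta> ^ n * N (X 1 - X 0))"
      using \<theta> by (intro summable_mult2 summable_geometric) auto
    show "norm (X (Suc n) - X n) \<le> \<theta> ^ n * N (X 1 - X 0)" for n
      using d[of n] N(1)[of "X (Suc n) - X n"] by simp
  qed
  then have "convergent (\<lambda>n. \<Sum>i<n. X (Suc i) - X i)"
    by (simp add: summable_iff_convergent)
  then have "convergent (\<lambda>n. X n - X 0)"
    by (simp add: sum_lessThan_telescope)
  then obtain y where y: "(\<lambda>n. X n - X 0) \<longlonglongrightarrow> y" by (auto simp: convergent_def)
  have lim: "X \<longlonglongrightarrow> y + X 0" using tendsto_add[OF y tendsto_const[of "X 0"]] by simp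
  let ?x = "y + X 0"
  have x: "?x \<in> S" by (rule closed_sequentially[OF S(1) X lim])
  have "(\<lambda>n. T ?x - X (Suc n)) \<longlonglongrightarrow> 0"
  proof (rule Lim_null_comparison)
    show "\<forall>\<^sub>F n in sequentially. norm (T ?x - X (Suc n)) \<le> \<theta> * (C * norm (?x - X n))"
    proof (intro always_eventually allI)
      fix n
      have "norm (T ?x - X (Suc n)) \<le> \<theta> * N (?x - X n)"
        using N(1)[of "T ?x - X (Suc n)"] T[OF x X, of n] by (simp add: XS)
      also have "\<dots> \<le> \<theta> * (C * norm (?x - X n))"
        using N(2) \<theta> by (intro mult_left_mono)
      finally show "norm (T ?x - X (Suc n)) \<le> \<theta> * (C * norm (?x - X n))" .
    qed
    have "(\<lambda>n. \<theta> * (C * norm (?x - X n))) \<longlonglongrightarrow> \<theta> * (C * norm (?x - ?x))"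
      by (intro tendsto_intros lim)
    then show "(\<lambda>n. \<theta> * (C * norm (?x - X n))) \<longlonglongrightarrow> 0" by simp
  qed
  then have "(\<lambda>n. T ?x - (T ?x - X (Suc n))) \<longlonglongrightarrow> T ?x - 0" by (intro tendsto_intros)
  then have "(\<lambda>n. X (Suc n)) \<longlonglongrightarrow> T ?x" by simp
  moreover have "(\<lambda>n. X (Suc n)) \<longlonglongrightarrow> ?x" using lim by (rule LIMSEQ_Suc)
  ultimately have "T ?x = ?x" by (rule LIMSEQ_unique)
  with x show ?thesis by blast
qed

section \<open>The conjugacy equation and the inversion equation on the unit polydisk\<close>

lemma single_power_fst: "single (1, 0) a ^ n = single (n, 0) (a ^ n)"
  and single_power_snd: "single (0, 1) a ^ n = single (0, n) (a ^ n)"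
  for a :: "'a::comm_banach_algebra" and n :: nat
  by (induction n) (simp_all add: one_l1_def zero_prod_def single_times_single)

lemma supported_cmp_linear:
  fixes a b :: "'a::comm_banach_algebra"
  assumes "\<And>k. k \<notin> U \<Longrightarrow> c k = 0" "wconv c s t" "norm a \<le> s" "norm b \<le> t"
  shows "supported (cmp c (single (1, 0) a) (single (0, 1) b)) U"
proof (rule supported_has_sum[OF cmp_has_sum[OF assms(2)]])
  fix k :: "nat \<times> nat"
  have "single 0 (c k) * (single (1, 0) a ^ fst k * single (0, 1) b ^ snd k)
    = single k (c k * (a ^ fst k * b ^ snd k))"
    by (cases k) (simp add: single_power_fst[unfolded One_nat_def] single_power_snd[unfolded One_nat_def]
        single_times_single zero_prod_def prod_eq_iff)
  then show "supported (single 0 (c k) * (single (1, 0) a ^ fst k * single (0, 1) b ^ snd k)) U"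
    using assms(1) by (cases "k \<in> U") (auto simp: supported_def cf_single)
qed (use assms in auto)

lemma single_one_zero_mult: 
  fixes a b :: "'a::comm_banach_algebra" and F :: "'a ps2"
  shows "a * b = 1 \<Longrightarrow> single 0 a * (single 0 b * F) = F"
  by (simp add: mult.assoc[symmetric] single_times_single flip: one_l1_def)

lemma supported_single0_mult:
  "supported F U \<Longrightarrow> supported (single 0 a * F) U" 
  for F :: "'a::comm_banach_algebra ps2"
  by (rule supported_times[OF supported_single]) auto

lemma wsum_supported:
  fixes F :: "'a::real_normed_vector ps2"
  assumes "supported F U" "\<And>k. k \<in> U \<Longrightarrow> weight s t k \<le> B" "0 \<le> s" "0 \<le> t"
  shows "wconv (cf F) s t" "wsum (cf F) s t \<le> B * norm F"
  by (rule wconv_cf; use assms in \<open>auto simp: supported_def\<close>)+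

text \<open>The Lipschitz estimate behind the conjugacy equation, for one component of the map. On the projection to \<open>U\<close> the factor \<open>\<theta>\<close> is the
contraction by the linear part. On the complement, \<open>\<phi> \<circ> L\<close> contributes nothing because \<open>L\<close> is diagonal and keeps the support in
\<open>U\<close>; all that remains is of the size of the small quantities \<open>\<epsilon>\<close> and \<open>\<eta>\<close>.\<close>

lemma step_component_lipschitz:
  fixes \<mu>1 \<mu>2 \<nu> :: "'a::comm_banach_algebra"
    and F :: "nat \<times> nat \<Rightarrow> 'a" and \<phi> \<phi>' \<gamma>1 \<gamma>2 \<gamma>1' \<gamma>2' p1 p2 p1' p2' :: "'a ps2"
  defines "L1 \<equiv> single (1, 0) \<mu>1" and "L2 \<equiv> single (0, 1) \<mu>2"
    and "X1 \<equiv> single (1, 0) 1" and "X2 \<equiv> single (0, 1) 1"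
  assumes \<nu>: "\<nu> \<noteq> 0" "norm \<nu> \<le> N"
    and U: "\<And>k. k \<in> U \<Longrightarrow> norm \<nu> * weight s t k \<le> \<theta>" "\<And>k. k \<in> U \<Longrightarrow> weight s t k \<le> N"
    and \<sigma>: "0 < \<sigma>" "norm \<mu>1 + 2 * \<sigma> \<le> s" "norm \<mu>2 + 2 * \<sigma> \<le> t"
    and F: "wconv F 2 2" "wsum F 2 2 \<le> \<eta>"
    and \<epsilon>: "0 < \<epsilon>" "\<epsilon> \<le> 1/2" "\<epsilon> \<le> \<sigma>"
    and \<phi>: "supported \<phi> U" "supported \<phi>' U" "norm \<phi>' \<le> \<epsilon>"
    and \<gamma>: "norm \<gamma>1 + norm \<gamma>2 \<le> \<epsilon>" "norm \<gamma>1' + norm \<gamma>2' \<le> \<epsilon>"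
    and p: "norm p1 + norm p2 \<le> \<epsilon>" "norm p1' + norm p2' \<le> \<epsilon>"
  defines "A \<equiv> cmp (cf \<phi>) (L1 + \<gamma>1) (L2 + \<gamma>2) - cmp F (X1 + p1) (X2 + p2)"
    and "A' \<equiv> cmp (cf \<phi>') (L1 + \<gamma>1') (L2 + \<gamma>2') - cmp F (X1 + p1') (X2 + p2')"
    and "b \<equiv> N * \<epsilon> / \<sigma> * (norm (\<gamma>1 - \<gamma>1') + norm (\<gamma>2 - \<gamma>2')) + 2 * \<eta> * (norm (p1 - p1') + norm (p2 - p2'))"
  shows "norm (single 0 \<nu> * proj U A - single 0 \<nu> * proj U A') \<le> \<theta> * norm (\<phi> - \<phi>') + N * b"
    and "norm (proj (- U) A - proj (- U) A') \<le> N * \<epsilon> / \<sigma> * norm (\<phi> - \<phi>') + b"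
proof -
  have N: "0 < N" using \<nu> by (meson le_less_trans less_le_trans norm_ge_zero zero_less_norm_iff)
  have st: "0 \<le> s" "0 \<le> t" using \<sigma> norm_ge_zero[of \<mu>1] norm_ge_zero[of \<mu>2] by linarith+
  have nL: "norm (L1 + g1) \<le> s - \<sigma>" "norm (L2 + g2) \<le> t - \<sigma>" if "norm g1 + norm g2 \<le> \<epsilon>" for g1 g2
    using norm_triangle_ineq[of L1 g1] norm_triangle_ineq[of L2 g2] that \<sigma> \<epsilon> norm_ge_zero[of g1] norm_ge_zero[of g2]
    unfolding L1_def L2_def norm_single by linarith+
  have nX: "norm (X1 + g1) \<le> 2 - 1/2" "norm (X2 + g2) \<le> 2 - 1/2" if "norm g1 + norm g2 \<le> \<epsilon>" for g1 g2
    using norm_triangle_ineq[of X1 g1] norm_triangle_ineq[of X2 g2] that \<epsilon> norm_ge_zero[of g1] norm_ge_zero[of g2]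
    unfolding X1_def X2_def norm_single norm_one by linarith+
  define D where "D = \<phi> - \<phi>'"
  have D: "supported D U" unfolding D_def by (intro supported_ops \<phi>)
  have cD: "cf D = (\<lambda>k. cf \<phi> k - cf \<phi>' k)" by (rule ext) (simp add: D_def)
  note w = wsum_supported[OF _ U(2) st]
  define B where "B = (cmp (cf \<phi>') (L1 + \<gamma>1) (L2 + \<gamma>2) - cmp (cf \<phi>') (L1 + \<gamma>1') (L2 + \<gamma>2'))
    - (cmp F (X1 + p1) (X2 + p2) - cmp F (X1 + p1') (X2 + p2'))"
  have AB: "A - A' = cmp (cf D) (L1 + \<gamma>1) (L2 + \<gamma>2) + B"
    unfolding A_def A'_def B_def cD
    by (subst cmp_diff[OF w(1)[OF \<phi>(1)] w(1)[OF \<phi>(2)]]) (use nL[OF \<gamma>(1)] \<sigma> in auto)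
  have "norm (cmp (cf \<phi>') (L1 + \<gamma>1) (L2 + \<gamma>2) - cmp (cf \<phi>') (L1 + \<gamma>1') (L2 + \<gamma>2'))
    \<le> wsum (cf \<phi>') s t / \<sigma> * (norm ((L1 + \<gamma>1) - (L1 + \<gamma>1')) + norm ((L2 + \<gamma>2) - (L2 + \<gamma>2')))"
    by (rule cmp_lipschitz[OF w(1)[OF \<phi>(2)] nL[OF \<gamma>(1)] nL[OF \<gamma>(2)] \<sigma>(1)])
  also have "\<dots> \<le> N * \<epsilon> / \<sigma> * (norm ((L1 + \<gamma>1) - (L1 + \<gamma>1')) + norm ((L2 + \<gamma>2) - (L2 + \<gamma>2')))"
  proof -
    have "wsum (cf \<phi>') s t \<le> N * norm \<phi>'" by (rule w(2)[OF \<phi>(2)])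
    also have "\<dots> \<le> N * \<epsilon>" using \<phi>(3) N by (intro mult_left_mono) auto
    finally show ?thesis using \<sigma>(1) by (intro mult_right_mono divide_right_mono) auto
  qed
  finally have B1: "norm (cmp (cf \<phi>') (L1 + \<gamma>1) (L2 + \<gamma>2) - cmp (cf \<phi>') (L1 + \<gamma>1') (L2 + \<gamma>2'))
    \<le> N * \<epsilon> / \<sigma> * (norm (\<gamma>1 - \<gamma>1') + norm (\<gamma>2 - \<gamma>2'))" by simp
  have "norm (cmp F (X1 + p1) (X2 + p2) - cmp F (X1 + p1') (X2 + p2'))
    \<le> wsum F 2 2 / (1/2) * (norm ((X1 + p1) - (X1 + p1')) + norm ((X2 + p2) - (X2 + p2')))"
    by (rule cmp_lipschitz[OF F(1) nX[OF p(1)] nX[OF p(2)]]) simp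
  also have "\<dots> \<le> \<eta> / (1/2) * (norm ((X1 + p1) - (X1 + p1')) + norm ((X2 + p2) - (X2 + p2')))"
    using F(2) by (intro mult_right_mono divide_right_mono) auto
  finally have B2: "norm (cmp F (X1 + p1) (X2 + p2) - cmp F (X1 + p1') (X2 + p2'))
    \<le> 2 * \<eta> * (norm (p1 - p1') + norm (p2 - p2'))" by (simp add: mult.commute)
  have B: "norm B \<le> b"
    unfolding B_def b_def by (rule order.trans[OF norm_triangle_ineq4 add_mono[OF B1 B2]])
  have \<nu>0: "norm \<nu> > 0" using \<nu> by simp
  have "weight s t k \<le> \<theta> / norm \<nu>" if "k \<in> U" for k
    using U(1)[OF that] \<nu>0 by (simp add: field_simps)
  note w\<theta> = wsum_supported[OF D this st]
  have "norm (single 0 \<nu> * proj U (A - A')) \<le> norm \<nu> * norm (A - A')"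
    by (intro order.trans[OF norm_mult_ineq] mult_mono norm_proj_le) auto
  also have "\<dots> \<le> norm \<nu> * (\<theta> / norm \<nu> * norm D + b)"
  proof (intro mult_left_mono)
    have "norm (cmp (cf D) (L1 + \<gamma>1) (L2 + \<gamma>2)) \<le> wsum (cf D) s t"
      by (rule norm_cmp_le[OF w\<theta>(1)]) (use nL[OF \<gamma>(1)] \<sigma> in auto)
    then have "norm (cmp (cf D) (L1 + \<gamma>1) (L2 + \<gamma>2)) \<le> \<theta> / norm \<nu> * norm D"
      using w\<theta>(2) by linarith
    then show "norm (A - A') \<le> \<theta> / norm \<nu> * norm D + b"
      unfolding AB by (intro order.trans[OF norm_triangle_ineq] add_mono B)
  qed simp
  also have "\<dots> = \<theta> * norm D + norm \<nu> * b" using \<nu>0 by (simp add: field_simps)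
  also have "\<dots> \<le> \<theta> * norm D + N * b"
    using \<nu> order.trans[OF norm_ge_zero B] by (intro add_left_mono mult_right_mono) auto
  finally show "norm (single 0 \<nu> * proj U A - single 0 \<nu> * proj U A') \<le> \<theta> * norm (\<phi> - \<phi>') + N * b"
    by (simp add: proj_diff right_diff_distrib D_def)
  have "supported (cmp (cf D) L1 L2) U"
    unfolding L1_def L2_def by (rule supported_cmp_linear[OF _ w(1)[OF D]]) (use D \<sigma> in \<open>auto simp: supported_def\<close>)
  then have z: "proj (- U) (cmp (cf D) L1 L2) = 0"
    by (auto intro!: l1_eqI simp: supported_def cf_proj)
  have AB': "(cmp (cf D) (L1 + \<gamma>1) (L2 + \<gamma>2) - cmp (cf D) L1 L2) + B = (A - A') - cmp (cf D) L1 L2"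
    by (simp add: AB)
  have "proj (- U) A - proj (- U) A' = proj (- U) ((cmp (cf D) (L1 + \<gamma>1) (L2 + \<gamma>2) - cmp (cf D) L1 L2) + B)"
    unfolding AB' proj_diff z by simp
  also have "norm \<dots> \<le> norm ((cmp (cf D) (L1 + \<gamma>1) (L2 + \<gamma>2) - cmp (cf D) L1 L2) + B)"
    by (rule norm_proj_le)
  also have "\<dots> \<le> N * \<epsilon> / \<sigma> * norm D + b"
  proof (intro order.trans[OF norm_triangle_ineq] add_mono B)
    have n0: "norm L1 \<le> s - \<sigma>" "norm L2 \<le> t - \<sigma>" using nL[of 0 0] \<epsilon> by auto
    have "norm (cmp (cf D) (L1 + \<gamma>1) (L2 + \<gamma>2) - cmp (cf D) L1 L2)
      \<le> wsum (cf D) s t / \<sigma> * (norm ((L1 + \<gamma>1) - L1) + norm ((L2 + \<gamma>2) - L2))"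
      by (rule cmp_lipschitz[OF w(1)[OF D] nL[OF \<gamma>(1)] n0 \<sigma>(1)])
    also have "\<dots> \<le> (N * norm D) / \<sigma> * \<epsilon>"
      using w(2)[OF D] \<sigma>(1) \<gamma>(1) N by (intro mult_mono divide_right_mono) auto
    finally show "norm (cmp (cf D) (L1 + \<gamma>1) (L2 + \<gamma>2) - cmp (cf D) L1 L2) \<le> N * \<epsilon> / \<sigma> * norm D"
      by (simp add: mult_ac)
  qed
  finally show "norm (proj (- U) A - proj (- U) A') \<le> N * \<epsilon> / \<sigma> * norm (\<phi> - \<phi>') + b"
    by (simp add: D_def)
qed

text \<open>The conjugacy equation \<open>f \<circ> (id + \<phi>) = (id + \<phi>) \<circ> (L + \<gamma>)\<close> for \<open>f = L + F\<close> with \<open>F\<close> small. Its projection to \<open>U\<close>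
determines \<open>\<phi>\<close> and the complementary projection determines \<open>\<gamma>\<close>; together they form a contraction on the pairs \<open>(\<phi>, \<gamma>)\<close> of
small norm. Since the iteration preserves the exponents in \<open>M\<close>, so does its limit.\<close>

lemma step_unit:
  fixes \<mu>1 \<mu>2 \<nu>1 \<nu>2 :: "'a::comm_banach_algebra"
    and F1 F2 :: "nat \<times> nat \<Rightarrow> 'a"
  defines "L1 \<equiv> single (1, 0) \<mu>1" and "L2 \<equiv> single (0, 1) \<mu>2"
    and "X1 \<equiv> single (1, 0) 1" and "X2 \<equiv> single (0, 1) 1"
  assumes M: "expset M"
    and Fs: "\<And>k. k \<notin> exps1 M \<Longrightarrow> F1 k = 0" "\<And>k. k \<notin> exps2 M \<Longrightarrow> F2 k = 0"
    and \<mu>\<nu>: "\<mu>1 * \<nu>1 = 1" "\<mu>2 * \<nu>2 = 1" 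
    and N: "1 \<le> N" "norm \<nu>1 \<le> N" "norm \<nu>2 \<le> N"
    and U1: "\<And>k. k \<in> U1 \<Longrightarrow> norm \<nu>1 * weight s t k \<le> \<theta>" "\<And>k. k \<in> U1 \<Longrightarrow> weight s t k \<le> N"
    and U2: "\<And>k. k \<in> U2 \<Longrightarrow> norm \<nu>2 * weight s t k \<le> \<theta>" "\<And>k. k \<in> U2 \<Longrightarrow> weight s t k \<le> N"
    and \<sigma>: "0 < \<sigma>" "norm \<mu>1 + 2 * \<sigma> \<le> s" "norm \<mu>2 + 2 * \<sigma> \<le> t"
    and F: "wconv F1 2 2" "wsum F1 2 2 \<le> \<eta>" "wconv F2 2 2" "wsum F2 2 2 \<le> \<eta>"
    and \<theta>: "0 \<le> \<theta>" "\<theta> < 1"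
    and \<epsilon>: "0 < \<epsilon>" "\<epsilon> \<le> 1/2" "\<epsilon> \<le> \<sigma>" "16 * N * N * \<epsilon> / \<sigma> \<le> 1 - \<theta>" 
    and \<eta>: "16 * N * \<eta> \<le> (1 - \<theta>) * \<epsilon>"
  obtains \<phi>1 \<phi>2 \<gamma>1 \<gamma>2 where
    "supported \<phi>1 (exps1 M \<inter> U1)" "supported \<phi>2 (exps2 M \<inter> U2)"
    "supported \<gamma>1 (exps1 M - U1)" "supported \<gamma>2 (exps2 M - U2)"
    "norm \<phi>1 \<le> \<epsilon>" "norm \<phi>2 \<le> \<epsilon>" "norm \<gamma>1 \<le> \<epsilon>" "norm \<gamma>2 \<le> \<epsilon>"
    "single 0 \<mu>1 * \<phi>1 + cmp F1 (X1 + \<phi>1) (X2 + \<phi>2) = \<gamma>1 + cmp (cf \<phi>1) (L1 + \<gamma>1) (L2 + \<gamma>2)"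
    "single 0 \<mu>2 * \<phi>2 + cmp F2 (X1 + \<phi>1) (X2 + \<phi>2) = \<gamma>2 + cmp (cf \<phi>2) (L1 + \<gamma>1) (L2 + \<gamma>2)"
proof -
  let ?E1 = "exps1 M" and ?E2 = "exps2 M"
  define nn :: "'a ps2 \<times> 'a ps2 \<times> 'a ps2 \<times> 'a ps2 \<Rightarrow> real"
    where "nn = (\<lambda>(\<phi>1, \<phi>2, \<gamma>1, \<gamma>2). norm \<phi>1 + norm \<phi>2 + norm \<gamma>1 + norm \<gamma>2)"
  define A1 where "A1 = (\<lambda>(\<phi>1, \<phi>2, \<gamma>1, \<gamma>2). cmp (cf \<phi>1) (L1 + \<gamma>1) (L2 + \<gamma>2) - cmp F1 (X1 + \<phi>1) (X2 + \<phi>2))"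
  define A2 where "A2 = (\<lambda>(\<phi>1, \<phi>2, \<gamma>1, \<gamma>2). cmp (cf \<phi>2) (L1 + \<gamma>1) (L2 + \<gamma>2) - cmp F2 (X1 + \<phi>1) (X2 + \<phi>2))"
  \<comment> \<open>The equations to be solved are \<open>\<mu>\<^sub>i \<phi>\<^sub>i - \<gamma>\<^sub>i = A\<^sub>i\<close>, and \<open>\<phi>\<^sub>i\<close>, \<open>\<gamma>\<^sub>i\<close> have disjoint supports.\<close>
  define T where "T x = (single 0 \<nu>1 * proj U1 (A1 x), single 0 \<nu>2 * proj U2 (A2 x), - proj (- U1) (A1 x), - proj (- U2) (A2 x))" for x
  define S where "S = {x :: 'a ps2 \<times> 'a ps2 \<times> 'a ps2 \<times> 'a ps2.
    supported (fst x) (?E1 \<inter> U1) \<and> supported (fst (snd x)) (?E2 \<inter> U2) \<and>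
    supported (fst (snd (snd x))) (?E1 - U1) \<and> supported (snd (snd (snd x))) (?E2 - U2) \<and> nn x \<le> \<epsilon>}"
  have nn_cont: "continuous_on UNIV nn"
    unfolding nn_def case_prod_unfold by (intro continuous_intros)
  have "closed S"
  proof -
    have cl: "closed {x. supported (f x) V}" if "continuous_on UNIV f"
      for f :: "'a ps2 \<times> 'a ps2 \<times> 'a ps2 \<times> 'a ps2 \<Rightarrow> 'a ps2" and V
      using continuous_closed_preimage[OF that closed_UNIV closed_supported[of V]] by (simp add: vimage_def)
    show ?thesis unfolding S_def
      by (intro closed_Collect_conj cl closed_Collect_le nn_cont continuous_intros)
  qed
  have N0: "nn (\<phi>1, \<phi>2, \<gamma>1, \<gamma>2) = norm \<phi>1 + norm \<phi>2 + norm \<gamma>1 + norm \<gamma>2" for \<phi>1 \<phi>2 \<gamma>1 \<gamma>2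
    by (simp add: nn_def)
  have norm_le: "norm x \<le> nn x" for x
  proof (cases x)
    case (fields a b c d)
    have "norm (a, b, c, d) \<le> norm a + (norm b + (norm c + norm d))"
      by (intro order.trans[OF norm_Pair_le] add_left_mono order.refl norm_Pair_le)
    then show ?thesis by (simp add: fields N0)
  qed
  have le_norm: "nn x \<le> 4 * norm x" for x
  proof (cases x)
    case (fields a b c d)
    have "norm a \<le> norm x" "norm (b, c, d) \<le> norm x" using norm_fst_le[of a "(b,c,d)"] norm_snd_le[of "(b,c,d)" a] fields by auto
    moreover have "norm b \<le> norm (b, c, d)" "norm (c, d) \<le> norm (b, c, d)" using norm_fst_le[of b "(c,d)"] norm_snd_le[of "(c,d)" b] by auto
    moreover have "norm c \<le> norm (c, d)" "norm d \<le> norm (c, d)" using norm_fst_le[of c d] norm_snd_le[of d c] by auto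
    ultimately show ?thesis by (simp add: fields N0)
  qed
  have \<nu>0: "\<nu>1 \<noteq> 0" "\<nu>2 \<noteq> 0" using \<mu>\<nu> by auto
  define a where "a = N * \<epsilon> / \<sigma>"
  have a: "0 \<le> a" "16 * (N * a) \<le> 1 - \<theta>" "16 * a \<le> 1 - \<theta>"
  proof -
    show a0: "0 \<le> a" using N \<epsilon> \<sigma> by (simp add: a_def)
    show *: "16 * (N * a) \<le> 1 - \<theta>" using \<epsilon>(4) by (simp add: a_def mult_ac)
    have "a \<le> N * a" using N a0 by (simp add: mult_le_cancel_right1)
    then show "16 * a \<le> 1 - \<theta>" using * by linarith
  qed
  have \<eta>0: "0 \<le> \<eta>" using wsum_nonneg[of 2 2 F1] F(2) by simp
  have N\<eta>: "32 * (N * \<eta>) \<le> 1 - \<theta>" "32 * \<eta> \<le> 1 - \<theta>"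
  proof -
    have "(1 - \<theta>) * \<epsilon> \<le> (1 - \<theta>) * (1 / 2)" using \<epsilon>(2) \<theta> by (intro mult_left_mono) auto
    then show *: "32 * (N * \<eta>) \<le> 1 - \<theta>" using \<eta> by (simp add: mult.assoc)
    have "\<eta> \<le> N * \<eta>" using N \<eta>0 by (simp add: mult_le_cancel_right1)
    then show "32 * \<eta> \<le> 1 - \<theta>" using * by linarith
  qed
  have lip: "nn (T x - T y) \<le> (1 + \<theta>) / 2 * nn (x - y)" if xy: "x \<in> S" "y \<in> S" for x y
  proof (cases x; cases y)
    fix f1 f2 g1 g2 f1' f2' g1' g2'
    assume x: "x = (f1, f2, g1, g2)" and y: "y = (f1', f2', g1', g2')"
    have sup: "supported f1 U1" "supported f1' U1" "supported f2 U2" "supported f2' U2"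
      using xy x y by (auto simp: S_def intro: supported_mono)
    have bd: "norm f1' \<le> \<epsilon>" "norm f2' \<le> \<epsilon>" "norm g1 + norm g2 \<le> \<epsilon>" "norm g1' + norm g2' \<le> \<epsilon>"
       "norm f1 + norm f2 \<le> \<epsilon>" "norm f1' + norm f2' \<le> \<epsilon>"
      using xy norm_ge_zero[of f1] norm_ge_zero[of f2] norm_ge_zero[of f1'] norm_ge_zero[of f2']
        norm_ge_zero[of g1] norm_ge_zero[of g2] norm_ge_zero[of g1'] norm_ge_zero[of g2']
      by (auto simp: S_def N0 x y simp del: norm_ge_zero)
    note l1 = step_component_lipschitz[OF \<nu>0(1) N(2) U1 \<sigma> F(1,2) \<epsilon>(1-3) sup(1,2) bd(1,3-6), folded L1_def L2_def X1_def X2_def]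
    note l2 = step_component_lipschitz[OF \<nu>0(2) N(3) U2 \<sigma> F(3,4) \<epsilon>(1-3) sup(3,4) bd(2,3-6), folded L1_def L2_def X1_def X2_def]
    define P where "P = norm (f1 - f1') + norm (f2 - f2')"
    define G where "G = norm (g1 - g1') + norm (g2 - g2')"
    have PG: "0 \<le> P" "0 \<le> G" by (auto simp: P_def G_def)
    have "nn (T x - T y) \<le> \<theta> * P + a * P + 2 * N * (a * G + 2 * \<eta> * P) + 2 * (a * G + 2 * \<eta> * P)"
      using l1 l2 unfolding x y T_def A1_def A2_def prod.case minus_prod_def fst_conv snd_conv N0 
        a_def[symmetric] P_def[symmetric] G_def[symmetric] minus_diff_minus norm_minus_cancel
      by (simp add: P_def distrib_left)
    also have "\<dots> = (\<theta> + a + 4 * (N * \<eta>) + 4 * \<eta>) * P + (2 * (N * a) + 2 * a) * G"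
      by (simp add: algebra_simps)
    also have "\<dots> \<le> (1 + \<theta>) / 2 * P + (1 + \<theta>) / 2 * G"
      using a N\<eta> \<theta> PG by (intro add_mono mult_right_mono) auto
    also have "\<dots> = (1 + \<theta>) / 2 * nn (x - y)"
      by (simp add: x y N0 P_def G_def algebra_simps)
    finally show ?thesis .
  qed
  have zero: "0 \<in> S" using \<epsilon> by (simp add: S_def supported_ops nn_def zero_prod_def)
  have "nn (T 0) \<le> (1 - \<theta>) / 2 * \<epsilon>"
  proof -
    have n1: "norm (A1 0) \<le> \<eta>" "norm (A2 0) \<le> \<eta>"
    proof -
      have z: "cmp (cf 0) L1 L2 = 0" unfolding cmp_def by simp
      have "norm (cmp F1 X1 X2) \<le> wsum F1 2 2" "norm (cmp F2 X1 X2) \<le> wsum F2 2 2"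
        by (rule norm_cmp_le; use F in \<open>simp add: X1_def X2_def\<close>)+
      then show "norm (A1 0) \<le> \<eta>" "norm (A2 0) \<le> \<eta>"
        using F unfolding A1_def A2_def zero_prod_def by (auto simp: z)
    qed
    have "norm (single 0 \<nu>1 * proj U1 (A1 0)) \<le> N * \<eta>" "norm (single 0 \<nu>2 * proj U2 (A2 0)) \<le> N * \<eta>"
      using N by (intro order.trans[OF norm_mult_ineq] mult_mono order.trans[OF norm_proj_le n1(1)]
          order.trans[OF norm_proj_le n1(2)]; simp)+
    moreover have "norm (- proj (- U1) (A1 0)) \<le> \<eta>" "norm (- proj (- U2) (A2 0)) \<le> \<eta>"
      using order.trans[OF norm_proj_le n1(1)] order.trans[OF norm_proj_le n1(2)] by simp_all
    moreover have "\<eta> \<le> N * \<eta>" using N \<eta>0 by (simp add: mult_le_cancel_right1)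
    ultimately have "nn (T 0) \<le> 4 * (N * \<eta>)" unfolding T_def N0 by linarith
    also have "\<dots> \<le> (1 - \<theta>) / 2 * \<epsilon>"
    proof -
      have "0 \<le> N * \<eta>" using N \<eta>0 by simp
      then show ?thesis using \<eta> by (simp add: algebra_simps)
    qed
    finally show ?thesis .
  qed
  note T0 = this
  have TS: "T x \<in> S" if "x \<in> S" for x
  proof (cases x)
    case (fields f1 f2 g1 g2)
    have "nn (T x) \<le> nn (T x - T 0) + nn (T 0)"
    proof -
      have "nn (u + v) \<le> nn u + nn v" for u v
      proof (cases u; cases v)
        fix a b c d a' b' c' d' assume "u = (a,b,c,d)" "v = (a',b',c',d')"
        then show ?thesis
          using norm_triangle_ineq[of a a'] norm_triangle_ineq[of b b'] norm_triangle_ineq[of c c'] norm_triangle_ineq[of d d']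
          by (simp add: N0)
      qed
      from this[of "T x - T 0" "T 0"] show ?thesis by simp
    qed
    also have "\<dots> \<le> (1 + \<theta>) / 2 * nn (x - 0) + (1 - \<theta>) / 2 * \<epsilon>"
      by (intro add_mono lip that zero T0)
    also have "\<dots> \<le> (1 + \<theta>) / 2 * \<epsilon> + (1 - \<theta>) / 2 * \<epsilon>"
      using that \<theta> by (intro add_right_mono mult_left_mono) (auto simp: S_def)
    finally have n: "nn (T x) \<le> \<epsilon>" by (simp add: field_simps)
    have sub: "shifted (M - {0}) e \<subseteq> shifted M e" for e by (auto simp: shifted_def)
    have sf: "supported f1 ?E1" "supported f2 ?E2" "supported g1 ?E1" "supported g2 ?E2" 
      "supported f1 U1" "supported f2 U2" "nn (f1, f2, g1, g2) \<le> \<epsilon>"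
      using that fields by (auto simp: S_def intro: supported_mono)
    have e: "supported (single (1, 0) c) (shifted M (1, 0))" "supported (single (0, 1) c) (shifted M (0, 1))" for c :: 'a
      using M by (auto intro!: supported_mono[OF supported_single] simp: shifted_def toZ_def expset_def zero_prod_def)
    have sH: "supported (X1 + f1) (shifted M (1, 0))" "supported (X2 + f2) (shifted M (0, 1))"
       "supported (L1 + g1) (shifted M (1, 0))" "supported (L2 + g2) (shifted M (0, 1))"
      unfolding X1_def X2_def L1_def L2_def
      by (intro supported_ops e supported_mono[OF sf(1) sub] supported_mono[OF sf(2) sub]
          supported_mono[OF sf(3) sub] supported_mono[OF sf(4) sub])+
    have st: "0 \<le> s" "0 \<le> t" using \<sigma> norm_ge_zero[of \<mu>1] norm_ge_zero[of \<mu>2] by linarith+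
    have nH: "norm (X1 + f1) \<le> 2" "norm (X2 + f2) \<le> 2" "norm (L1 + g1) \<le> s" "norm (L2 + g2) \<le> t"
      using norm_triangle_ineq[of X1 f1] norm_triangle_ineq[of X2 f2] norm_triangle_ineq[of L1 g1] norm_triangle_ineq[of L2 g2]
        sf(7) \<epsilon> \<sigma> norm_ge_zero[of f1] norm_ge_zero[of f2] norm_ge_zero[of g1] norm_ge_zero[of g2]
      unfolding N0 X1_def X2_def L1_def L2_def norm_single norm_one by linarith+
    have c: "cf f1 k = 0" if "k \<notin> ?E1" for k using sf(1) that unfolding supported_def by blast
    have c': "cf f2 k = 0" if "k \<notin> ?E2" for k using sf(2) that unfolding supported_def by blast
    have sA: "supported (A1 x) ?E1" "supported (A2 x) ?E2"
      unfolding A1_def A2_def fields prod.case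
      by (intro supported_ops supported_cmp[OF M Fs(1) sH(1,2) F(1) nH(1,2)]
        supported_cmp[OF M Fs(2) sH(1,2) F(3) nH(1,2)]
        supported_cmp[OF M c sH(3,4) wsum_supported(1)[OF sf(5) U1(2) st] nH(3,4)]
        supported_cmp[OF M c' sH(3,4) wsum_supported(1)[OF sf(6) U2(2) st] nH(3,4)]; assumption)+
    have "supported (single 0 \<nu>1 * proj U1 (A1 x)) (?E1 \<inter> U1)" "supported (single 0 \<nu>2 * proj U2 (A2 x)) (?E2 \<inter> U2)"
      "supported (- proj (- U1) (A1 x)) (?E1 - U1)" "supported (- proj (- U2) (A2 x)) (?E2 - U2)"
      using supported_proj[OF sA(1), of U1] supported_proj[OF sA(1), of "- U1"] supported_proj[OF sA(2), of U2] supported_proj[OF sA(2), of "- U2"]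
      by (auto intro!: supported_single0_mult supported_ops elim!: supported_mono)
    then show ?thesis using n unfolding S_def T_def by simp
  qed
  obtain x where x: "x \<in> S" "T x = x"
    using contraction_fixpoint[OF \<open>closed S\<close> zero TS norm_le le_norm _ _ lip] \<theta> by auto
  obtain f1 f2 g1 g2 where fields: "x = (f1, f2, g1, g2)" by (cases x)
  have eq: "f1 = single 0 \<nu>1 * proj U1 (A1 x)" "f2 = single 0 \<nu>2 * proj U2 (A2 x)"
    "g1 = - proj (- U1) (A1 x)" "g2 = - proj (- U2) (A2 x)"
    using x(2) by (simp_all add: T_def fields)
  have "single 0 \<mu>1 * f1 - g1 = proj U1 (A1 x) + proj (- U1) (A1 x)"
    by (simp add: eq(1,3) single_one_zero_mult[OF \<mu>\<nu>(1)])
  then have e1: "single 0 \<mu>1 * f1 - g1 = A1 x" by (simp add: proj_add_compl)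
  have "single 0 \<mu>2 * f2 - g2 = proj U2 (A2 x) + proj (- U2) (A2 x)"
    by (simp add: eq(2,4) single_one_zero_mult[OF \<mu>\<nu>(2)])
  then have e2: "single 0 \<mu>2 * f2 - g2 = A2 x" by (simp add: proj_add_compl)
  show ?thesis
  proof (rule that[of f1 f2 g1 g2])
    show "single 0 \<mu>1 * f1 + cmp F1 (X1 + f1) (X2 + f2) = g1 + cmp (cf f1) (L1 + g1) (L2 + g2)"
      using e1 unfolding A1_def fields prod.case by (simp add: algebra_simps)
    show "single 0 \<mu>2 * f2 + cmp F2 (X1 + f1) (X2 + f2) = g2 + cmp (cf f2) (L1 + g1) (L2 + g2)"
      using e2 unfolding A2_def fields prod.case by (simp add: algebra_simps)
    show "norm f1 \<le> \<epsilon>" "norm f2 \<le> \<epsilon>" "norm g1 \<le> \<epsilon>" "norm g2 \<le> \<epsilon>"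
      using x(1) norm_ge_zero[of f1] norm_ge_zero[of f2] norm_ge_zero[of g1] norm_ge_zero[of g2]
      unfolding S_def fields by (auto simp: N0 simp del: norm_ge_zero)
  qed (use x(1) in \<open>auto simp: S_def fields\<close>)
qed

text \<open>A right inverse \<open>L\<^sup>-\<^sup>1 + \<psi>\<close> of \<open>L + F\<close>: the equation \<open>\<psi> = - L\<^sup>-\<^sup>1 F \<circ> (L\<^sup>-\<^sup>1 + \<psi>)\<close> is a contraction for small \<open>F\<close>.\<close>

lemma inverse_unit:
  fixes \<mu>1 \<mu>2 \<nu>1 \<nu>2 :: "'a::comm_banach_algebra"
    and F1 F2 :: "nat \<times> nat \<Rightarrow> 'a"
  defines "K1 \<equiv> single (1, 0) \<nu>1" and "K2 \<equiv> single (0, 1) \<nu>2"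
  assumes M: "expset M"
    and Fs: "\<And>k. k \<notin> exps1 M \<Longrightarrow> F1 k = 0" "\<And>k. k \<notin> exps2 M \<Longrightarrow> F2 k = 0"
    and \<mu>\<nu>: "\<mu>1 * \<nu>1 = 1" "\<mu>2 * \<nu>2 = 1" 
    and N: "norm \<nu>1 \<le> N" "norm \<nu>2 \<le> N"
    and F: "wconv F1 (N + 2) (N + 2)" "wsum F1 (N + 2) (N + 2) \<le> \<eta>" "wconv F2 (N + 2) (N + 2)" "wsum F2 (N + 2) (N + 2) \<le> \<eta>"
    and \<eta>: "4 * N * \<eta> \<le> 1"
  obtains \<psi>1 \<psi>2 where
    "supported \<psi>1 (exps1 M)" "supported \<psi>2 (exps2 M)"
    "norm \<psi>1 \<le> 1" "norm \<psi>2 \<le> 1"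
    "single 0 \<mu>1 * \<psi>1 + cmp F1 (K1 + \<psi>1) (K2 + \<psi>2) = 0"
    "single 0 \<mu>2 * \<psi>2 + cmp F2 (K1 + \<psi>1) (K2 + \<psi>2) = 0"
proof -
  let ?E1 = "exps1 M" and ?E2 = "exps2 M"
  define nn :: "'a ps2 \<times> 'a ps2 \<Rightarrow> real" where "nn = (\<lambda>(a, b). norm a + norm b)"
  have N0: "nn (a, b) = norm a + norm b" for a b by (simp add: nn_def)
  define T where "T = (\<lambda>(a, b). (- (single 0 \<nu>1 * cmp F1 (K1 + a) (K2 + b)), - (single 0 \<nu>2 * cmp F2 (K1 + a) (K2 + b))))"
  define S where "S = {x :: 'a ps2 \<times> 'a ps2. supported (fst x) ?E1 \<and> supported (snd x) ?E2 \<and> nn x \<le> 1}"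
  have nn_cont: "continuous_on UNIV nn"
    unfolding nn_def case_prod_unfold by (intro continuous_intros)
  have "closed S"
  proof -
    have cl: "closed {x. supported (f x) V}" if "continuous_on UNIV f"
      for f :: "'a ps2 \<times> 'a ps2 \<Rightarrow> 'a ps2" and V
      using continuous_closed_preimage[OF that closed_UNIV closed_supported[of V]] by (simp add: vimage_def)
    show ?thesis unfolding S_def
      by (intro closed_Collect_conj cl closed_Collect_le nn_cont continuous_intros)
  qed
  have norm_le: "norm x \<le> nn x" for x
    by (cases x) (simp add: N0 norm_Pair_le)
  have le_norm: "nn x \<le> 2 * norm x" for x
    using norm_fst_le[of "fst x" "snd x"] norm_snd_le[of "snd x" "fst x"] by (cases x) (simp add: N0)
  have N1: "0 \<le> N" using N norm_ge_zero order_trans by blast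
  have nK: "norm (K1 + a) \<le> N + 2 - 1" "norm (K2 + b) \<le> N + 2 - 1" if "nn (a, b) \<le> 1" for a b
    using norm_triangle_ineq[of K1 a] norm_triangle_ineq[of K2 b] that N norm_ge_zero[of a] norm_ge_zero[of b]
    unfolding K1_def K2_def norm_single N0 by linarith+
  have \<eta>0: "0 \<le> \<eta>" using wsum_nonneg[of "N+2" "N+2" F1] F(2) N1 by simp
  have lip: "nn (T x - T y) \<le> 1 / 2 * nn (x - y)" if xy: "x \<in> S" "y \<in> S" for x y
  proof (cases x; cases y)
    fix a b a' b' assume x: "x = (a, b)" and y: "y = (a', b')"
    have l: "norm (single 0 \<nu> * cmp F (K1 + a) (K2 + b) - single 0 \<nu> * cmp F (K1 + a') (K2 + b')) \<le> N * (\<eta> * nn (x - y))"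
      if "wconv F (N + 2) (N + 2)" "wsum F (N + 2) (N + 2) \<le> \<eta>" "norm \<nu> \<le> N" for F and \<nu> :: 'a
    proof -
      have xy': "nn (a, b) \<le> 1" "nn (a', b') \<le> 1" using xy by (auto simp: S_def x y)
      have "norm (cmp F (K1 + a) (K2 + b) - cmp F (K1 + a') (K2 + b'))
        \<le> wsum F (N + 2) (N + 2) / 1 * (norm ((K1 + a) - (K1 + a')) + norm ((K2 + b) - (K2 + b')))"
        by (rule cmp_lipschitz[OF that(1) nK[OF xy'(1)] nK[OF xy'(2)]]) simp
      also have "\<dots> \<le> \<eta> * nn (x - y)"
        using that(2) by (auto simp: x y N0 intro!: mult_right_mono)
      finally have *: "norm (cmp F (K1 + a) (K2 + b) - cmp F (K1 + a') (K2 + b')) \<le> \<eta> * nn (x - y)" .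
      have "norm (single 0 \<nu> * (cmp F (K1 + a) (K2 + b) - cmp F (K1 + a') (K2 + b'))) \<le> N * (\<eta> * nn (x - y))"
        using that(3) N1 by (intro order.trans[OF norm_mult_ineq] mult_mono *) auto
      then show ?thesis by (simp add: right_diff_distrib)
    qed
    have "nn (T x - T y) \<le> N * (\<eta> * nn (x - y)) + N * (\<eta> * nn (x - y))"
      using add_mono[OF l[OF F(1,2) N(1)] l[OF F(3,4) N(2)]]
      by (simp add: T_def x y N0 norm_minus_commute)
    also have "\<dots> = (2 * (N * \<eta>)) * nn (x - y)" by simp
    also have "\<dots> \<le> 1 / 2 * nn (x - y)"
      using \<eta> order.trans[OF norm_ge_zero norm_le] by (intro mult_right_mono) auto
    finally show ?thesis .
  qed
  have TS: "T x \<in> S" if "x \<in> S" for x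
  proof (cases x)
    case (Pair a b)
    have sub: "shifted (M - {0}) e \<subseteq> shifted M e" for e by (auto simp: shifted_def)
    have sf: "supported a ?E1" "supported b ?E2" "nn (a, b) \<le> 1"
      using that Pair by (auto simp: S_def)
    have e: "supported (single (1, 0) c) (shifted M (1, 0))" "supported (single (0, 1) c) (shifted M (0, 1))" for c :: 'a
      using M by (auto intro!: supported_mono[OF supported_single] simp: shifted_def toZ_def expset_def zero_prod_def)
    have sH: "supported (K1 + a) (shifted M (1, 0))" "supported (K2 + b) (shifted M (0, 1))"
      unfolding K1_def K2_def
      by (intro supported_ops e supported_mono[OF sf(1) sub] supported_mono[OF sf(2) sub])+
    have nH: "norm (K1 + a) \<le> N + 2" "norm (K2 + b) \<le> N + 2" using nK[OF sf(3)] by auto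
    have "supported (fst (T x)) ?E1" "supported (snd (T x)) ?E2"
      unfolding T_def Pair prod.case fst_conv snd_conv
      by (intro supported_ops supported_single0_mult supported_cmp[OF M Fs(1) sH F(1) nH]
          supported_cmp[OF M Fs(2) sH F(3) nH]; assumption)+
    moreover have "norm (- (single 0 \<nu>1 * cmp F1 (K1 + a) (K2 + b))) \<le> N * \<eta>"
      unfolding norm_minus_cancel using N N1
      by (intro order.trans[OF norm_mult_ineq] mult_mono order.trans[OF norm_cmp_le[OF F(1) nH] F(2)]) auto
    moreover have "norm (- (single 0 \<nu>2 * cmp F2 (K1 + a) (K2 + b))) \<le> N * \<eta>"
      unfolding norm_minus_cancel using N N1
      by (intro order.trans[OF norm_mult_ineq] mult_mono order.trans[OF norm_cmp_le[OF F(3) nH] F(4)]) auto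
    ultimately show ?thesis using \<eta> unfolding S_def T_def Pair by (simp add: N0)
  qed
  have zero: "0 \<in> S" by (simp add: S_def supported_ops nn_def zero_prod_def)
  obtain x where x: "x \<in> S" "T x = x"
    using contraction_fixpoint[OF \<open>closed S\<close> zero TS norm_le le_norm _ _ lip] by auto
  obtain a b where ab: "x = (a, b)" by (cases x)
  have eq: "a = - (single 0 \<nu>1 * cmp F1 (K1 + a) (K2 + b))" "b = - (single 0 \<nu>2 * cmp F2 (K1 + a) (K2 + b))"
    using x(2) by (simp_all add: T_def ab)
  show ?thesis
  proof (rule that[of a b])
    have "single 0 \<mu>1 * a = - (single 0 \<mu>1 * (single 0 \<nu>1 * cmp F1 (K1 + a) (K2 + b)))"
      by (subst eq(1)) simp
    then show "single 0 \<mu>1 * a + cmp F1 (K1 + a) (K2 + b) = 0"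
      by (simp add: single_one_zero_mult[OF \<mu>\<nu>(1)])
    have "single 0 \<mu>2 * b = - (single 0 \<mu>2 * (single 0 \<nu>2 * cmp F2 (K1 + a) (K2 + b)))"
      by (subst eq(2)) simp
    then show "single 0 \<mu>2 * b + cmp F2 (K1 + a) (K2 + b) = 0"
      by (simp add: single_one_zero_mult[OF \<mu>\<nu>(2)])
    have "nn (a, b) \<le> 1" using x(1) by (simp add: S_def ab)
    then show "norm a \<le> 1" "norm b \<le> 1" 
      using norm_ge_zero[of a] norm_ge_zero[of b] unfolding N0 by linarith+
  qed (use x(1) in \<open>auto simp: S_def ab\<close>)
qed

section \<open>Germs at the origin\<close>

definition germ :: "(nat \<times> nat \<Rightarrow> 'a::real_normed_vector) \<Rightarrow> bool" where
  "germ c \<longleftrightarrow> (\<exists>r>0. wconv c r r)"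

text \<open>The coefficients of \<open>x \<mapsto> c (\<delta> x) / \<delta>\<close>, which is one component of the conjugate of a map by the dilation with factor \<open>\<delta>\<close>.\<close>

definition rescale :: "real \<Rightarrow> (nat \<times> nat \<Rightarrow> 'a::real_normed_vector) \<Rightarrow> nat \<times> nat \<Rightarrow> 'a" where
  "rescale \<delta> c k = (\<delta> ^ (fst k + snd k) / \<delta>) *\<^sub>R c k"

lemma rescale_term:
  "0 < \<delta> \<Longrightarrow> norm (rescale \<delta> c k) * weight s t k = norm (c k) * weight (\<delta> * s) (\<delta> * t) k * (1 / \<delta>)"
  by (simp add: rescale_def weight_def power_add power_mult_distrib)

lemma wconv_rescale: "0 < \<delta> \<Longrightarrow> wconv (rescale \<delta> c) s t \<longleftrightarrow> wconv c (\<delta> * s) (\<delta> * t)"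
  unfolding wconv_def rescale_term by (subst summable_on_cmult_left') auto

lemma wsum_rescale: "0 < \<delta> \<Longrightarrow> wsum (rescale \<delta> c) s t = wsum c (\<delta> * s) (\<delta> * t) / \<delta>"
  unfolding wsum_def rescale_term by (subst infsum_cmult_left') auto

lemma rescale_rescale: "0 < \<delta> \<Longrightarrow> rescale \<delta> (rescale (1 / \<delta>) c) = c"
  by (rule ext) (simp add: rescale_def power_divide)

lemma germ_rescale: "0 < \<delta> \<Longrightarrow> germ (rescale \<delta> c) \<longleftrightarrow> germ c"
proof -
  have 1: "germ c" if h: "0 < \<delta>" "germ (rescale \<delta> c)" for \<delta> and c :: "nat \<times> nat \<Rightarrow> 'a"
  proof -
    obtain r where "r > 0" "wconv (rescale \<delta> c) r r" using h(2) by (auto simp: germ_def)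
    then have "\<delta> * r > 0" "wconv c (\<delta> * r) (\<delta> * r)" using h(1) by (auto simp: wconv_rescale)
    then show ?thesis unfolding germ_def by blast
  qed
  assume \<delta>: "0 < \<delta>"
  show ?thesis
    using 1[OF \<delta>, of c] 1[of "1 / \<delta>" "rescale \<delta> c"] rescale_rescale[of "1 / \<delta>" c] \<delta> by auto
qed

lemma germ_cf: "germ (cf F)"
  unfolding germ_def by (rule exI[of _ 1]) (simp add: wconv_cf(1)[where B = 1] weight_def)

text \<open>For \<open>n = 2\<close> this makes nonlinear parts small even after the division by the factor of the dilation in \<open>rescale\<close>.\<close>

lemma wsum_shrink:
  fixes c :: "nat \<times> nat \<Rightarrow> 'a::real_normed_vector"
  assumes c: "wconv c s t" and n: "\<And>k. c k \<noteq> 0 \<Longrightarrow> n \<le> fst k + snd k"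
    and "0 \<le> \<tau>" "\<tau> \<le> 1" "0 \<le> s" "0 \<le> t"
  shows "wconv c (\<tau> * s) (\<tau> * t)" "wsum c (\<tau> * s) (\<tau> * t) \<le> \<tau> ^ n * wsum c s t"
proof -
  have le: "norm (c k) * weight (\<tau> * s) (\<tau> * t) k \<le> \<tau> ^ n * (norm (c k) * weight s t k)" for k
  proof (cases "c k = 0")
    case False
    have "norm (c k) * weight (\<tau> * s) (\<tau> * t) k = \<tau> ^ (fst k + snd k) * (norm (c k) * weight s t k)"
      by (simp add: weight_def power_mult_distrib power_add)
    also have "\<dots> \<le> \<tau> ^ n * (norm (c k) * weight s t k)"
      using n[OF False] assms by (intro mult_right_mono power_decreasing) auto
    finally show ?thesis .
  qed simp
  note hs = has_sum_cmult_right[OF wconv_has_sum[OF c], of "\<tau> ^ n"]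
  show 1: "wconv c (\<tau> * s) (\<tau> * t)"
    unfolding wconv_def
    by (rule summable_on_comparison_test[OF has_sum_imp_summable[OF hs] le]) (use assms in auto)
  show "wsum c (\<tau> * s) (\<tau> * t) \<le> \<tau> ^ n * wsum c s t"
    by (rule has_sum_mono[OF wconv_has_sum[OF 1] hs le])
qed

text \<open>This provides the smallness assumptions of \<open>step_unit\<close> and \<open>inverse_unit\<close>, on polydisks of radius greater than one.\<close>

lemma germ_rescale_small:
  fixes c :: "nat \<times> nat \<Rightarrow> 'a::real_normed_vector"
  assumes c: "germ c" "\<And>k. c k \<noteq> 0 \<Longrightarrow> 2 \<le> fst k + snd k" and s: "0 < s" and \<eta>: "0 < \<eta>"
  obtains \<delta>0 where "0 < \<delta>0" "\<And>\<delta>. 0 < \<delta> \<Longrightarrow> \<delta> \<le> \<delta>0 \<Longrightarrow> wconv (rescale \<delta> c) s s"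
    "\<And>\<delta>. 0 < \<delta> \<Longrightarrow> \<delta> \<le> \<delta>0 \<Longrightarrow> wsum (rescale \<delta> c) s s \<le> \<eta>"
proof -
  obtain r where r: "r > 0" "wconv c r r" using c by (auto simp: germ_def)
  define W where "W = wsum c r r + 1"
  have W: "0 < W" "wsum c r r \<le> W" using wsum_nonneg[of r r c] r by (auto simp: W_def)
  define \<delta>0 where "\<delta>0 = min (r / s) (\<eta> * r\<^sup>2 / (s\<^sup>2 * W))"
  have *: "wconv (rescale \<delta> c) s s \<and> wsum (rescale \<delta> c) s s \<le> \<eta>" if \<delta>: "0 < \<delta>" "\<delta> \<le> \<delta>0" for \<delta>
  proof -
    define \<tau> where "\<tau> = \<delta> * s / r"
    have \<tau>: "0 \<le> \<tau>" "\<tau> \<le> 1" "\<tau> * r = \<delta> * s"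
      using \<delta> s r by (auto simp: \<tau>_def \<delta>0_def field_simps)
    note sh = wsum_shrink[OF r(2) c(2) \<tau>(1,2), unfolded \<tau>(3)]
    have "wsum c (\<delta> * s) (\<delta> * s) \<le> \<tau>\<^sup>2 * wsum c r r" using sh(2) r by simp
    also have "\<dots> \<le> \<tau>\<^sup>2 * W" using W by (intro mult_left_mono) auto
    also have "\<dots> = \<delta> * (\<delta> * (s\<^sup>2 * W / r\<^sup>2))" by (simp add: \<tau>_def power2_eq_square)
    also have "\<delta> * (s\<^sup>2 * W / r\<^sup>2) \<le> \<eta>"
      using \<delta>(2) s r W by (auto simp: \<delta>0_def field_simps)
    finally have "wsum c (\<delta> * s) (\<delta> * s) \<le> \<delta> * \<eta>" using \<delta> by simp
    then show ?thesis using sh(1) r \<delta> by (simp add: wconv_rescale wsum_rescale field_simps)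
  qed
  have "0 < \<delta>0" using r s \<eta> W by (simp add: \<delta>0_def)
  then show ?thesis using that * by blast
qed

lemma germ_rescale_small2:
  fixes c d :: "nat \<times> nat \<Rightarrow> 'a::real_normed_vector"
  assumes "germ c" "\<And>k. c k \<noteq> 0 \<Longrightarrow> 2 \<le> fst k + snd k" "germ d" "\<And>k. d k \<noteq> 0 \<Longrightarrow> 2 \<le> fst k + snd k"
    and s: "0 < s" and \<eta>: "0 < \<eta>"
  obtains \<delta>0 where "0 < \<delta>0" 
    "\<And>\<delta>. 0 < \<delta> \<Longrightarrow> \<delta> \<le> \<delta>0 \<Longrightarrow> wconv (rescale \<delta> c) s s \<and> wsum (rescale \<delta> c) s s \<le> \<eta> \<and>
      wconv (rescale \<delta> d) s s \<and> wsum (rescale \<delta> d) s s \<le> \<eta>"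
proof -
  obtain \<delta>1 where 1: "0 < \<delta>1" "\<And>\<delta>. 0 < \<delta> \<Longrightarrow> \<delta> \<le> \<delta>1 \<Longrightarrow> wconv (rescale \<delta> c) s s"
    "\<And>\<delta>. 0 < \<delta> \<Longrightarrow> \<delta> \<le> \<delta>1 \<Longrightarrow> wsum (rescale \<delta> c) s s \<le> \<eta>"
    using germ_rescale_small[OF assms(1,2) s \<eta>] by metis
  obtain \<delta>2 where 2: "0 < \<delta>2" "\<And>\<delta>. 0 < \<delta> \<Longrightarrow> \<delta> \<le> \<delta>2 \<Longrightarrow> wconv (rescale \<delta> d) s s"
    "\<And>\<delta>. 0 < \<delta> \<Longrightarrow> \<delta> \<le> \<delta>2 \<Longrightarrow> wsum (rescale \<delta> d) s s \<le> \<eta>"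
    using germ_rescale_small[OF assms(3,4) s \<eta>] by metis
  show ?thesis by (rule that[of "min \<delta>1 \<delta>2"]) (use 1 2 in auto)
qed

lemma polydisk_iff: "x \<in> polydisk r s \<longleftrightarrow> norm (fst x) < r \<and> norm (snd x) < s"
  by (cases x) (auto simp: polydisk_def)

type_synonym 'a fmap = "('a \<Rightarrow> complex) \<Rightarrow> complex \<times> complex \<Rightarrow> complex \<times> complex"

text \<open>The neighbourhood of \<open>0\<close> does not depend on the character, that is, on the parameter.\<close>

definition near0 :: "(('a::comm_banach_algebra \<Rightarrow> complex) \<Rightarrow> complex \<times> complex \<Rightarrow> bool) \<Rightarrow> bool" where
  "near0 P \<longleftrightarrow> (\<exists>r>0. \<forall>\<omega> x. character \<omega> \<longrightarrow> x \<in> polydisk r r \<longrightarrow> P \<omega> x)"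

lemma near0_mono: "near0 P \<Longrightarrow> (\<And>\<omega> x. character \<omega> \<Longrightarrow> P \<omega> x \<Longrightarrow> Q \<omega> x) \<Longrightarrow> near0 Q"
  unfolding near0_def by meson

lemma near0_conj:
  assumes "near0 P" "near0 Q"
  shows "near0 (\<lambda>\<omega> x. P \<omega> x \<and> Q \<omega> x)"
proof -
  obtain r s where "r > 0" "\<forall>\<omega> x. character \<omega> \<longrightarrow> x \<in> polydisk r r \<longrightarrow> P \<omega> x"
    "s > 0" "\<forall>\<omega> x. character \<omega> \<longrightarrow> x \<in> polydisk s s \<longrightarrow> Q \<omega> x"
    using assms unfolding near0_def by blast
  then show ?thesis unfolding near0_def
    by (intro exI[of _ "min r s"]) (auto simp: polydisk_iff)
qed

text \<open>Equicontinuity at \<open>0\<close> with value \<open>0\<close>, uniformly in the parameter. It makes equality near \<open>0\<close> compatible with substitution of the map.\<close>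

definition small_map :: "'a::comm_banach_algebra fmap \<Rightarrow> bool" where
  "small_map G \<longleftrightarrow> (\<forall>r>0. near0 (\<lambda>\<omega> x. G \<omega> x \<in> polydisk r r))"

lemma near0_compose:
  assumes "near0 P" "small_map G"
  shows "near0 (\<lambda>\<omega> x. P \<omega> (G \<omega> x))"
proof -
  obtain r where r: "r > 0" "\<forall>\<omega> x. character \<omega> \<longrightarrow> x \<in> polydisk r r \<longrightarrow> P \<omega> x"
    using assms unfolding near0_def by blast
  have "near0 (\<lambda>\<omega> x. G \<omega> x \<in> polydisk r r)" using assms(2) r(1) by (auto simp: small_map_def)
  then show ?thesis by (rule near0_mono) (use r in blast)
qed

text \<open>The conjugations of germs are computed with equations: maps form a monoid under \<open>\<odot>\<close>, and \<open>\<doteq>\<close> is compatible with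
composition as long as the inner maps are small.\<close>

definition after :: "'a fmap \<Rightarrow> 'a fmap \<Rightarrow> 'a fmap" (infixr "\<odot>" 70) where
  "(f \<odot> g) \<omega> x = f \<omega> (g \<omega> x)"

definition idm :: "'a fmap" where
  "idm \<omega> x = x"

definition near_eq :: "'a::comm_banach_algebra fmap \<Rightarrow> 'a fmap \<Rightarrow> bool" (infix "\<doteq>" 50) where
  "f \<doteq> g \<longleftrightarrow> near0 (\<lambda>\<omega> x. f \<omega> x = g \<omega> x)"

lemma after_simps: "(f \<odot> g) \<odot> h = f \<odot> g \<odot> h" "idm \<odot> f = f" "f \<odot> idm = f"
  by (auto simp: fun_eq_iff after_def idm_def)

lemma near_eq_sym: "f \<doteq> g \<Longrightarrow> g \<doteq> f"
  unfolding near_eq_def by (erule near0_mono) simp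

lemma near_eq_trans [trans]: "f \<doteq> g \<Longrightarrow> g \<doteq> h \<Longrightarrow> f \<doteq> h"
  unfolding near_eq_def by (drule (1) near0_conj) (erule near0_mono, simp)

lemma near_eq_left: "f \<doteq> g \<Longrightarrow> small_map h \<Longrightarrow> f \<odot> h \<doteq> g \<odot> h"
  unfolding near_eq_def after_def by (rule near0_compose)

lemma near_eq_right: "f \<doteq> g \<Longrightarrow> h \<odot> f \<doteq> h \<odot> g"
  unfolding near_eq_def after_def by (erule near0_mono) simp

lemma small_after:
  assumes "small_map f" "small_map g"
  shows "small_map (f \<odot> g)"
  unfolding small_map_def
proof (intro allI impI)
  fix r :: real assume "0 < r"
  then have "near0 (\<lambda>\<omega> x. f \<omega> x \<in> polydisk r r)" using assms(1) by (simp add: small_map_def)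
  from near0_compose[OF this assms(2)] show "near0 (\<lambda>\<omega> x. (f \<odot> g) \<omega> x \<in> polydisk r r)"
    by (simp add: after_def)
qed

definition gmap :: "'a \<Rightarrow> 'a \<Rightarrow> (nat \<times> nat \<Rightarrow> 'a) \<Rightarrow> (nat \<times> nat \<Rightarrow> 'a) \<Rightarrow> 'a fmap" where
  "gmap a b F1 F2 \<omega> x = (\<omega> a * fst x + ev \<omega> F1 x, \<omega> b * snd x + ev \<omega> F2 x)"

definition germs :: "(int \<times> int) set \<Rightarrow> (nat \<times> nat \<Rightarrow> 'a::real_normed_vector) \<Rightarrow> (nat \<times> nat \<Rightarrow> 'a) \<Rightarrow> bool" where
  "germs M F1 F2 \<longleftrightarrow> germ F1 \<and> germ F2 \<and>
     (\<forall>k. k \<notin> exps1 M \<longrightarrow> F1 k = 0) \<and> (\<forall>k. k \<notin> exps2 M \<longrightarrow> F2 k = 0)"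

lemma expset_order:
  assumes "expset M" "k \<in> exps1 M \<or> k \<in> exps2 M"
  shows "2 \<le> fst k + snd k"
  using assms by (fastforce simp: expset_def shifted_def toZ_def)

lemma germs_order:
  assumes "expset M" "germs M F1 F2"
  shows "F1 k \<noteq> 0 \<Longrightarrow> 2 \<le> fst k + snd k" "F2 k \<noteq> 0 \<Longrightarrow> 2 \<le> fst k + snd k"
  using assms expset_order[of M k] unfolding germs_def by blast+

lemma germs_mono: "germs M F1 F2 \<Longrightarrow> M \<subseteq> M' \<Longrightarrow> germs M' F1 F2"
  unfolding germs_def shifted_def by blast

lemma norm_ev_shrink:
  assumes "character \<omega>" "wconv c r r" "r > 0" "\<And>k. c k \<noteq> 0 \<Longrightarrow> 2 \<le> fst k + snd k"
    "norm (fst x) \<le> \<rho>" "norm (snd x) \<le> \<rho>" "\<rho> \<le> r"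
  shows "norm (ev \<omega> c x) \<le> \<rho> / r * wsum c r r"
proof -
  have \<rho>: "0 \<le> \<rho>" using assms(5) norm_ge_zero order_trans by blast
  have 1: "1 \<le> fst k + snd k" if "c k \<noteq> 0" for k using assms(4)[OF that] by simp
  have "wconv c (\<rho> / r * r) (\<rho> / r * r)" "wsum c (\<rho> / r * r) (\<rho> / r * r) \<le> (\<rho> / r) ^ 1 * wsum c r r"
    by (rule wsum_shrink[OF assms(2) 1]; use assms \<rho> in simp)+
  then show ?thesis
    using norm_ev_le[OF assms(1), of c \<rho> \<rho> x] assms by simp
qed

lemma small_gmap:
  fixes a b :: "'a::comm_banach_algebra"
  assumes M: "expset M" and F: "germs M F1 F2"
  shows "small_map (gmap a b F1 F2)"
  unfolding small_map_def
proof (intro allI impI)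
  fix r :: real assume r: "0 < r"
  obtain r1 r2 where r12: "r1 > 0" "wconv F1 r1 r1" "r2 > 0" "wconv F2 r2 r2"
    using F by (auto simp: germs_def germ_def)
  define C where "C = norm a + norm b + wsum F1 r1 r1 / r1 + wsum F2 r2 r2 / r2 + 1"
  have w: "0 \<le> wsum F1 r1 r1 / r1" "0 \<le> wsum F2 r2 r2 / r2" using r12 by (auto intro!: divide_nonneg_nonneg wsum_nonneg)
  have C: "0 < C" using w norm_ge_zero[of a] norm_ge_zero[of b] unfolding C_def by linarith
  define \<rho> where "\<rho> = min (min r1 r2) (r / C)"
  have "\<rho> \<le> r / C" by (simp add: \<rho>_def)
  then have "C * \<rho> \<le> r" using C by (simp add: pos_le_divide_eq mult.commute)
  then have \<rho>: "0 < \<rho>" "\<rho> \<le> r1" "\<rho> \<le> r2" "C * \<rho> \<le> r"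
    using r12 r C by (auto simp: \<rho>_def)
  show "near0 (\<lambda>\<omega> x. gmap a b F1 F2 \<omega> x \<in> polydisk r r)"
    unfolding near0_def
  proof (intro exI[of _ \<rho>] conjI allI impI \<rho>(1))
    fix \<omega> :: "'a \<Rightarrow> complex" and x assume \<omega>: "character \<omega>" and "x \<in> polydisk \<rho> \<rho>"
    then have x: "norm (fst x) \<le> \<rho>" "norm (snd x) \<le> \<rho>" by (auto simp: polydisk_iff)
    have "norm (\<omega> a * fst x + ev \<omega> F1 x) \<le> norm a * \<rho> + \<rho> / r1 * wsum F1 r1 r1"
      using x \<rho> by (intro order.trans[OF norm_triangle_ineq] add_mono 
        norm_ev_shrink[OF \<omega> r12(2,1) germs_order(1)[OF M F]]) 
        (auto simp: norm_mult intro!: mult_mono char_simps(8)[OF \<omega>])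
    also have "\<dots> = (norm a + wsum F1 r1 r1 / r1) * \<rho>" by (simp add: algebra_simps)
    also have "\<dots> < C * \<rho>" using w \<rho> unfolding C_def 
      by (intro mult_strict_right_mono) (auto simp: add_strict_increasing2 intro: add_nonneg_pos)
    finally have 1: "norm (\<omega> a * fst x + ev \<omega> F1 x) < r" using \<rho> by simp
    have "norm (\<omega> b * snd x + ev \<omega> F2 x) \<le> norm b * \<rho> + \<rho> / r2 * wsum F2 r2 r2"
      using x \<rho> by (intro order.trans[OF norm_triangle_ineq] add_mono 
        norm_ev_shrink[OF \<omega> r12(4,3) germs_order(2)[OF M F]]) 
        (auto simp: norm_mult intro!: mult_mono char_simps(8)[OF \<omega>])
    also have "\<dots> = (norm b + wsum F2 r2 r2 / r2) * \<rho>" by (simp add: algebra_simps)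
    also have "\<dots> < C * \<rho>" using w \<rho> norm_ge_zero[of a] norm_ge_zero[of b] unfolding C_def 
      by (intro mult_strict_right_mono) (linarith | assumption)+
    finally have 2: "norm (\<omega> b * snd x + ev \<omega> F2 x) < r" using \<rho> by simp
    show "gmap a b F1 F2 \<omega> x \<in> polydisk r r" using 1 2 by (simp add: gmap_def polydisk_iff)
  qed
qed

lemma ev_rescale:
  assumes "character \<omega>" "0 < \<delta>"
  shows "ev \<omega> c (cscale (of_real \<delta>) x) = of_real \<delta> * ev \<omega> (rescale \<delta> c) x"
proof -
  have "\<omega> (c k) * mpow (cscale (of_real \<delta>) x) k = of_real \<delta> * (\<omega> (rescale \<delta> c k) * mpow x k)" for k
  proof -
    have "\<omega> (rescale \<delta> c k) = of_real (\<delta> ^ (fst k + snd k) / \<delta>) * \<omega> (c k)"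
      by (simp add: rescale_def char_simps(7)[OF assms(1)] scaleR_conv_of_real[where 'a = complex])
    then show ?thesis
      using assms(2) by (simp add: mpow_def cscale_def power_mult_distrib power_add)
  qed
  then show ?thesis by (simp add: ev_def infsum_cmult_right')
qed

lemma gmap_scale:
  assumes "character \<omega>" "0 < \<delta>"
  shows "gmap a b F1 F2 \<omega> (cscale (of_real \<delta>) x) = cscale (of_real \<delta>) (gmap a b (rescale \<delta> F1) (rescale \<delta> F2) \<omega> x)"
  by (simp add: gmap_def ev_rescale[OF assms]) (simp add: cscale_def algebra_simps)

text \<open>Reduces identities near \<open>0\<close> to identities on the closed unit polydisk.\<close>

lemma near_eq_scaled:
  fixes f g :: "'a::comm_banach_algebra fmap"
  assumes \<delta>: "0 < \<delta>"
    and eq: "\<And>\<omega> y. character \<omega> \<Longrightarrow> norm (fst y) \<le> 1 \<Longrightarrow> norm (snd y) \<le> 1 \<Longrightarrow>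
      f \<omega> (cscale (of_real \<delta>) y) = g \<omega> (cscale (of_real \<delta>) y)"
  shows "f \<doteq> g"
  unfolding near_eq_def near0_def
proof (intro exI[of _ \<delta>] conjI allI impI \<delta>)
  fix \<omega> :: "'a \<Rightarrow> complex" and x assume "character \<omega>" "x \<in> polydisk \<delta> \<delta>"
  moreover have "x = cscale (of_real \<delta>) (cscale (of_real (1 / \<delta>)) x)" using \<delta> by (simp add: cscale_def)
  ultimately show "f \<omega> x = g \<omega> x"
    using eq[of \<omega> "cscale (of_real (1 / \<delta>)) x"] \<delta>
    by (simp add: polydisk_iff cscale_def norm_mult norm_divide field_simps)
qed

lemma ev_linear_plus:
  assumes "character \<omega>" "norm (fst y) \<le> 1" "norm (snd y) \<le> 1"
  shows "(ev \<omega> (cf (single (1, 0) a + F1)) y, ev \<omega> (cf (single (0, 1) b + F2)) y) = gmap a b (cf F1) (cf F2) \<omega> y"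
  using ev_add[OF assms, of "single (1, 0) a" F1] ev_add[OF assms, of "single (0, 1) b" F2] 
  by (simp add: ev_single[OF assms] gmap_def mpow_def)

lemma ev_single0_mult:
  assumes "character \<omega>" "norm (fst y) \<le> 1" "norm (snd y) \<le> 1"
  shows "ev \<omega> (cf (single 0 a * F)) y = \<omega> a * ev \<omega> (cf F) y"
  using ev_single[OF assms, of 0 a] by (simp add: ev_mult[OF assms] mpow_def)

lemma germs_rescale_cf:
  assumes "supported F1 (exps1 M)" "supported F2 (exps2 M)" "0 < \<delta>"
  shows "germs M (rescale (1 / \<delta>) (cf F1)) (rescale (1 / \<delta>) (cf F2))"
  using assms unfolding germs_def by (simp add: germ_rescale germ_cf) (auto simp: rescale_def supported_def)

section \<open>Conjugation, inversion and composition of germs\<close>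

text \<open>Removal of the exponents in \<open>U1\<close> and \<open>U2\<close>, for germs without any smallness assumption: dilate, solve the conjugacy equation on the unit
polydisk, and undo the dilation. Smallness of the weights on \<open>U1\<close>, \<open>U2\<close> relative to the linear part is not affected by the dilation.\<close>

lemma step_germ:
  fixes \<mu>1 \<mu>2 \<nu>1 \<nu>2 :: "'a::comm_banach_algebra"
  assumes M: "expset M" and F: "germs M F1 F2"
    and \<mu>\<nu>: "\<mu>1 * \<nu>1 = 1" "\<mu>2 * \<nu>2 = 1" and st: "norm \<mu>1 < s" "norm \<mu>2 < t"
    and \<theta>: "0 \<le> \<theta>" "\<theta> < 1"
    and U: "\<And>k. k \<in> U1 \<Longrightarrow> norm \<nu>1 * weight s t k \<le> \<theta>" "\<And>k. k \<in> U2 \<Longrightarrow> norm \<nu>2 * weight s t k \<le> \<theta>"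
  obtains \<phi>1 \<phi>2 \<gamma>1 \<gamma>2 where "germs M \<phi>1 \<phi>2" "germs M \<gamma>1 \<gamma>2"
    "\<And>k. k \<in> U1 \<Longrightarrow> \<gamma>1 k = 0" "\<And>k. k \<in> U2 \<Longrightarrow> \<gamma>2 k = 0"
    "gmap \<mu>1 \<mu>2 F1 F2 \<odot> gmap 1 1 \<phi>1 \<phi>2 \<doteq> gmap 1 1 \<phi>1 \<phi>2 \<odot> gmap \<mu>1 \<mu>2 \<gamma>1 \<gamma>2"
proof -
  define \<sigma> where "\<sigma> = min ((s - norm \<mu>1) / 2) ((t - norm \<mu>2) / 2)"
  have \<sigma>: "0 < \<sigma>" "norm \<mu>1 + 2 * \<sigma> \<le> s" "norm \<mu>2 + 2 * \<sigma> \<le> t"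
    using st by (auto simp: \<sigma>_def min_def field_simps)
  define N where "N = Max {1, norm \<nu>1, norm \<nu>2, norm \<mu>1, norm \<mu>2}"
  have N: "1 \<le> N" "norm \<nu>1 \<le> N" "norm \<nu>2 \<le> N" "norm \<mu>1 \<le> N" "norm \<mu>2 \<le> N"
    by (simp_all add: N_def)
  have UN: "weight s t k \<le> N" if "norm \<nu> * weight s t k \<le> \<theta>" "\<mu> * \<nu> = 1" "norm \<mu> \<le> N" for k and \<mu> \<nu> :: 'a
  proof -
    have "0 \<le> s" "0 \<le> t" using st norm_ge_zero[of \<mu>1] norm_ge_zero[of \<mu>2] by linarith+
    then have w: "0 \<le> weight s t k" by simp
    have "1 \<le> norm \<mu> * norm \<nu>" using norm_mult_ineq[of \<mu> \<nu>] that(2) by simp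
    then have "weight s t k \<le> norm \<mu> * norm \<nu> * weight s t k" using w by (simp add: mult_le_cancel_right1)
    also have "\<dots> \<le> norm \<mu> * \<theta>" using that(1) by (simp add: mult.assoc mult_left_mono)
    also have "\<dots> \<le> norm \<mu>" using \<theta> by (simp add: mult_left_le)
    finally show ?thesis using that(3) by simp
  qed
  have UN1: "weight s t k \<le> N" if "k \<in> U1" for k using UN[OF U(1) \<mu>\<nu>(1) N(4)] that .
  have UN2: "weight s t k \<le> N" if "k \<in> U2" for k using UN[OF U(2) \<mu>\<nu>(2) N(5)] that .
  \<comment> \<open>The sizes of the ball and of the nonlinear part are chosen so that the Lipschitz constant in \<open>step_unit\<close> is at most \<open>(1 + \<theta>) / 2\<close>.\<close>
  define \<epsilon> where "\<epsilon> = min (min (1/2) \<sigma>) (\<sigma> * (1 - \<theta>) / (16 * N * N))"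
  have \<epsilon>: "0 < \<epsilon>" "\<epsilon> \<le> 1/2" "\<epsilon> \<le> \<sigma>" "16 * N * N * \<epsilon> / \<sigma> \<le> 1 - \<theta>"
  proof -
    show "0 < \<epsilon>" "\<epsilon> \<le> 1/2" "\<epsilon> \<le> \<sigma>" using \<sigma> \<theta> N by (auto simp: \<epsilon>_def)
    have "\<epsilon> \<le> \<sigma> * (1 - \<theta>) / (16 * N * N)" by (simp add: \<epsilon>_def)
    then have "\<epsilon> * (16 * N * N) \<le> \<sigma> * (1 - \<theta>)" using N by (subst (asm) pos_le_divide_eq) auto
    then show "16 * N * N * \<epsilon> / \<sigma> \<le> 1 - \<theta>" using \<sigma> by (simp add: divide_le_eq mult_ac)
  qed
  define \<eta> where "\<eta> = (1 - \<theta>) * \<epsilon> / (16 * N)"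
  have \<eta>: "0 < \<eta>" "16 * N * \<eta> \<le> (1 - \<theta>) * \<epsilon>" using \<theta> \<epsilon> N by (auto simp: \<eta>_def)
  have gF: "germ F1" "germ F2" using F by (auto simp: germs_def)
  obtain \<delta> where \<delta>: "0 < \<delta>" "wconv (rescale \<delta> F1) 2 2 \<and> wsum (rescale \<delta> F1) 2 2 \<le> \<eta> \<and>
      wconv (rescale \<delta> F2) 2 2 \<and> wsum (rescale \<delta> F2) 2 2 \<le> \<eta>"
    using germ_rescale_small2[OF gF(1) germs_order(1)[OF M F] gF(2) germs_order(2)[OF M F], of 2 \<eta>] \<eta>(1)
    by (metis order.refl zero_less_numeral)
  have Fs: "rescale \<delta> F1 k = 0" if "k \<notin> exps1 M" for k using F that unfolding germs_def rescale_def by (metis scaleR_zero_right)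
  have Fs': "rescale \<delta> F2 k = 0" if "k \<notin> exps2 M" for k using F that unfolding germs_def rescale_def by (metis scaleR_zero_right)
  obtain \<phi>1 \<phi>2 \<gamma>1 \<gamma>2 where u:
    "supported \<phi>1 (exps1 M \<inter> U1)" "supported \<phi>2 (exps2 M \<inter> U2)"
    "supported \<gamma>1 (exps1 M - U1)" "supported \<gamma>2 (exps2 M - U2)"
    "norm \<phi>1 \<le> \<epsilon>" "norm \<phi>2 \<le> \<epsilon>" "norm \<gamma>1 \<le> \<epsilon>" "norm \<gamma>2 \<le> \<epsilon>"
    "single 0 \<mu>1 * \<phi>1 + cmp (rescale \<delta> F1) (single (1, 0) 1 + \<phi>1) (single (0, 1) 1 + \<phi>2) = \<gamma>1 + cmp (cf \<phi>1) (single (1, 0) \<mu>1 + \<gamma>1) (single (0, 1) \<mu>2 + \<gamma>2)"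
    "single 0 \<mu>2 * \<phi>2 + cmp (rescale \<delta> F2) (single (1, 0) 1 + \<phi>1) (single (0, 1) 1 + \<phi>2) = \<gamma>2 + cmp (cf \<phi>2) (single (1, 0) \<mu>1 + \<gamma>1) (single (0, 1) \<mu>2 + \<gamma>2)"
    by (rule step_unit[OF M Fs Fs' \<mu>\<nu> N(1-3) U(1) UN1 U(2) UN2 \<sigma> _ _ _ _ \<theta> \<epsilon> \<eta>(2)])
      (use \<delta>(2) in blast)+
  have us: "supported \<phi>1 U1" "supported \<phi>2 U2" "supported \<phi>1 (exps1 M)" "supported \<phi>2 (exps2 M)"
    "supported \<gamma>1 (exps1 M)" "supported \<gamma>2 (exps2 M)"
    using u(1-4) by (auto elim: supported_mono)
  have st0: "0 \<le> s" "0 \<le> t" using st norm_ge_zero[of \<mu>1] norm_ge_zero[of \<mu>2] by linarith+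
  have conv: "wconv (cf \<phi>1) s t" "wconv (cf \<phi>2) s t"
    using wsum_supported(1)[OF us(1) _ st0] wsum_supported(1)[OF us(2) _ st0] UN1 UN2 by blast+
  have nX: "norm (single (1, 0) 1 + \<phi>1) \<le> 2" "norm (single (0, 1) 1 + \<phi>2) \<le> 2"
    using norm_triangle_ineq[of "single (1::nat, 0::nat) 1" \<phi>1] norm_triangle_ineq[of "single (0::nat, 1::nat) 1" \<phi>2] u(5,6) \<epsilon>(2)
    unfolding norm_single norm_one by linarith+
  have nL: "norm (single (1, 0) \<mu>1 + \<gamma>1) \<le> s" "norm (single (0, 1) \<mu>2 + \<gamma>2) \<le> t"
    using norm_triangle_ineq[of "single (1::nat, 0::nat) \<mu>1" \<gamma>1] norm_triangle_ineq[of "single (0::nat, 1::nat) \<mu>2" \<gamma>2] u(7,8) \<epsilon>(3) \<sigma>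
    unfolding norm_single by linarith+
  have unit: "gmap \<mu>1 \<mu>2 (rescale \<delta> F1) (rescale \<delta> F2) \<omega> (gmap 1 1 (cf \<phi>1) (cf \<phi>2) \<omega> y)
      = gmap 1 1 (cf \<phi>1) (cf \<phi>2) \<omega> (gmap \<mu>1 \<mu>2 (cf \<gamma>1) (cf \<gamma>2) \<omega> y)"
    if \<omega>: "character \<omega>" and y: "norm (fst y) \<le> 1" "norm (snd y) \<le> 1" for \<omega> y
  proof -
    note e = ev_linear_plus[OF \<omega> y, unfolded ev_add[OF \<omega> y]]
    have \<delta>': "wconv (rescale \<delta> F1) 2 2" "wconv (rescale \<delta> F2) 2 2" using \<delta> by auto
    have "\<omega> \<mu>1 * ev \<omega> (cf \<phi>1) y + ev \<omega> (rescale \<delta> F1) (gmap 1 1 (cf \<phi>1) (cf \<phi>2) \<omega> y)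
      = ev \<omega> (cf \<gamma>1) y + ev \<omega> (cf \<phi>1) (gmap \<mu>1 \<mu>2 (cf \<gamma>1) (cf \<gamma>2) \<omega> y)"
      using arg_cong[OF u(9), of "\<lambda>F. ev \<omega> (cf F) y"]
      unfolding ev_add[OF \<omega> y] ev_single0_mult[OF \<omega> y] ev_cmp[OF \<omega> y \<delta>'(1) nX]
        ev_cmp[OF \<omega> y conv(1) nL] e .
    moreover have "\<omega> \<mu>2 * ev \<omega> (cf \<phi>2) y + ev \<omega> (rescale \<delta> F2) (gmap 1 1 (cf \<phi>1) (cf \<phi>2) \<omega> y)
      = ev \<omega> (cf \<gamma>2) y + ev \<omega> (cf \<phi>2) (gmap \<mu>1 \<mu>2 (cf \<gamma>1) (cf \<gamma>2) \<omega> y)"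
      using arg_cong[OF u(10), of "\<lambda>F. ev \<omega> (cf F) y"]
      unfolding ev_add[OF \<omega> y] ev_single0_mult[OF \<omega> y] ev_cmp[OF \<omega> y \<delta>'(2) nX]
        ev_cmp[OF \<omega> y conv(2) nL] e .
    ultimately show ?thesis
      by (simp add: gmap_def char_simps[OF \<omega>] algebra_simps)
  qed
  let ?r = "rescale (1 / \<delta>)"
  show ?thesis
  proof (rule that)
    show "germs M (?r (cf \<phi>1)) (?r (cf \<phi>2))" "germs M (?r (cf \<gamma>1)) (?r (cf \<gamma>2))"
      by (rule germs_rescale_cf; fact us \<delta>(1))+
    show "?r (cf \<gamma>1) k = 0" if "k \<in> U1" for k using u(3) that by (cases k) (auto simp: rescale_def supported_def)
    show "?r (cf \<gamma>2) k = 0" if "k \<in> U2" for k using u(4) that by (cases k) (auto simp: rescale_def supported_def)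
    show "gmap \<mu>1 \<mu>2 F1 F2 \<odot> gmap 1 1 (?r (cf \<phi>1)) (?r (cf \<phi>2))
      \<doteq> gmap 1 1 (?r (cf \<phi>1)) (?r (cf \<phi>2)) \<odot> gmap \<mu>1 \<mu>2 (?r (cf \<gamma>1)) (?r (cf \<gamma>2))"
      by (rule near_eq_scaled[OF \<delta>(1)]) (simp add: after_def gmap_scale rescale_rescale \<delta>(1) unit)
  qed
qed

lemma right_inverse_germ:
  fixes \<mu>1 \<mu>2 \<nu>1 \<nu>2 :: "'a::comm_banach_algebra"
  assumes M: "expset M" and F: "germs M F1 F2"
    and \<mu>\<nu>: "\<mu>1 * \<nu>1 = 1" "\<mu>2 * \<nu>2 = 1"
  obtains \<psi>1 \<psi>2 where "germs M \<psi>1 \<psi>2" "gmap \<mu>1 \<mu>2 F1 F2 \<odot> gmap \<nu>1 \<nu>2 \<psi>1 \<psi>2 \<doteq> idm"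
proof -
  define N where "N = Max {1, norm \<nu>1, norm \<nu>2}"
  have N: "1 \<le> N" "norm \<nu>1 \<le> N" "norm \<nu>2 \<le> N"
    by (simp_all add: N_def)
  define \<eta> where "\<eta> = 1 / (4 * N)"
  have \<eta>: "0 < \<eta>" "4 * N * \<eta> \<le> 1" using N by (auto simp: \<eta>_def)
  have gF: "germ F1" "germ F2" using F by (auto simp: germs_def)
  have N2: "0 < N + 2" using N by simp
  obtain \<delta> where \<delta>: "0 < \<delta>" "wconv (rescale \<delta> F1) (N+2) (N+2) \<and> wsum (rescale \<delta> F1) (N+2) (N+2) \<le> \<eta> \<and>
      wconv (rescale \<delta> F2) (N+2) (N+2) \<and> wsum (rescale \<delta> F2) (N+2) (N+2) \<le> \<eta>"
    using germ_rescale_small2[OF gF(1) germs_order(1)[OF M F] gF(2) germs_order(2)[OF M F] N2 \<eta>(1)]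
    by (metis order.refl)
  have Fs: "rescale \<delta> F1 k = 0" if "k \<notin> exps1 M" for k using F that unfolding germs_def rescale_def by (metis scaleR_zero_right)
  have Fs': "rescale \<delta> F2 k = 0" if "k \<notin> exps2 M" for k using F that unfolding germs_def rescale_def by (metis scaleR_zero_right)
  obtain \<psi>1 \<psi>2 where u: "supported \<psi>1 (exps1 M)" "supported \<psi>2 (exps2 M)"
    "norm \<psi>1 \<le> 1" "norm \<psi>2 \<le> 1"
    "single 0 \<mu>1 * \<psi>1 + cmp (rescale \<delta> F1) (single (1, 0) \<nu>1 + \<psi>1) (single (0, 1) \<nu>2 + \<psi>2) = 0"
    "single 0 \<mu>2 * \<psi>2 + cmp (rescale \<delta> F2) (single (1, 0) \<nu>1 + \<psi>1) (single (0, 1) \<nu>2 + \<psi>2) = 0"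
    by (rule inverse_unit[OF M Fs Fs' \<mu>\<nu> N(2,3) _ _ _ _ \<eta>(2)]) (use \<delta>(2) in blast)+
  have nK: "norm (single (1, 0) \<nu>1 + \<psi>1) \<le> N + 2" "norm (single (0, 1) \<nu>2 + \<psi>2) \<le> N + 2"
    using norm_triangle_ineq[of "single (1::nat, 0::nat) \<nu>1" \<psi>1] norm_triangle_ineq[of "single (0::nat, 1::nat) \<nu>2" \<psi>2] u(3,4) N
    unfolding norm_single by linarith+
  have unit: "gmap \<mu>1 \<mu>2 (rescale \<delta> F1) (rescale \<delta> F2) \<omega> (gmap \<nu>1 \<nu>2 (cf \<psi>1) (cf \<psi>2) \<omega> y) = y"
    if \<omega>: "character \<omega>" and y: "norm (fst y) \<le> 1" "norm (snd y) \<le> 1" for \<omega> y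
  proof -
    note e = ev_linear_plus[OF \<omega> y, unfolded ev_add[OF \<omega> y]]
    have \<delta>': "wconv (rescale \<delta> F1) (N+2) (N+2)" "wconv (rescale \<delta> F2) (N+2) (N+2)" using \<delta> by auto
    have z: "ev \<omega> (cf 0) y = 0" by (simp add: ev_def char_simps[OF \<omega>])
    have 1: "\<omega> \<mu>1 * ev \<omega> (cf \<psi>1) y + ev \<omega> (rescale \<delta> F1) (gmap \<nu>1 \<nu>2 (cf \<psi>1) (cf \<psi>2) \<omega> y) = 0"
      using arg_cong[OF u(5), of "\<lambda>F. ev \<omega> (cf F) y"]
      unfolding ev_add[OF \<omega> y] ev_single0_mult[OF \<omega> y] ev_cmp[OF \<omega> y \<delta>'(1) nK] e z .
    have 2: "\<omega> \<mu>2 * ev \<omega> (cf \<psi>2) y + ev \<omega> (rescale \<delta> F2) (gmap \<nu>1 \<nu>2 (cf \<psi>1) (cf \<psi>2) \<omega> y) = 0"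
      using arg_cong[OF u(6), of "\<lambda>F. ev \<omega> (cf F) y"]
      unfolding ev_add[OF \<omega> y] ev_single0_mult[OF \<omega> y] ev_cmp[OF \<omega> y \<delta>'(2) nK] e z .
    have 3: "\<omega> \<mu>1 * (\<omega> \<nu>1 * fst y) = fst y" "\<omega> \<mu>2 * (\<omega> \<nu>2 * snd y) = snd y"
      unfolding mult.assoc[symmetric] char_simps(6)[OF \<omega>, symmetric] \<mu>\<nu> char_simps(5)[OF \<omega>] by simp_all
    have g: "gmap a b G1 G2 \<omega> (gmap \<nu>1 \<nu>2 (cf \<psi>1) (cf \<psi>2) \<omega> y) =
      (\<omega> a * (\<omega> \<nu>1 * fst y) + (\<omega> a * ev \<omega> (cf \<psi>1) y + ev \<omega> G1 (gmap \<nu>1 \<nu>2 (cf \<psi>1) (cf \<psi>2) \<omega> y)),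
       \<omega> b * (\<omega> \<nu>2 * snd y) + (\<omega> b * ev \<omega> (cf \<psi>2) y + ev \<omega> G2 (gmap \<nu>1 \<nu>2 (cf \<psi>1) (cf \<psi>2) \<omega> y)))" for a b G1 G2
      by (simp add: gmap_def algebra_simps)
    show ?thesis unfolding g 1 2 3 by simp
  qed
  let ?r = "rescale (1 / \<delta>)"
  show ?thesis
  proof (rule that)
    show "germs M (?r (cf \<psi>1)) (?r (cf \<psi>2))" by (rule germs_rescale_cf; fact u \<delta>(1))
    show "gmap \<mu>1 \<mu>2 F1 F2 \<odot> gmap \<nu>1 \<nu>2 (?r (cf \<psi>1)) (?r (cf \<psi>2)) \<doteq> idm"
      by (rule near_eq_scaled[OF \<delta>(1)]) (simp add: after_def idm_def gmap_scale rescale_rescale \<delta>(1) unit)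
  qed
qed

text \<open>The right inverse has a right inverse in its turn, and is therefore two-sided.\<close>

lemma inverse_germ:
  fixes \<mu>1 \<mu>2 \<nu>1 \<nu>2 :: "'a::comm_banach_algebra"
  assumes M: "expset M" and F: "germs M F1 F2"
    and \<mu>\<nu>: "\<mu>1 * \<nu>1 = 1" "\<mu>2 * \<nu>2 = 1"
  obtains \<psi>1 \<psi>2 where "germs M \<psi>1 \<psi>2" "gmap \<mu>1 \<mu>2 F1 F2 \<odot> gmap \<nu>1 \<nu>2 \<psi>1 \<psi>2 \<doteq> idm"
    "gmap \<nu>1 \<nu>2 \<psi>1 \<psi>2 \<odot> gmap \<mu>1 \<mu>2 F1 F2 \<doteq> idm"
proof -
  let ?f = "gmap \<mu>1 \<mu>2 F1 F2"
  obtain \<psi>1 \<psi>2 where \<psi>: "germs M \<psi>1 \<psi>2" "?f \<odot> gmap \<nu>1 \<nu>2 \<psi>1 \<psi>2 \<doteq> idm" (is "_ \<odot> ?g \<doteq> _")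
    by (rule right_inverse_germ[OF M F \<mu>\<nu>])
  have \<nu>\<mu>: "\<nu>1 * \<mu>1 = 1" "\<nu>2 * \<mu>2 = 1" using \<mu>\<nu> by (simp_all add: mult.commute)
  obtain G1 G2 where G: "germs M G1 G2" "?g \<odot> gmap \<mu>1 \<mu>2 G1 G2 \<doteq> idm" (is "_ \<odot> ?h \<doteq> _")
    by (rule right_inverse_germ[OF M \<psi>(1) \<nu>\<mu>])
  have "?f \<odot> ?g \<odot> ?h \<doteq> ?f" using near_eq_right[OF G(2), of ?f] by (simp add: after_simps)
  moreover have "?f \<odot> ?g \<odot> ?h \<doteq> ?h"
    using near_eq_left[OF \<psi>(2) small_gmap[OF M G(1)]] by (simp add: after_simps)
  ultimately have "?f \<doteq> ?h" by (blast intro: near_eq_sym near_eq_trans)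
  then have "?g \<odot> ?f \<doteq> idm" by (rule near_eq_trans[OF near_eq_right G(2)])
  with \<psi> that show ?thesis by blast
qed

definition full :: "(int \<times> int) set" where
  "full = {u. u = 0 \<or> fst u + snd u \<ge> 1}"

lemma expset_full: "expset full"
  by (auto simp: expset_def full_def)

lemma compose_germ:
  fixes a1 a2 b1 b2 :: "'a::comm_banach_algebra"
  assumes F: "germs full F1 F2" and G: "germs full G1 G2"
  obtains K1 K2 where "germs full K1 K2"
    "gmap a1 a2 F1 F2 \<odot> gmap b1 b2 G1 G2 \<doteq> gmap (a1 * b1) (a2 * b2) K1 K2"
proof -
  let ?E1 = "exps1 full" and ?E2 = "exps2 full"
  note M = expset_full
  define N where "N = Max {norm b1, norm b2}"
  have N: "norm b1 \<le> N" "norm b2 \<le> N" by (simp_all add: N_def)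
  have N1: "0 < N + 1" using N(1) norm_ge_zero[of b1] by linarith
  have g: "germ F1" "germ F2" "germ G1" "germ G2" using F G by (auto simp: germs_def)
  obtain \<delta>1 where \<delta>1: "0 < \<delta>1" "\<And>\<delta>. 0 < \<delta> \<Longrightarrow> \<delta> \<le> \<delta>1 \<Longrightarrow> wconv (rescale \<delta> F1) (N+1) (N+1) \<and> wsum (rescale \<delta> F1) (N+1) (N+1) \<le> 1 \<and>
      wconv (rescale \<delta> F2) (N+1) (N+1) \<and> wsum (rescale \<delta> F2) (N+1) (N+1) \<le> 1"
    using germ_rescale_small2[OF g(1) germs_order(1)[OF M F] g(2) germs_order(2)[OF M F] N1 zero_less_one] by blast
  obtain \<delta>2 where \<delta>2: "0 < \<delta>2" "\<And>\<delta>. 0 < \<delta> \<Longrightarrow> \<delta> \<le> \<delta>2 \<Longrightarrow> wconv (rescale \<delta> G1) 1 1 \<and> wsum (rescale \<delta> G1) 1 1 \<le> 1 \<and>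
      wconv (rescale \<delta> G2) 1 1 \<and> wsum (rescale \<delta> G2) 1 1 \<le> 1"
    using germ_rescale_small2[OF g(3) germs_order(1)[OF M G] g(4) germs_order(2)[OF M G] zero_less_one zero_less_one] by blast
  define \<delta> where "\<delta> = min \<delta>1 \<delta>2"
  have \<delta>: "0 < \<delta>" using \<delta>1 \<delta>2 by (simp add: \<delta>_def)
  have w: "wconv (rescale \<delta> F1) (N+1) (N+1)" "wconv (rescale \<delta> F2) (N+1) (N+1)"
     "wconv (rescale \<delta> G1) 1 1" "wsum (rescale \<delta> G1) 1 1 \<le> 1" "wconv (rescale \<delta> G2) 1 1" "wsum (rescale \<delta> G2) 1 1 \<le> 1"
    using \<delta>1(2)[of \<delta>] \<delta>2(2)[of \<delta>] \<delta>1(1) \<delta>2(1) by (auto simp: \<delta>_def)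
  define H1 where "H1 = Abs_l1 (rescale \<delta> G1)"
  define H2 where "H2 = Abs_l1 (rescale \<delta> G2)"
  have H: "cf H1 = rescale \<delta> G1" "cf H2 = rescale \<delta> G2"
    using w unfolding H1_def H2_def wconv_def by (auto intro!: Abs_l1_inverse simp: weight_def)
  have nH: "norm H1 \<le> 1" "norm H2 \<le> 1"
    using w unfolding norm_l1_def H wsum_def by (auto simp: weight_def)
  have sH: "supported H1 ?E1" "supported H2 ?E2"
    using G unfolding supported_def H germs_def rescale_def by simp_all
  let ?H1 = "single (1, 0) b1 + H1" and ?H2 = "single (0, 1) b2 + H2"
  define K1 where "K1 = single 0 a1 * H1 + cmp (rescale \<delta> F1) ?H1 ?H2"
  define K2 where "K2 = single 0 a2 * H2 + cmp (rescale \<delta> F2) ?H1 ?H2"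
  have nB: "norm ?H1 \<le> N + 1" "norm ?H2 \<le> N + 1"
    using norm_triangle_ineq[of "single (1::nat, 0::nat) b1" H1] norm_triangle_ineq[of "single (0::nat, 1::nat) b2" H2] nH N
    unfolding norm_single by linarith+
  have sub: "shifted (full - {0}) e \<subseteq> shifted full e" for e by (auto simp: shifted_def)
  have e: "supported (single (1, 0) c) (shifted full (1, 0))" "supported (single (0, 1) c) (shifted full (0, 1))" for c :: 'a
    using M by (auto intro!: supported_mono[OF supported_single] simp: shifted_def toZ_def expset_def zero_prod_def)
  have sB: "supported ?H1 (shifted full (1, 0))" "supported ?H2 (shifted full (0, 1))"
    by (intro supported_ops e supported_mono[OF sH(1) sub] supported_mono[OF sH(2) sub])+
  have Fs: "rescale \<delta> F1 k = 0" if "k \<notin> ?E1" for k using F that unfolding germs_def rescale_def by (metis scaleR_zero_right)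
  have Fs': "rescale \<delta> F2 k = 0" if "k \<notin> ?E2" for k using F that unfolding germs_def rescale_def by (metis scaleR_zero_right)
  have sK: "supported K1 ?E1" "supported K2 ?E2"
    unfolding K1_def K2_def
    by (intro supported_ops supported_single0_mult sH supported_cmp[OF M Fs sB w(1) nB] supported_cmp[OF M Fs' sB w(2) nB]; assumption)+
  have unit: "gmap a1 a2 (rescale \<delta> F1) (rescale \<delta> F2) \<omega> (gmap b1 b2 (rescale \<delta> G1) (rescale \<delta> G2) \<omega> y)
      = gmap (a1 * b1) (a2 * b2) (cf K1) (cf K2) \<omega> y"
    if \<omega>: "character \<omega>" and y: "norm (fst y) \<le> 1" "norm (snd y) \<le> 1" for \<omega> y
  proof -
    note e = ev_linear_plus[OF \<omega> y, of b1 H1 b2 H2, unfolded ev_add[OF \<omega> y]]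
    have 1: "ev \<omega> (cf K1) y = \<omega> a1 * ev \<omega> (cf H1) y + ev \<omega> (rescale \<delta> F1) (gmap b1 b2 (cf H1) (cf H2) \<omega> y)"
      unfolding K1_def ev_add[OF \<omega> y] ev_single0_mult[OF \<omega> y] ev_cmp[OF \<omega> y w(1) nB] e ..
    have 2: "ev \<omega> (cf K2) y = \<omega> a2 * ev \<omega> (cf H2) y + ev \<omega> (rescale \<delta> F2) (gmap b1 b2 (cf H1) (cf H2) \<omega> y)"
      unfolding K2_def ev_add[OF \<omega> y] ev_single0_mult[OF \<omega> y] ev_cmp[OF \<omega> y w(2) nB] e ..
    have "gmap (a1 * b1) (a2 * b2) (cf K1) (cf K2) \<omega> y = gmap a1 a2 (rescale \<delta> F1) (rescale \<delta> F2) \<omega> (gmap b1 b2 (cf H1) (cf H2) \<omega> y)"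
      unfolding gmap_def[of "a1 * b1"] 1 2 unfolding gmap_def[of a1] by (simp add: gmap_def[of b1] char_simps[OF \<omega>] algebra_simps)
    then show ?thesis by (simp add: H)
  qed
  let ?r = "rescale (1 / \<delta>)"
  show ?thesis
  proof (rule that)
    show "germs full (?r (cf K1)) (?r (cf K2))" by (rule germs_rescale_cf; fact sK \<delta>(1))
    show "gmap a1 a2 F1 F2 \<odot> gmap b1 b2 G1 G2 \<doteq> gmap (a1 * b1) (a2 * b2) (?r (cf K1)) (?r (cf K2))"
      by (rule near_eq_scaled[OF \<delta>(1)]) (simp add: after_def gmap_scale rescale_rescale \<delta>(1) unit)
  qed
qed

section \<open>Clearing both sides of the cone\<close>

text \<open>The sets \<open>U\<close> and \<open>V\<close> collect the exponents for which \<open>L\<close>, respectively its inverse, contracts. Clearing \<open>U\<close> from \<open>f\<close> and then \<open>V\<close> from the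
inverse of the result leaves exponents outside both, by the closure properties of the monoids \<open>full - U\<close> and \<open>full - U - V\<close>.\<close>

theorem normal_form_germ:
  fixes \<mu>1 \<mu>2 \<nu>1 \<nu>2 :: "'a::comm_banach_algebra"
  assumes F: "germs full F1 F2"
    and \<mu>\<nu>: "\<mu>1 * \<nu>1 = 1" "\<mu>2 * \<nu>2 = 1"
    and st: "norm \<mu>1 < s" "norm \<mu>2 < t" "norm \<nu>1 < s'" "norm \<nu>2 < t'"
    and \<theta>: "0 \<le> \<theta>" "\<theta> < 1"
    and U: "\<And>k. k \<in> shifted U (1, 0) \<Longrightarrow> norm \<nu>1 * weight s t k \<le> \<theta>"
           "\<And>k. k \<in> shifted U (0, 1) \<Longrightarrow> norm \<nu>2 * weight s t k \<le> \<theta>"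
    and V: "\<And>k. k \<in> shifted V (1, 0) \<Longrightarrow> norm \<mu>1 * weight s' t' k \<le> \<theta>"
           "\<And>k. k \<in> shifted V (0, 1) \<Longrightarrow> norm \<mu>2 * weight s' t' k \<le> \<theta>"
    and M: "expset (full - U)" "expset (full - U - V)"
  obtains H1 H2 I1 I2 G1 G2 where "germs full H1 H2" "germs full I1 I2" "germs (full - U - V) G1 G2"
    "gmap 1 1 I1 I2 \<odot> gmap 1 1 H1 H2 \<doteq> idm" "gmap 1 1 H1 H2 \<odot> gmap 1 1 I1 I2 \<doteq> idm"
    "gmap \<mu>1 \<mu>2 G1 G2 \<doteq> gmap 1 1 I1 I2 \<odot> gmap \<mu>1 \<mu>2 F1 F2 \<odot> gmap 1 1 H1 H2"
proof -
  note M0 = expset_full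
  have \<nu>\<mu>: "\<nu>1 * \<mu>1 = 1" "\<nu>2 * \<mu>2 = 1" using \<mu>\<nu> by (simp_all add: mult.commute)
  have cut: "germs (M - W) f g" if "germs M f g" "\<And>k. k \<in> shifted W (1, 0) \<Longrightarrow> f k = 0"
    "\<And>k. k \<in> shifted W (0, 1) \<Longrightarrow> g k = 0" for M W and f g :: "nat \<times> nat \<Rightarrow> 'a"
    using that unfolding germs_def shifted_def by blast
  note inv = inverse_germ[OF M0 _ mult_1_left mult_1_left]
  let ?f = "gmap \<mu>1 \<mu>2 F1 F2"
  \<comment> \<open>\<open>f\<close> is conjugated by \<open>h1\<close> to \<open>g1\<close>, from which the exponents in \<open>U\<close> are absent.\<close>
  obtain a1 a2 b1 b2 where h1: "germs full a1 a2" and b: "germs full b1 b2"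
    "\<And>k. k \<in> shifted U (1, 0) \<Longrightarrow> b1 k = 0" "\<And>k. k \<in> shifted U (0, 1) \<Longrightarrow> b2 k = 0"
    and fh1: "?f \<odot> gmap 1 1 a1 a2 \<doteq> gmap 1 1 a1 a2 \<odot> gmap \<mu>1 \<mu>2 b1 b2" (is "_ \<odot> ?h1 \<doteq> _ \<odot> ?g1")
    by (rule step_germ[OF M0 F \<mu>\<nu> st(1,2) \<theta> U], assumption, assumption, rule that)
  \<comment> \<open>\<open>k1\<close> is the inverse of \<open>g1\<close>; it is conjugated by \<open>h2\<close> to \<open>k2\<close>, from which the exponents in
    \<open>V\<close> are absent as well, and \<open>g\<close> is the inverse of \<open>k2\<close>.\<close>
  obtain c1 c2 where k1: "germs (full - U) c1 c2" and g1k1: "?g1 \<odot> gmap \<nu>1 \<nu>2 c1 c2 \<doteq> idm" (is "_ \<odot> ?k1 \<doteq> _")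
    by (rule inverse_germ[OF M(1) cut[OF b] \<mu>\<nu>])
  obtain d1 d2 e1 e2 where d: "germs (full - U) d1 d2" and e: "germs (full - U) e1 e2"
    "\<And>k. k \<in> shifted V (1, 0) \<Longrightarrow> e1 k = 0" "\<And>k. k \<in> shifted V (0, 1) \<Longrightarrow> e2 k = 0"
    and k1h2: "?k1 \<odot> gmap 1 1 d1 d2 \<doteq> gmap 1 1 d1 d2 \<odot> gmap \<nu>1 \<nu>2 e1 e2" (is "_ \<odot> ?h2 \<doteq> _ \<odot> ?k2")
    by (rule step_germ[OF M(1) k1 \<nu>\<mu> st(3,4) \<theta> V], assumption, assumption, rule that)
  obtain G1 G2 where g: "germs (full - U - V) G1 G2" and k2g: "?k2 \<odot> gmap \<mu>1 \<mu>2 G1 G2 \<doteq> idm" (is "_ \<odot> ?g \<doteq> _")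
    by (rule inverse_germ[OF M(2) cut[OF e] \<nu>\<mu>])
  have h2: "germs full d1 d2" by (rule germs_mono[OF d]) auto
  obtain i1 i2 where i: "germs full i1 i2" "?h1 \<odot> gmap 1 1 i1 i2 \<doteq> idm" "gmap 1 1 i1 i2 \<odot> ?h1 \<doteq> idm" (is "?i \<odot> _ \<doteq> _")
    by (rule inv[OF h1])
  obtain j1 j2 where j: "germs full j1 j2" "?h2 \<odot> gmap 1 1 j1 j2 \<doteq> idm" "gmap 1 1 j1 j2 \<odot> ?h2 \<doteq> idm" (is "?j \<odot> _ \<doteq> _")
    by (rule inv[OF h2])
  obtain H1 H2 where H: "germs full H1 H2" "?h1 \<odot> ?h2 \<doteq> gmap (1 * 1) (1 * 1) H1 H2"
    by (rule compose_germ[OF h1 h2])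
  obtain I1 I2 where I: "germs full I1 I2" "?j \<odot> ?i \<doteq> gmap (1 * 1) (1 * 1) I1 I2"
    by (rule compose_germ[OF j(1) i(1)])
  let ?h = "gmap 1 1 H1 H2" and ?hi = "gmap 1 1 I1 I2"
  have hh: "?h \<doteq> ?h1 \<odot> ?h2" and hij: "?hi \<doteq> ?j \<odot> ?i" using near_eq_sym[OF H(2)] near_eq_sym[OF I(2)] by simp_all
  note sm = small_gmap[OF M0] small_gmap[OF M(2) g]
  have "?hi \<odot> ?h \<doteq> ?j \<odot> ?i \<odot> ?h" using near_eq_left[OF hij sm(1)[OF H(1)]] by (simp add: after_simps)
  also have "\<dots> \<doteq> ?j \<odot> ?i \<odot> ?h1 \<odot> ?h2" by (intro near_eq_right hh)
  also have "\<dots> \<doteq> ?j \<odot> ?h2" using near_eq_left[OF i(3) sm(1)[OF h2]] by (intro near_eq_right) (simp add: after_simps)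
  also have "\<dots> \<doteq> idm" by (rule j(3))
  finally have ih: "?hi \<odot> ?h \<doteq> idm" .
  have "?h \<odot> ?hi \<doteq> ?h1 \<odot> ?h2 \<odot> ?hi" using near_eq_left[OF hh sm(1)[OF I(1)]] by (simp add: after_simps)
  also have "\<dots> \<doteq> ?h1 \<odot> ?h2 \<odot> ?j \<odot> ?i" by (intro near_eq_right hij)
  also have "\<dots> \<doteq> ?h1 \<odot> ?i" using near_eq_left[OF j(2) sm(1)[OF i(1)]] by (intro near_eq_right) (simp add: after_simps)
  also have "\<dots> \<doteq> idm" by (rule i(2))
  finally have hi: "?h \<odot> ?hi \<doteq> idm" .
  \<comment> \<open>The conjugation of \<open>k1\<close> to \<open>k2\<close> by \<open>h2\<close> is also one of \<open>g1\<close> to \<open>g\<close>.\<close>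
  have "?k1 \<odot> ?h2 \<odot> ?g \<doteq> ?h2 \<odot> ?k2 \<odot> ?g" using near_eq_left[OF k1h2 sm(2)] by (simp add: after_simps)
  also have "\<dots> \<doteq> ?h2" using near_eq_right[OF k2g, of ?h2] by (simp add: after_simps)
  finally have "?g1 \<odot> ?h2 \<doteq> ?g1 \<odot> ?k1 \<odot> ?h2 \<odot> ?g" by (intro near_eq_right) (rule near_eq_sym)
  also have "\<dots> \<doteq> ?h2 \<odot> ?g"
    using near_eq_left[OF g1k1 small_after[OF sm(1)[OF h2] sm(2)]] by (simp add: after_simps)
  finally have g1h2: "?g1 \<odot> ?h2 \<doteq> ?h2 \<odot> ?g" .
  have "?f \<odot> ?h \<doteq> ?f \<odot> ?h1 \<odot> ?h2" by (rule near_eq_right[OF hh])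
  also have "\<dots> \<doteq> ?h1 \<odot> ?g1 \<odot> ?h2" using near_eq_left[OF fh1 sm(1)[OF h2]] by (simp add: after_simps)
  also have "\<dots> \<doteq> ?h1 \<odot> ?h2 \<odot> ?g" by (rule near_eq_right[OF g1h2])
  also have "\<dots> \<doteq> ?h \<odot> ?g" using near_eq_left[OF near_eq_sym[OF hh] sm(2)] by (simp add: after_simps)
  finally have "?hi \<odot> ?f \<odot> ?h \<doteq> ?hi \<odot> ?h \<odot> ?g" by (rule near_eq_right)
  also have "\<dots> \<doteq> ?g" using near_eq_left[OF ih sm(2)] by (simp add: after_simps)
  finally have "?hi \<odot> ?f \<odot> ?h \<doteq> ?g" .
  then have "?g \<doteq> ?hi \<odot> ?f \<odot> ?h" by (rule near_eq_sym)
  with H(1) I(1) g ih hi show ?thesis by (rule that)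
qed

section \<open>Convergents of a continued fraction\<close>

text \<open>Numerators and denominators of the convergents by the classical recursion. Index \<open>0\<close> stands for the formal convergent \<open>1 / 0\<close>.\<close>

fun cnum :: "(nat \<Rightarrow> nat) \<Rightarrow> nat \<Rightarrow> nat" where
  "cnum d 0 = 1"
| "cnum d (Suc 0) = d 1"
| "cnum d (Suc (Suc n)) = d (Suc (Suc n)) * cnum d (Suc n) + cnum d n"

fun cden :: "(nat \<Rightarrow> nat) \<Rightarrow> nat \<Rightarrow> nat" where
  "cden d 0 = 0"
| "cden d (Suc 0) = 1"
| "cden d (Suc (Suc n)) = d (Suc (Suc n)) * cden d (Suc n) + cden d n"

text \<open>The recursion peels off the last partial quotient, whereas the continued fraction is built from the first one; this and the next lemma translate.\<close>

lemma cnum_Suc: "cnum d (Suc n) = d 1 * cnum (d \<circ> Suc) n + cden (d \<circ> Suc) n"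
  by (induction n rule: induct_nat_012) (simp_all add: algebra_simps)

lemma cden_Suc: "cden d (Suc n) = cnum (d \<circ> Suc) n"
  by (induction n rule: induct_nat_012) (simp_all add: algebra_simps)

lemma cnum_pos: "(\<And>i. i \<ge> 1 \<Longrightarrow> d i \<ge> 1) \<Longrightarrow> cnum d n > 0"
  by (induction n rule: induct_nat_012) (auto simp: Suc_le_eq)

lemma cden_pos: "(\<And>i. i \<ge> 2 \<Longrightarrow> d i \<ge> 1) \<Longrightarrow> n \<ge> 1 \<Longrightarrow> cden d n > 0"
  using cnum_pos[of "d \<circ> Suc" "n - 1"] cden_Suc[of d "n - 1"] by simp

lemma cfrac_eq:
  "(\<And>i. i \<ge> 2 \<Longrightarrow> d i \<ge> 1) \<Longrightarrow> cfrac (map d [1..<Suc (Suc n)]) = real (cnum d (Suc n)) / real (cden d (Suc n))"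
proof (induction n arbitrary: d)
  case (Suc n)
  let ?d = "d \<circ> Suc"
  have 1: "map d [1..<Suc (Suc (Suc n))] = d 1 # map ?d [1..<Suc (Suc n)]"
    by (simp add: upt_conv_Cons map_Suc_upt[symmetric] del: upt_Suc)
  obtain b bs where 2: "map ?d [1..<Suc (Suc n)] = b # bs"
    by (simp add: upt_conv_Cons del: upt_Suc)
  have IH: "cfrac (map ?d [1..<Suc (Suc n)]) = real (cnum ?d (Suc n)) / real (cden ?d (Suc n))"
    using Suc.prems by (intro Suc.IH) auto
  have pos: "cnum ?d (Suc n) > 0" using Suc.prems by (intro cnum_pos) auto
  have "cfrac (map d [1..<Suc (Suc (Suc n))]) = real (d 1) + 1 / cfrac (map ?d [1..<Suc (Suc n)])"
    unfolding 1 2 by simp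
  also have "\<dots> = real (cnum d (Suc (Suc n))) / real (cden d (Suc (Suc n)))"
    unfolding IH cnum_Suc[of d "Suc n"] cden_Suc[of d "Suc n"] using pos by (simp add: field_simps del: cnum.simps cden.simps)
  finally show ?case .
qed simp

lemma cnum_cden_det:
  "int (cnum d (Suc n)) * int (cden d n) - int (cnum d n) * int (cden d (Suc n)) = (- 1) ^ Suc n"
proof (induction n)
  case (Suc n)
  have "int (cnum d (Suc (Suc n))) * int (cden d (Suc n)) - int (cnum d (Suc n)) * int (cden d (Suc (Suc n)))
    = - (int (cnum d (Suc n)) * int (cden d n) - int (cnum d n) * int (cden d (Suc n)))"
    by (simp add: algebra_simps)
  then show ?case using Suc by simp
qed simp

text \<open>All later convergents lie in the cone spanned by two consecutive ones, hence between them.\<close>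

lemma cnum_cden_cone:
  "\<exists>\<alpha> \<beta>. cnum d (m + n) = \<alpha> * cnum d (Suc m) + \<beta> * cnum d m \<and>
         cden d (m + n) = \<alpha> * cden d (Suc m) + \<beta> * cden d m"
proof (induction n rule: induct_nat_012)
  case 0
  show ?case by (rule exI[of _ 0], rule exI[of _ 1]) simp
next
  case 1
  show ?case by (rule exI[of _ 1], rule exI[of _ 0]) simp
next
  case (ge2 n)
  then obtain a b a' b' where
    "cnum d (m + n) = a * cnum d (Suc m) + b * cnum d m" "cden d (m + n) = a * cden d (Suc m) + b * cden d m"
    "cnum d (m + Suc n) = a' * cnum d (Suc m) + b' * cnum d m" "cden d (m + Suc n) = a' * cden d (Suc m) + b' * cden d m"
    by blast
  then show ?case
    by (intro exI[of _ "d (Suc (Suc (m + n))) * a' + a"] exI[of _ "d (Suc (Suc (m + n))) * b' + b"])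
      (simp add: algebra_simps)
qed

lemma cnum_cden_coprime: "coprime (cnum d (Suc n)) (cden d (Suc n))"
proof (rule coprimeI)
  fix c assume c: "c dvd cnum d (Suc n)" "c dvd cden d (Suc n)"
  have "int c dvd int (cnum d (Suc n)) * int (cden d n) - int (cnum d n) * int (cden d (Suc n))"
    using c by (intro dvd_diff dvd_mult dvd_mult2) (simp_all add: int_dvd_int_iff)
  then have "int c dvd (- 1) ^ Suc n" unfolding cnum_cden_det .
  then have "int c dvd 1" by (metis dvd_minus_iff dvd_mult_cancel_left dvd_refl dvd_trans minus_one_power_iff)
  then show "is_unit c" by simp
qed

text \<open>By the determinant identity the convergent with odd index is the smaller one of two consecutive convergents \<open>2 k + 1\<close> and \<open>2 k + 2\<close>. All later
convergents lie between them, hence so does the limit, strictly because it is irrational.\<close>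

lemma convergents_bracket:
  assumes e: "cfrac_expansion d R" and c: "cfrac_convergents d qs ps" and R: "R \<notin> \<rat>"
  shows "ps (2 * k + 1) > 0" "ps (2 * k + 2) > 0"
    "real (qs (2 * k + 1)) / real (ps (2 * k + 1)) < R" "R < real (qs (2 * k + 2)) / real (ps (2 * k + 2))"
    "int (qs (2 * k + 2)) * int (ps (2 * k + 1)) - int (qs (2 * k + 1)) * int (ps (2 * k + 2)) = 1"
proof -
  have d: "d i \<ge> 1" if "i \<ge> 2" for i using e that by (auto simp: cfrac_expansion_def)
  have lim: "(\<lambda>n. cfrac (map d [1..<Suc n])) \<longlonglongrightarrow> R" using e by (simp add: cfrac_expansion_def)
  have eq: "qs n = cnum d n" "ps n = cden d n" if n: "n \<ge> 1" for n
  proof -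
    obtain m where m: "n = Suc m" using n by (cases n) auto
    have pos: "ps n > 0" "cden d n > 0" using c n d by (auto simp: cfrac_convergents_def intro!: cden_pos)
    have ce: "cfrac (map d [1..<Suc n]) = real (cnum d n) / real (cden d n)"
      unfolding m by (rule cfrac_eq) (rule d)
    have "real (qs n) / real (ps n) = real (cnum d n) / real (cden d n)"
      unfolding ce[symmetric] using c n by (simp add: cfrac_convergents_def del: upt_Suc)
    then have "real (qs n * cden d n) = real (cnum d n * ps n)" using pos by (simp add: field_simps)
    then have "qs n * cden d n = cnum d n * ps n" by linarith
    moreover have "coprime (qs n) (ps n)" using c n by (auto simp: cfrac_convergents_def)
    moreover have "coprime (cnum d n) (cden d n)" unfolding m by (rule cnum_cden_coprime)
    ultimately show "qs n = cnum d n" "ps n = cden d n"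
      using coprime_crossproduct_nat[of "qs n" "ps n" "cnum d n" "cden d n"]
      by (auto simp: mult.commute coprime_commute)
  qed
  have cf: "cfrac (map d [1..<Suc n]) = real (qs n) / real (ps n)" if "n \<ge> 1" for n
    using c that by (auto simp: cfrac_convergents_def)
  have pos: "ps n > 0" if "n \<ge> 1" for n using c that by (auto simp: cfrac_convergents_def)
  show "ps (2 * k + 1) > 0" "ps (2 * k + 2) > 0" by (simp_all add: pos)
  have irr: "real (qs n) / real (ps n) \<noteq> R" for n using R by (metis Rats_divide Rats_of_nat)
  have cone: "\<exists>\<alpha>::nat. int (qs n) * int (ps m) - int (qs m) * int (ps n) = int \<alpha> * (- 1) ^ Suc m"
    if mn: "m \<ge> 1" "n \<ge> m" for m n
  proof -
    obtain a b where ab: "cnum d n = a * cnum d (Suc m) + b * cnum d m" "cden d n = a * cden d (Suc m) + b * cden d m"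
      using cnum_cden_cone[where d = d and m = m and n = "n - m"] mn by auto
    have "int (cnum d n) * int (cden d m) - int (cnum d m) * int (cden d n)
      = int a * (int (cnum d (Suc m)) * int (cden d m) - int (cnum d m) * int (cden d (Suc m)))"
      unfolding ab by (simp add: algebra_simps)
    then have "int (cnum d n) * int (cden d m) - int (cnum d m) * int (cden d n) = int a * (- 1) ^ Suc m"
      unfolding cnum_cden_det .
    then show ?thesis using eq mn by auto
  qed
  have "real (qs (2 * k + 1)) / real (ps (2 * k + 1)) \<le> R"
  proof (rule tendsto_lowerbound[OF lim])
    show "\<forall>\<^sub>F n in sequentially. real (qs (2 * k + 1)) / real (ps (2 * k + 1)) \<le> cfrac (map d [1..<Suc n])"
      unfolding eventually_sequentially
    proof (intro exI[of _ "2 * k + 1"] allI impI)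
      fix n assume n: "2 * k + 1 \<le> n"
      then obtain \<alpha> :: nat where "int (qs n) * int (ps (2 * k + 1)) - int (qs (2 * k + 1)) * int (ps n) = int \<alpha>"
        using cone[of "2 * k + 1" n] by auto
      then have "qs (2 * k + 1) * ps n \<le> qs n * ps (2 * k + 1)"
        by (metis diff_ge_0_iff_ge of_nat_0_le_iff of_nat_le_iff of_nat_mult)
      then have "real (qs (2 * k + 1)) * real (ps n) \<le> real (qs n) * real (ps (2 * k + 1))"
        by (metis of_nat_le_iff of_nat_mult)
      then show "real (qs (2 * k + 1)) / real (ps (2 * k + 1)) \<le> cfrac (map d [1..<Suc n])"
        using n pos[of n] pos[of "2 * k + 1"] by (subst cf) (auto simp: field_simps)
    qed
  qed simp
  then show "real (qs (2 * k + 1)) / real (ps (2 * k + 1)) < R" using irr[of "2 * k + 1"] by simp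
  have "R \<le> real (qs (2 * k + 2)) / real (ps (2 * k + 2))"
  proof (rule tendsto_upperbound[OF lim])
    show "\<forall>\<^sub>F n in sequentially. cfrac (map d [1..<Suc n]) \<le> real (qs (2 * k + 2)) / real (ps (2 * k + 2))"
      unfolding eventually_sequentially
    proof (intro exI[of _ "2 * k + 2"] allI impI)
      fix n assume n: "2 * k + 2 \<le> n"
      then obtain \<alpha> :: nat where "int (qs n) * int (ps (2 * k + 2)) - int (qs (2 * k + 2)) * int (ps n) = - int \<alpha>"
        using cone[of "2 * k + 2" n] by auto
      then have "int (qs n) * int (ps (2 * k + 2)) \<le> int (qs (2 * k + 2)) * int (ps n)" by linarith
      then have "qs n * ps (2 * k + 2) \<le> qs (2 * k + 2) * ps n"
        by (metis of_nat_le_iff of_nat_mult)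
      then have "real (qs n) * real (ps (2 * k + 2)) \<le> real (qs (2 * k + 2)) * real (ps n)"
        by (metis of_nat_le_iff of_nat_mult)
      then show "cfrac (map d [1..<Suc n]) \<le> real (qs (2 * k + 2)) / real (ps (2 * k + 2))"
        using n pos[of n] pos[of "2 * k + 2"] by (subst cf) (auto simp: field_simps)
    qed
  qed simp
  then show "R < real (qs (2 * k + 2)) / real (ps (2 * k + 2))" using irr[of "2 * k + 2"] by simp
  show "int (qs (2 * k + 2)) * int (ps (2 * k + 1)) - int (qs (2 * k + 1)) * int (ps (2 * k + 2)) = 1"
    using cnum_cden_det[of d "2 * k + 1"] by (simp add: eq del: cnum.simps cden.simps)
qed

section \<open>Exponents outside the cone are contracted\<close>

text \<open>In the plane with coordinates \<open>(m\<^sub>1, m\<^sub>2)\<close> the ray through \<open>(p, q)\<close> has slope \<open>q / p\<close>; the set \<open>full\<close> contains the exponents that occur in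
any map.\<close>

definition below :: "nat \<Rightarrow> nat \<Rightarrow> (int \<times> int) set" where
  "below p q = {u \<in> full. int p * snd u < int q * fst u}"

definition above :: "nat \<Rightarrow> nat \<Rightarrow> (int \<times> int) set" where
  "above p q = {u \<in> full. int q * fst u < int p * snd u}"

lemma expset_full_minus:
  "expset (full - below p q)" "expset (full - above p q)" "expset (full - below p q - above p' q')"
proof -
  have full: "u \<in> full \<Longrightarrow> v \<in> full \<Longrightarrow> u + v \<in> full" "0 \<in> full" "u \<in> full \<Longrightarrow> u \<noteq> 0 \<Longrightarrow> fst u + snd u \<ge> 1" for u v
    using expset_full by (auto simp: expset_def)
  show "expset (full - below p q)" "expset (full - above p q)" "expset (full - below p q - above p' q')"
    unfolding expset_def by (auto simp: below_def above_def full distrib_left not_less intro: add_mono)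
qed

text \<open>Cramer's rule with determinant one; \<open>i\<close> and \<open>j\<close> are nonnegative because \<open>u\<close> is neither below the first ray nor above the second.\<close>

lemma cone_generators:
  assumes det: "int q' * int p - int q * int p' = 1" and u: "u \<in> full - below p q - above p' q'"
  obtains i j :: nat where "u = (int i * int p + int j * int p', int i * int q + int j * int q')"
proof -
  obtain m n where mn: "u = (m, n)" by (cases u)
  define i where "i = int q' * m - int p' * n"
  define j where "j = int p * n - int q * m"
  have ij: "0 \<le> i" "0 \<le> j" using u by (auto simp: below_def above_def mn i_def j_def)
  have "i * int p + j * int p' = (int q' * int p - int q * int p') * m"
    "i * int q + j * int q' = (int q' * int p - int q * int p') * n"
    by (simp_all add: i_def j_def algebra_simps)
  then have "m = i * int p + j * int p'" "n = i * int q + j * int q'" unfolding det by simp_all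
  then show ?thesis using ij by (intro that[of "nat i" "nat j"]) (simp add: mn)
qed

lemma cone_generators_inj:
  fixes i j i' j' p q p' q' :: nat
  assumes det: "int q' * int p - int q * int p' = 1"
    and eq: "i * p + j * p' = i' * p + j' * p'" "i * q + j * q' = i' * q + j' * q'"
  shows "i = i' \<and> j = j'"
proof -
  have e: "int i * int p + int j * int p' = int i' * int p + int j' * int p'"
     "int i * int q + int j * int q' = int i' * int q + int j' * int q'"
    using eq by (metis of_nat_add of_nat_mult)+
  have "int i * (int q' * int p - int q * int p') = int i' * (int q' * int p - int q * int p')"
    "int j * (int q' * int p - int q * int p') = int j' * (int q' * int p - int q * int p')"
    using e by algebra+
  then show ?thesis unfolding det by simp
qed

text \<open>For exponents \<open>(m, n)\<close> below a ray of slope \<open>c\<close>, and with the logarithms \<open>a, b\<close> of the moduli of the eigenvalues, \<open>a m + b n\<close> is at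
most \<open>m (a + c b)\<close>, where \<open>a + c b < 0\<close> says that the ray itself is contracted. The number \<open>\<epsilon>\<close> leaves room for a perturbation of the eigenvalues.
The exponents above a ray are treated by exchanging the coordinates.\<close>

lemma cone_exponent_bound:
  fixes a b \<epsilon> L m n c :: real
  assumes "0 \<le> c" "b > 0" "\<epsilon> > 0" "L = a + c * b" "\<epsilon> * (3 + c) \<le> - L / 2" "1 \<le> m" "n \<le> c * m"
  shows "2 * \<epsilon> + (\<epsilon> + a) * m + (\<epsilon> + b) * n \<le> L / 2"
proof -
  have "(\<epsilon> + b) * n \<le> (\<epsilon> + b) * (c * m)" using assms by (intro mult_left_mono) auto
  then have "2 * \<epsilon> + (\<epsilon> + a) * m + (\<epsilon> + b) * n \<le> 2 * \<epsilon> + (L + \<epsilon> * (1 + c)) * m"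
    by (simp add: assms(4) algebra_simps)
  also have "\<dots> \<le> 2 * \<epsilon> + (L + \<epsilon> * (1 + c)) * 1"
  proof -
    have "0 \<le> \<epsilon> * (3 + c)" using assms by simp
    then have "L + \<epsilon> * (1 + c) \<le> 0" using assms(3,5) by (simp add: algebra_simps)
    then show ?thesis using assms(6) by (intro add_left_mono mult_left_mono_neg)
  qed
  also have "\<dots> \<le> L / 2" using assms(5) by (simp add: algebra_simps)
  finally show ?thesis .
qed

lemma weight_exp:
  "exp \<epsilon> * exp (- z) * weight (exp \<epsilon> * exp a) (exp \<epsilon> * exp b) k
    = exp (\<epsilon> - z + (\<epsilon> + a) * real (fst k) + (\<epsilon> + b) * real (snd k))"
  by (simp add: weight_def exp_add[symmetric] exp_of_nat_mult[symmetric] algebra_simps)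

lemma below_index:
  assumes "0 < p" "u \<in> below p q"
  shows "1 \<le> fst u" "real_of_int (snd u) \<le> real q / real p * real_of_int (fst u)"
proof -
  have b: "int p * snd u < int q * fst u" "u = 0 \<or> 1 \<le> fst u + snd u" using assms(2) by (auto simp: below_def full_def)
  then have b2: "1 \<le> fst u + snd u" by auto
  show "1 \<le> fst u"
  proof (rule ccontr)
    assume "\<not> 1 \<le> fst u"
    then have f: "fst u \<le> 0" by simp
    then have "1 \<le> snd u" using b2 by linarith
    then have "0 \<le> int p * snd u" by simp
    moreover have "int q * fst u \<le> 0" using f by (simp add: mult_nonneg_nonpos)
    ultimately show False using b(1) by linarith
  qed
  have "real p * real_of_int (snd u) \<le> real q * real_of_int (fst u)"
    using b(1) by (metis less_imp_le of_int_le_iff of_int_mult of_int_of_nat_eq)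
  then show "real_of_int (snd u) \<le> real q / real p * real_of_int (fst u)"
    using assms(1) by (simp add: field_simps)
qed

lemma weight_below:
  assumes "0 < p" "0 < b" "0 < \<epsilon>" "L = a + real q / real p * b" "\<epsilon> * (3 + real q / real p) \<le> - L / 2"
  shows "k \<in> shifted (below p q) (1, 0) \<Longrightarrow> exp \<epsilon> * exp (- a) * weight (exp \<epsilon> * exp a) (exp \<epsilon> * exp b) k \<le> exp (L / 2)"
    and "k \<in> shifted (below p q) (0, 1) \<Longrightarrow> exp \<epsilon> * exp (- b) * weight (exp \<epsilon> * exp a) (exp \<epsilon> * exp b) k \<le> exp (L / 2)"
proof -
  have core: "2 * \<epsilon> + (\<epsilon> + a) * real_of_int (fst u) + (\<epsilon> + b) * real_of_int (snd u) \<le> L / 2"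
    if "u \<in> below p q" for u
    using below_index[OF assms(1) that] assms(1)
    by (intro cone_exponent_bound[OF _ assms(2-5)]) auto
  show "exp \<epsilon> * exp (- a) * weight (exp \<epsilon> * exp a) (exp \<epsilon> * exp b) k \<le> exp (L / 2)" if "k \<in> shifted (below p q) (1, 0)"
    using core[of "toZ k - (1, 0)"] that unfolding weight_exp
    by (simp add: shifted_def toZ_def algebra_simps)
  show "exp \<epsilon> * exp (- b) * weight (exp \<epsilon> * exp a) (exp \<epsilon> * exp b) k \<le> exp (L / 2)" if "k \<in> shifted (below p q) (0, 1)"
    using core[of "toZ k - (0, 1)"] that unfolding weight_exp
    by (simp add: shifted_def toZ_def algebra_simps)
qed

lemma above_eq_below: "(m, n) \<in> above p q \<longleftrightarrow> (n, m) \<in> below q p"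
  by (auto simp: above_def below_def full_def zero_prod_def)

lemma weight_above:
  assumes "0 < q" "0 < a" "0 < \<epsilon>" "L = b + real p / real q * a" "\<epsilon> * (3 + real p / real q) \<le> - L / 2"
  shows "k \<in> shifted (above p q) (1, 0) \<Longrightarrow> exp \<epsilon> * exp (- a) * weight (exp \<epsilon> * exp a) (exp \<epsilon> * exp b) k \<le> exp (L / 2)"
    and "k \<in> shifted (above p q) (0, 1) \<Longrightarrow> exp \<epsilon> * exp (- b) * weight (exp \<epsilon> * exp a) (exp \<epsilon> * exp b) k \<le> exp (L / 2)"
proof -
  have w: "weight s t k = weight t s (snd k, fst k)" for s t by (simp add: weight_def)
  show "exp \<epsilon> * exp (- a) * weight (exp \<epsilon> * exp a) (exp \<epsilon> * exp b) k \<le> exp (L / 2)" if "k \<in> shifted (above p q) (1, 0)"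
    using weight_below(2)[OF assms, of "(snd k, fst k)"] that
    by (simp add: w[of "exp \<epsilon> * exp a"] shifted_def toZ_def above_eq_below)
  show "exp \<epsilon> * exp (- b) * weight (exp \<epsilon> * exp a) (exp \<epsilon> * exp b) k \<le> exp (L / 2)" if "k \<in> shifted (above p q) (0, 1)"
    using weight_below(1)[OF assms, of "(snd k, fst k)"] that
    by (simp add: w[of "exp \<epsilon> * exp a"] shifted_def toZ_def above_eq_below)
qed

text \<open>The condition on the sets \<open>U1, U2\<close> in \<open>step_germ\<close>, with \<open>A, B\<close> the moduli of the eigenvalues at the base parameter. Room by a
factor \<open>\<kappa>\<close> is needed because the norms in the algebra are suprema over a neighbourhood of the base parameter and exceed these moduli.\<close>

definition contracts :: "(int \<times> int) set \<Rightarrow> real \<Rightarrow> real \<Rightarrow> real \<Rightarrow> real \<Rightarrow> bool" where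
  "contracts U \<kappa> \<theta> A B \<longleftrightarrow>
     (\<forall>k\<in>shifted U (1, 0). \<kappa> / A * weight (\<kappa> * A) (\<kappa> * B) k \<le> \<theta>) \<and>
     (\<forall>k\<in>shifted U (0, 1). \<kappa> / B * weight (\<kappa> * A) (\<kappa> * B) k \<le> \<theta>)"

text \<open>If \<open>\<bar>\<mu>\<^sub>2\<bar> > 1\<close>, the exponents below the cone are contracted by the map and those above it by the inverse; if \<open>\<bar>\<mu>\<^sub>2\<bar> < 1\<close>, the roles are exchanged.\<close>

lemma contracts_exists:
  fixes p q p' q' :: nat
  assumes p: "0 < p" "0 < p'" and R: "real q / real p < R" "R < real q' / real p'" "0 < R"
    and AB: "0 < A" "0 < B" "ln A / ln B = - R"
  obtains U V \<kappa> \<theta> where "U = below p q \<and> V = above p' q' \<or> U = above p' q' \<and> V = below p q"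
    "1 < \<kappa>" "0 \<le> \<theta>" "\<theta> < 1" "contracts U \<kappa> \<theta> A B" "contracts V \<kappa> \<theta> (1 / A) (1 / B)"
proof -
  define b where "b = ln B"
  have b0: "b \<noteq> 0" using AB R by (auto simp: b_def)
  have a: "ln A = - R * b" using AB b0 by (simp add: b_def field_simps)
  have E: "A = exp (- R * b)" "B = exp b" "1 / A = exp (R * b)" "1 / B = exp (- b)"
    using AB a by (auto simp: b_def exp_minus simp flip: a) (metis exp_ln exp_minus inverse_eq_divide minus_mult_left a minus_minus)+
  have q': "0 < real q' / real p'" using R by linarith
  then have q'0: "0 < q'" using p by (simp add: zero_less_divide_iff)
  define c where "c = real q / real p"
  define c' where "c' = real p' / real q'"
  have cc: "c < R" "0 \<le> c" "c' * R < 1" "0 \<le> c'"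
    using R p q'0 by (auto simp: c_def c'_def field_simps)
  \<comment> \<open>The logarithms of the moduli of \<open>\<mu>\<^sup>m\<close>, or of its inverse, for \<open>m\<close> on the two rays, normalised by \<open>m\<^sub>1 = 1\<close> and \<open>m\<^sub>2 = 1\<close>.\<close>
  define L where "L = - (\<bar>b\<bar> * (R - c))"
  define L' where "L' = - (\<bar>b\<bar> * (1 - c' * R))"
  have L: "L < 0" "L' < 0" using cc b0 by (auto simp: L_def L'_def)
  define \<epsilon> where "\<epsilon> = min (- L / 2 / (3 + c)) (- L' / 2 / (3 + c'))"
  have \<epsilon>: "0 < \<epsilon>" "\<epsilon> * (3 + c) \<le> - L / 2" "\<epsilon> * (3 + c') \<le> - L' / 2"
  proof -
    have "0 < - L / 2 / (3 + c)" "0 < - L' / 2 / (3 + c')" using L cc by (intro divide_pos_pos; simp)+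
    then show "0 < \<epsilon>" unfolding \<epsilon>_def by simp
    have "\<epsilon> \<le> - L / 2 / (3 + c)" "\<epsilon> \<le> - L' / 2 / (3 + c')" by (auto simp: \<epsilon>_def)
    then show "\<epsilon> * (3 + c) \<le> - L / 2" "\<epsilon> * (3 + c') \<le> - L' / 2"
      using cc pos_le_divide_eq[of "3 + c" \<epsilon> "- L / 2"] pos_le_divide_eq[of "3 + c'" \<epsilon> "- L' / 2"]
      by linarith+
  qed
  define \<theta> where "\<theta> = max (exp (L / 2)) (exp (L' / 2))"
  have \<theta>: "0 \<le> \<theta>" "\<theta> < 1" "exp (L / 2) \<le> \<theta>" "exp (L' / 2) \<le> \<theta>" using L by (auto simp: \<theta>_def le_max_iff_disj)
  have ex: "exp \<epsilon> / exp x = exp \<epsilon> * exp (- x)" for x by (simp add: exp_minus divide_inverse)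
  have bel: "contracts (below p q) (exp \<epsilon>) \<theta> (exp x) (exp y)" if "0 < y" "L = x + c * y" for x y
    unfolding contracts_def ex
    by (intro conjI ballI order.trans[OF _ \<theta>(3)]
        weight_below[OF p(1) that(1) \<epsilon>(1) that(2)[unfolded c_def] \<epsilon>(2)[unfolded c_def]])
  have abo: "contracts (above p' q') (exp \<epsilon>) \<theta> (exp x) (exp y)" if "0 < x" "L' = y + c' * x" for x y
    unfolding contracts_def ex
    by (intro conjI ballI order.trans[OF _ \<theta>(4)]
        weight_above[OF q'0 that(1) \<epsilon>(1) that(2)[unfolded c'_def] \<epsilon>(3)[unfolded c'_def]])
  have \<kappa>: "1 < exp \<epsilon>" using \<epsilon> by simp
  show ?thesis
  proof (cases "b > 0")
    case True
    have "contracts (below p q) (exp \<epsilon>) \<theta> A B"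
      unfolding E(1,2) using True by (intro bel) (auto simp: L_def algebra_simps)
    moreover have "contracts (above p' q') (exp \<epsilon>) \<theta> (1 / A) (1 / B)"
      unfolding E(3,4) using True R by (intro abo) (auto simp: L'_def algebra_simps)
    ultimately show ?thesis using that \<kappa> \<theta> by blast
  next
    case False
    then have "b < 0" using b0 by simp
    then have "contracts (above p' q') (exp \<epsilon>) \<theta> A B"
      unfolding E(1,2) using R by (intro abo) (auto simp: L'_def algebra_simps mult_pos_neg)
    moreover have "contracts (below p q) (exp \<epsilon>) \<theta> (1 / A) (1 / B)"
      unfolding E(3,4) using \<open>b < 0\<close> by (intro bel) (auto simp: L_def algebra_simps)
    ultimately show ?thesis using that \<kappa> \<theta> by blast
  qed
qed

section \<open>Families of functions given by power series over an algebra\<close>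

text \<open>The power series and the polydisk do not depend on the character. This turns into convergence uniform in the parameter.\<close>

definition expands :: "(('a::comm_banach_algebra \<Rightarrow> complex) \<Rightarrow> complex \<times> complex \<Rightarrow> complex) \<Rightarrow> bool" where
  "expands F \<longleftrightarrow> (\<exists>r>0. \<exists>c. wconv c r r \<and> (\<forall>\<omega> x. character \<omega> \<longrightarrow> x \<in> polydisk r r \<longrightarrow>
     ((\<lambda>k. \<omega> (c k) * mpow x k) has_sum F \<omega> x) UNIV))"

lemma expands_linear:
  fixes c :: "nat \<times> nat \<Rightarrow> 'a::comm_banach_algebra"
  assumes "germ c"
  shows "expands (\<lambda>\<omega> x. \<omega> a * mpow x e + ev \<omega> c x)"
proof -
  obtain r where r: "r > 0" "wconv c r r" using assms by (auto simp: germ_def)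
  define c' where "c' k = (if k = e then a else 0) + c k" for k
  have "(\<lambda>k. norm (if k = e then a else 0) * weight r r k) summable_on UNIV"
    by (rule finite_nonzero_values_imp_summable_on) (rule finite_subset[of _ "{e}"], auto)
  then have "(\<lambda>k. norm (if k = e then a else 0) * weight r r k + norm (c k) * weight r r k) summable_on UNIV"
    using r(2) unfolding wconv_def by (rule summable_on_add)
  then have w: "wconv c' r r"
    unfolding wconv_def
  proof (rule summable_on_comparison_test)
    fix k
    have "norm (c' k) \<le> norm (if k = e then a else 0) + norm (c k)" unfolding c'_def by (rule norm_triangle_ineq)
    then have "norm (c' k) * weight r r k \<le> (norm (if k = e then a else 0) + norm (c k)) * weight r r k"
      using r(1) by (intro mult_right_mono) auto
    then show "norm (c' k) * weight r r k \<le> norm (if k = e then a else 0) * weight r r k + norm (c k) * weight r r k"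
      by (simp only: distrib_right)
  qed (use r in auto)
  have "((\<lambda>k. \<omega> (c' k) * mpow x k) has_sum (\<omega> a * mpow x e + ev \<omega> c x)) UNIV"
    if \<omega>: "character \<omega>" and x: "x \<in> polydisk r r" for \<omega> x
  proof -
    have "((\<lambda>k. \<omega> (if k = e then a else 0) * mpow x k) has_sum \<omega> a * mpow x e) UNIV"
      by (rule has_sum_finite_neutralI[of "{e}"]) (auto simp: char_simps[OF \<omega>])
    from has_sum_add[OF this ev_has_sum[OF \<omega> r(2), of x]] show ?thesis
      using x by (simp add: c'_def char_simps(1)[OF \<omega>] distrib_right polydisk_iff)
  qed
  then show ?thesis unfolding expands_def using r w by blast
qed

lemma expands_ev:
  assumes "germ c" shows "expands (\<lambda>\<omega>. ev \<omega> c)"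
proof -
  obtain r where r: "r > 0" "wconv c r r" using assms by (auto simp: germ_def)
  then show ?thesis unfolding expands_def using ev_has_sum[of _ c r r]
    by (intro exI[of _ r] conjI exI[of _ c]) (auto simp: polydisk_iff)
qed

lemma expands_gmap:
  assumes "germs M F1 F2"
  shows "expands (\<lambda>\<omega> x. fst (gmap a b F1 F2 \<omega> x))" "expands (\<lambda>\<omega> x. snd (gmap a b F1 F2 \<omega> x))"
  using expands_linear[of F1 a "(1, 0)"] expands_linear[of F2 b "(0, 1)"] assms
  by (simp_all add: gmap_def mpow_def germs_def)

lemma expands_analytic_family:
  fixes \<omega> :: "'p::topological_space \<Rightarrow> 'a::comm_banach_algebra \<Rightarrow> complex"
  assumes F: "expands F" and \<omega>: "\<And>l. l \<in> \<Lambda> \<Longrightarrow> character (\<omega> l)"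
    and cont: "\<And>a. continuous_on \<Lambda> (\<lambda>l. \<omega> l a)" and ne: "\<Lambda> \<noteq> {}"
  shows "analytic_family \<Lambda> (\<lambda>l. F (\<omega> l))"
proof -
  obtain r c where r: "r > 0" "wconv c r r"
    "\<And>\<omega> x. character \<omega> \<Longrightarrow> x \<in> polydisk r r \<Longrightarrow> ((\<lambda>k. \<omega> (c k) * mpow x k) has_sum F \<omega> x) UNIV"
    using F unfolding expands_def by blast
  have bd: "norm (\<omega> l a) \<le> norm a" if "l \<in> \<Lambda>" for l a using char_simps(8)[OF \<omega>[OF that]] .
  have S: "0 \<le> (SUP l\<in>\<Lambda>. norm (\<omega> l a))" "(SUP l\<in>\<Lambda>. norm (\<omega> l a)) \<le> norm a" for a
  proof -
    obtain l where l: "l \<in> \<Lambda>" using ne by blast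
    have "norm (\<omega> l a) \<le> (SUP l\<in>\<Lambda>. norm (\<omega> l a))"
      by (rule cSUP_upper[OF l]) (use bd in \<open>auto intro!: bdd_aboveI2\<close>)
    then show "0 \<le> (SUP l\<in>\<Lambda>. norm (\<omega> l a))" using norm_ge_zero order_trans by blast
    show "(SUP l\<in>\<Lambda>. norm (\<omega> l a)) \<le> norm a" by (rule cSUP_least[OF ne bd])
  qed
  have "sup_convergent \<Lambda> (polydisk r r) UNIV (\<lambda>k l. \<omega> l (c k))"
    unfolding sup_convergent_def
  proof (intro conjI ballI)
    fix k show "continuous_on \<Lambda> (\<lambda>l. \<omega> l (c k))" by (rule cont)
    show "bounded ((\<lambda>l. \<omega> l (c k)) ` \<Lambda>)" using bd unfolding bounded_iff by blast
  next
    fix x assume x: "x \<in> polydisk r r"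
    show "(\<lambda>k. (SUP l\<in>\<Lambda>. norm (\<omega> l (c k))) * norm (mpow x k)) summable_on UNIV"
    proof (rule summable_on_comparison_test[OF r(2)[unfolded wconv_def]])
      fix k show "(SUP l\<in>\<Lambda>. norm (\<omega> l (c k))) * norm (mpow x k) \<le> norm (c k) * weight r r k"
        using x by (intro mult_mono S norm_mpow_le) (auto simp: polydisk_iff)
    qed (simp add: S)
  qed
  then show ?thesis
    unfolding analytic_family_def using r \<omega> by (intro exI[of _ r] conjI exI[of _ "\<lambda>k l. \<omega> l (c k)"]) auto
qed

lemma mpow_add: "mpow x (j + k) = mpow x j * mpow x k"
  by (simp add: mpow_def power_add)

lemma has_sum_nat_prod_split:
  fixes g :: "nat \<times> nat \<Rightarrow> 'b::real_normed_vector"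
  assumes 1: "((\<lambda>(i, j). g (Suc i, j)) has_sum S) UNIV" and 2: "((\<lambda>j. g (0, Suc j)) has_sum T) UNIV"
    and 0: "g (0, 0) = 0"
  shows "(g has_sum (S + T)) UNIV"
proof -
  have 1: "(g has_sum S) (range (\<lambda>(i, j). (Suc i, j)))"
    by (subst has_sum_reindex) (use 1 in \<open>auto simp: inj_on_def o_def case_prod_unfold\<close>)
  have 2: "(g has_sum T) (range (\<lambda>j. (0, Suc j)))"
    by (subst has_sum_reindex) (use 2 in \<open>auto simp: inj_on_def o_def\<close>)
  have "(g has_sum (S + T)) (range (\<lambda>(i, j). (Suc i, j)) \<union> range (\<lambda>j. (0, Suc j)))"
    by (rule has_sum_Un_disjoint[OF 1 2]) auto
  moreover have *: "x \<in> range (\<lambda>(i, j). (Suc i, j)) \<union> range (\<lambda>j. (0, Suc j))" if "g x \<noteq> 0" for x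
  proof (cases x)
    case (Pair i j)
    then show ?thesis using that 0 by (cases i; cases j) auto
  qed
  have "(g has_sum (S + T)) UNIV \<longleftrightarrow> (g has_sum (S + T)) (range (\<lambda>(i, j). (Suc i, j)) \<union> range (\<lambda>j. (0, Suc j)))"
    by (rule has_sum_cong_neutral) (use * in auto)
  ultimately show ?thesis by simp
qed

text \<open>Every monomial of \<open>G\<close> is \<open>x\<^sup>e u\<^sup>i u'\<^sup>j\<close> with a unique pair \<open>(i, j) \<noteq> (0, 0)\<close>. Those divisible by \<open>u\<close> are collected in \<open>B1\<close>, those without
\<open>u\<close> in \<open>B2\<close>. If \<open>G\<close> converges on the polydisk of radius \<open>r\<close>, both converge on the polydisk with the corresponding radii
\<open>r\<^bsup>p + q\<^esup>\<close> and \<open>r\<^bsup>p' + q'\<^esup>\<close> for \<open>u\<close> and \<open>u'\<close>.\<close>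

lemma cone_series:
  fixes G :: "nat \<times> nat \<Rightarrow> 'a::comm_banach_algebra" and p q p' q' :: nat
  assumes det: "int q' * int p - int q * int p' = 1" and G: "germ G"
    and supp: "\<And>k. G k \<noteq> 0 \<Longrightarrow> \<exists>i j. (i, j) \<noteq> (0, 0) \<and> k = e + (i * p + j * p', i * q + j * q')"
  obtains B1 B2 where "germ B1" "germ B2"
    "near0 (\<lambda>\<omega> x. ev \<omega> G x = mpow x e * (mpow x (p, q) * ev \<omega> B1 (mpow x (p, q), mpow x (p', q'))
       + mpow x (p', q') * ev \<omega> B2 (mpow x (p, q), mpow x (p', q'))))"
proof -
  define \<iota> where "\<iota> = (\<lambda>(i, j). e + (i * p + j * p', i * q + j * q'))"
  have inj: "inj \<iota>"
  proof (rule injI)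
    fix x y assume eq: "\<iota> x = \<iota> y"
    obtain i j i' j' where xy: "x = (i, j)" "y = (i', j')" by (cases x, cases y)
    have "i = i' \<and> j = j'"
      by (rule cone_generators_inj[OF det]) (use eq in \<open>simp_all add: \<iota>_def xy prod_eq_iff\<close>)
    then show "x = y" by (simp add: xy)
  qed
  obtain r where r: "r > 0" "wconv G r r" using G by (auto simp: germ_def)
  define s where "s = r ^ (p + q)"
  define t where "t = r ^ (p' + q')"
  have st: "s > 0" "t > 0" using r by (simp_all add: s_def t_def)
  have w\<iota>: "weight r r (\<iota> (i, j)) = weight r r e * (s ^ i * t ^ j)" for i j
    by (simp add: weight_def \<iota>_def s_def t_def flip: power_mult power_add) (simp add: algebra_simps)
  have we: "weight r r e > 0" using r by (simp add: weight_def)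
  have sub: "(\<lambda>k. norm (G (\<iota> (f k))) * weight r r (\<iota> (f k))) summable_on UNIV" if f: "inj f" for f :: "nat \<times> nat \<Rightarrow> nat \<times> nat"
  proof -
    have "(\<lambda>k. norm (G k) * weight r r k) summable_on range (\<iota> \<circ> f)"
      using r(2) unfolding wconv_def by (rule summable_on_subset_banach) auto
    then show ?thesis
      by (subst (asm) summable_on_reindex) (use inj_compose[OF inj f] in \<open>simp_all add: o_def\<close>)
  qed
  define B1 where "B1 = (\<lambda>(i, j). G (\<iota> (Suc i, j)))"
  define B2 where "B2 = (\<lambda>(i :: nat, j). if i = 0 then G (\<iota> (0, Suc j)) else 0)"
  have conv1: "wconv B1 s t"
  proof -
    have "(\<lambda>k. norm (G (\<iota> (apfst Suc k))) * weight r r (\<iota> (apfst Suc k)) * inverse (weight r r e * s)) summable_on UNIV"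
      by (rule summable_on_cmult_left[OF sub]) (auto simp: inj_on_def)
    moreover have "norm (G (\<iota> (apfst Suc k))) * weight r r (\<iota> (apfst Suc k)) * inverse (weight r r e * s) = norm (B1 k) * weight s t k" for k
      using we st by (cases k) (simp add: w\<iota> B1_def weight_def[of s] field_simps)
    ultimately show ?thesis by (simp add: wconv_def)
  qed
  have conv2: "wconv B2 s t"
  proof -
    have "(\<lambda>k. norm (G (\<iota> (apsnd Suc k))) * weight r r (\<iota> (apsnd Suc k)) * inverse (weight r r e * t)) summable_on UNIV"
      by (rule summable_on_cmult_left[OF sub]) (auto simp: inj_on_def)
    moreover have "norm (B2 k) * weight s t k \<le> norm (G (\<iota> (apsnd Suc k))) * weight r r (\<iota> (apsnd Suc k)) * inverse (weight r r e * t)" for k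
      using we st by (cases k) (simp add: w\<iota> B2_def weight_def[of s] field_simps)
    ultimately show ?thesis
      unfolding wconv_def by (rule summable_on_comparison_test) (use st in auto)
  qed
  have "germ B1" "germ B2"
    unfolding germ_def using wconv_mono(1)[OF conv1, of "min s t" "min s t"] wconv_mono(1)[OF conv2, of "min s t" "min s t"] st
    by (intro exI[of _ "min s t"]; simp)+
  moreover have "near0 (\<lambda>\<omega> x. ev \<omega> G x = mpow x e * (mpow x (p, q) * ev \<omega> B1 (mpow x (p, q), mpow x (p', q'))
       + mpow x (p', q') * ev \<omega> B2 (mpow x (p, q), mpow x (p', q'))))"
    unfolding near0_def
  proof (intro exI[of _ r] conjI allI impI r(1))
    fix \<omega> :: "'a \<Rightarrow> complex" and x assume \<omega>: "character \<omega>" and "x \<in> polydisk r r"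
    then have x: "norm (fst x) \<le> r" "norm (snd x) \<le> r" by (auto simp: polydisk_iff)
    let ?u = "mpow x (p, q)" and ?v = "mpow x (p', q')"
    have uv: "norm (fst (?u, ?v)) \<le> s" "norm (snd (?u, ?v)) \<le> t"
      using norm_mpow_le[OF x, of "(p, q)"] norm_mpow_le[OF x, of "(p', q')"]
      by (simp_all add: weight_def s_def t_def power_add)
    define g where "g = (\<lambda>k. \<omega> (G (\<iota> k)) * mpow x (\<iota> k))"
    have m\<iota>: "mpow x (\<iota> (i, j)) = mpow x e * (?u ^ i * ?v ^ j)" for i j
      by (simp add: \<iota>_def mpow_add) (simp add: mpow_def power_add power_mult_distrib mult.commute[of i p]
        mult.commute[of i q] mult.commute[of j p'] mult.commute[of j q'] flip: power_mult)
    have "((\<lambda>k. \<omega> (G k) * mpow x k) has_sum ev \<omega> G x) UNIV"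
      by (rule ev_has_sum[OF \<omega> r(2) x])
    also have "?this \<longleftrightarrow> ((\<lambda>k. \<omega> (G k) * mpow x k) has_sum ev \<omega> G x) (range \<iota>)"
    proof (rule has_sum_cong_neutral)
      fix k assume "k \<in> UNIV - range \<iota>"
      then have "G k = 0" using supp[of k] by (force simp: \<iota>_def)
      then show "\<omega> (G k) * mpow x k = 0" by (simp add: char_simps(4)[OF \<omega>])
    qed auto
    finally have tot: "(g has_sum ev \<omega> G x) UNIV"
      by (subst (asm) has_sum_reindex) (use inj in \<open>auto simp: g_def o_def\<close>)
    have b1: "((\<lambda>(i, j). g (Suc i, j)) has_sum (mpow x e * ?u) * ev \<omega> B1 (?u, ?v)) UNIV"
      using has_sum_cmult_right[OF ev_has_sum[OF \<omega> conv1 uv], of "mpow x e * ?u"]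
      by (rule has_sum_cong[THEN iffD1, rotated]) (auto simp: g_def B1_def m\<iota> mpow_def[of "(_, _)"])
    have "((\<lambda>k. (mpow x e * ?v) * (\<omega> (B2 k) * mpow (?u, ?v) k)) has_sum (mpow x e * ?v) * ev \<omega> B2 (?u, ?v)) UNIV"
      by (rule has_sum_cmult_right[OF ev_has_sum[OF \<omega> conv2 uv]])
    also have "?this \<longleftrightarrow> ((\<lambda>k. (mpow x e * ?v) * (\<omega> (B2 k) * mpow (?u, ?v) k)) has_sum (mpow x e * ?v) * ev \<omega> B2 (?u, ?v)) (range (Pair 0))"
      by (rule has_sum_cong_neutral) (auto simp: B2_def char_simps(4)[OF \<omega>] image_iff)
    also have "\<dots> \<longleftrightarrow> ((\<lambda>j. g (0, Suc j)) has_sum (mpow x e * ?v) * ev \<omega> B2 (?u, ?v)) UNIV"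
    proof -
      have *: "(\<lambda>k. (mpow x e * ?v) * (\<omega> (B2 k) * mpow (?u, ?v) k)) \<circ> Pair 0 = (\<lambda>j. g (0, Suc j))"
        by (rule ext) (simp add: g_def B2_def m\<iota> mpow_def[of "(_, _)"])
      have "inj (Pair (0::nat))" by (rule injI) simp
      then show ?thesis by (subst has_sum_reindex) (simp_all only: *)
    qed
    finally have b2: "((\<lambda>j. g (0, Suc j)) has_sum (mpow x e * ?v) * ev \<omega> B2 (?u, ?v)) UNIV" .
    have "G (\<iota> (0, 0)) = 0"
    proof (rule ccontr)
      assume "G (\<iota> (0, 0)) \<noteq> 0"
      then obtain i j where ij: "(i, j) \<noteq> (0, 0)" "\<iota> (0, 0) = e + (i * p + j * p', i * q + j * q')"
        using supp by blast
      from ij(2) have "\<iota> (0, 0) = \<iota> (i, j)" by (simp add: \<iota>_def)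
      then show False using injD[OF inj] ij(1) by blast
    qed
    then have "g (0, 0) = 0" by (simp add: g_def char_simps(4)[OF \<omega>])
    from has_sum_unique[OF tot has_sum_nat_prod_split[OF b1 b2 this]]
    show "ev \<omega> G x = mpow x e * (?u * ev \<omega> B1 (?u, ?v) + ?v * ev \<omega> B2 (?u, ?v))"
      by (simp add: algebra_simps)
  qed
  ultimately show ?thesis by (rule that)
qed

definition cone_normal_form ::
  "nat \<Rightarrow> nat \<Rightarrow> nat \<Rightarrow> nat \<Rightarrow> complex \<Rightarrow> complex \<Rightarrow> (nat \<Rightarrow> nat \<Rightarrow> complex \<times> complex \<Rightarrow> complex) \<Rightarrow>
   complex \<times> complex \<Rightarrow> complex \<times> complex" where
  "cone_normal_form p q p' q' m1 m2 b x =
     (let u = mpow x (p, q); u' = mpow x (p', q') in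
        (fst x * (m1 + u * b 1 1 (u, u') + u' * b 2 1 (u, u')),
         snd x * (m2 + u * b 1 2 (u, u') + u' * b 2 2 (u, u'))))"

text \<open>The linear part over the algebra is only required to be close to the eigenvalues at the base parameter, up to the factor \<open>\<kappa>\<close>.\<close>

lemma normal_form_expands:
  fixes \<mu>1 \<mu>2 \<nu>1 \<nu>2 :: "'a::comm_banach_algebra" and p q p' q' :: nat
  assumes F: "germs full F1 F2" and \<mu>\<nu>: "\<mu>1 * \<nu>1 = 1" "\<mu>2 * \<nu>2 = 1"
    and AB: "0 < A" "0 < B" "norm \<mu>1 < \<kappa> * A" "norm \<mu>2 < \<kappa> * B" "norm \<nu>1 < \<kappa> / A" "norm \<nu>2 < \<kappa> / B"
    and UV: "U = below p q \<and> V = above p' q' \<or> U = above p' q' \<and> V = below p q"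
    and \<kappa>\<theta>: "1 < \<kappa>" "0 \<le> \<theta>" "\<theta> < 1" "contracts U \<kappa> \<theta> A B" "contracts V \<kappa> \<theta> (1 / A) (1 / B)"
    and det: "int q' * int p - int q * int p' = 1"
  obtains H HI G and B :: "nat \<Rightarrow> nat \<Rightarrow> ('a \<Rightarrow> complex) \<Rightarrow> complex \<times> complex \<Rightarrow> complex" where
    "expands (\<lambda>\<omega> x. fst (H \<omega> x))" "expands (\<lambda>\<omega> x. snd (H \<omega> x))"
    "expands (\<lambda>\<omega> x. fst (HI \<omega> x))" "expands (\<lambda>\<omega> x. snd (HI \<omega> x))"
    "expands (\<lambda>\<omega> x. fst (G \<omega> x))" "expands (\<lambda>\<omega> x. snd (G \<omega> x))"
    "\<And>i j. expands (B i j)" "small_map H" "small_map HI"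
    "HI \<odot> H \<doteq> idm" "H \<odot> HI \<doteq> idm" "G \<doteq> HI \<odot> gmap \<mu>1 \<mu>2 F1 F2 \<odot> H"
    "G \<doteq> (\<lambda>\<omega>. cone_normal_form p q p' q' (\<omega> \<mu>1) (\<omega> \<mu>2) (\<lambda>i j. B i j \<omega>))"
proof -
  have S: "full - U - V = full - below p q - above p' q'" using UV by blast
  have M: "expset (full - U)" "expset (full - U - V)" unfolding S using UV expset_full_minus by auto
  have st: "0 \<le> \<kappa> * A" "0 \<le> \<kappa> * B" "0 \<le> \<kappa> * (1 / A)" "0 \<le> \<kappa> * (1 / B)" using AB \<kappa>\<theta> by auto
  have U: "norm \<nu>1 * weight (\<kappa> * A) (\<kappa> * B) k \<le> \<theta>" if "k \<in> shifted U (1, 0)" for k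
    using mult_right_mono[OF less_imp_le[OF AB(5)] weight_nonneg[OF st(1,2), of k]] that \<kappa>\<theta>(4) unfolding contracts_def
    by fastforce
  have U': "norm \<nu>2 * weight (\<kappa> * A) (\<kappa> * B) k \<le> \<theta>" if "k \<in> shifted U (0, 1)" for k
    using mult_right_mono[OF less_imp_le[OF AB(6)] weight_nonneg[OF st(1,2), of k]] that \<kappa>\<theta>(4) unfolding contracts_def
    by fastforce
  have V: "norm \<mu>1 * weight (\<kappa> * (1 / A)) (\<kappa> * (1 / B)) k \<le> \<theta>" if "k \<in> shifted V (1, 0)" for k
  proof -
    have "\<kappa> / (1 / A) * weight (\<kappa> * (1 / A)) (\<kappa> * (1 / B)) k \<le> \<theta>" using that \<kappa>\<theta>(5) unfolding contracts_def by blast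
    then show ?thesis
      using mult_right_mono[OF less_imp_le[OF AB(3)] weight_nonneg[OF st(3,4), of k]] by simp
  qed
  have V': "norm \<mu>2 * weight (\<kappa> * (1 / A)) (\<kappa> * (1 / B)) k \<le> \<theta>" if "k \<in> shifted V (0, 1)" for k
  proof -
    have "\<kappa> / (1 / B) * weight (\<kappa> * (1 / A)) (\<kappa> * (1 / B)) k \<le> \<theta>" using that \<kappa>\<theta>(5) unfolding contracts_def by blast
    then show ?thesis
      using mult_right_mono[OF less_imp_le[OF AB(4)] weight_nonneg[OF st(3,4), of k]] by simp
  qed
  have nn: "norm \<nu>1 < \<kappa> * (1 / A)" "norm \<nu>2 < \<kappa> * (1 / B)" using AB by simp_all
  obtain H1 H2 I1 I2 G1 G2 where g: "germs full H1 H2" "germs full I1 I2" "germs (full - U - V) G1 G2"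
    "gmap 1 1 I1 I2 \<odot> gmap 1 1 H1 H2 \<doteq> idm" "gmap 1 1 H1 H2 \<odot> gmap 1 1 I1 I2 \<doteq> idm"
    "gmap \<mu>1 \<mu>2 G1 G2 \<doteq> gmap 1 1 I1 I2 \<odot> gmap \<mu>1 \<mu>2 F1 F2 \<odot> gmap 1 1 H1 H2"
    by (rule normal_form_germ[OF F \<mu>\<nu> AB(3,4) nn \<kappa>\<theta>(2,3) U U' V V' M])
  have su: "\<exists>i j. (i, j) \<noteq> (0, 0) \<and> k = e + (i * p + j * p', i * q + j * q')"
    if k: "k \<in> shifted (full - U - V - {0}) (toZ e)" for k e
  proof -
    have u: "toZ k - toZ e \<in> full - below p q - above p' q'" "toZ k - toZ e \<noteq> 0"
      using k unfolding shifted_def S by auto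
    obtain i j :: nat where ij: "toZ k - toZ e = (int i * int p + int j * int p', int i * int q + int j * int q')"
      by (rule cone_generators[OF det u(1)])
    then have "k = e + (i * p + j * p', i * q + j * q')"
      by (auto simp: toZ_def prod_eq_iff algebra_simps simp flip: of_nat_mult of_nat_add)
    moreover have "(i, j) \<noteq> (0, 0)" using ij u(2) by (auto simp: zero_prod_def)
    ultimately show ?thesis by blast
  qed
  have s1: "\<exists>i j. (i, j) \<noteq> (0, 0) \<and> k = (1, 0) + (i * p + j * p', i * q + j * q')" if "G1 k \<noteq> 0" for k
  proof (rule su)
    have "k \<in> shifted (full - U - V - {0}) (1, 0)" using g(3) that unfolding germs_def by blast
    then show "k \<in> shifted (full - U - V - {0}) (toZ (1, 0))" by (simp add: toZ_def)
  qed
  have s2: "\<exists>i j. (i, j) \<noteq> (0, 0) \<and> k = (0, 1) + (i * p + j * p', i * q + j * q')" if "G2 k \<noteq> 0" for k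
  proof (rule su)
    have "k \<in> shifted (full - U - V - {0}) (0, 1)" using g(3) that unfolding germs_def by blast
    then show "k \<in> shifted (full - U - V - {0}) (toZ (0, 1))" by (simp add: toZ_def)
  qed
  have gG: "germ G1" "germ G2" using g(3) by (auto simp: germs_def)
  obtain B11 B21 where b1: "germ B11" "germ B21"
    "near0 (\<lambda>\<omega> x. ev \<omega> G1 x = mpow x (1, 0) * (mpow x (p, q) * ev \<omega> B11 (mpow x (p, q), mpow x (p', q'))
       + mpow x (p', q') * ev \<omega> B21 (mpow x (p, q), mpow x (p', q'))))"
    by (rule cone_series[OF det gG(1) s1])
  obtain B12 B22 where b2: "germ B12" "germ B22"
    "near0 (\<lambda>\<omega> x. ev \<omega> G2 x = mpow x (0, 1) * (mpow x (p, q) * ev \<omega> B12 (mpow x (p, q), mpow x (p', q'))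
       + mpow x (p', q') * ev \<omega> B22 (mpow x (p, q), mpow x (p', q'))))"
    by (rule cone_series[OF det gG(2) s2])
  define B where "B i j = (\<lambda>\<omega>. ev \<omega> (if i = 1 then if j = 1 then B11 else B12 else if j = 1 then B21 else B22))"
    for i j :: nat
  show ?thesis
  proof (rule that[of "gmap 1 1 H1 H2" "gmap 1 1 I1 I2" "gmap \<mu>1 \<mu>2 G1 G2" B])
    show "expands (B i j)" for i j unfolding B_def by (rule expands_ev) (use b1 b2 in auto)
    show "gmap \<mu>1 \<mu>2 G1 G2 \<doteq> (\<lambda>\<omega>. cone_normal_form p q p' q' (\<omega> \<mu>1) (\<omega> \<mu>2) (\<lambda>i j. B i j \<omega>))"
      unfolding near_eq_def using near0_conj[OF b1(3) b2(3)]
      by (rule near0_mono) (simp add: gmap_def cone_normal_form_def Let_def B_def mpow_def algebra_simps)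
  qed (rule expands_gmap[OF g(1)] expands_gmap[OF g(2)] expands_gmap[OF g(3)]
      small_gmap[OF expset_full g(1)] small_gmap[OF expset_full g(2)] g(4-6))+
qed

definition normal_form_family ::
  "'p::topological_space set \<Rightarrow> ('p \<Rightarrow> complex \<times> complex \<Rightarrow> complex \<times> complex) \<Rightarrow>
   ('p \<Rightarrow> complex) \<Rightarrow> ('p \<Rightarrow> complex) \<Rightarrow> nat \<Rightarrow> nat \<Rightarrow> nat \<Rightarrow> nat \<Rightarrow>
   ('p \<Rightarrow> complex \<times> complex \<Rightarrow> complex \<times> complex) \<Rightarrow>
   ('p \<Rightarrow> complex \<times> complex \<Rightarrow> complex \<times> complex) \<Rightarrow>
   ('p \<Rightarrow> complex \<times> complex \<Rightarrow> complex \<times> complex) \<Rightarrow>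
   (nat \<Rightarrow> nat \<Rightarrow> 'p \<Rightarrow> complex \<times> complex \<Rightarrow> complex) \<Rightarrow> bool" where
  "normal_form_family \<Lambda>' f \<mu>1 \<mu>2 p q p' q' h hinv g b \<longleftrightarrow>
     analytic_map_family \<Lambda>' h \<and> analytic_map_family \<Lambda>' hinv \<and> analytic_map_family \<Lambda>' g \<and>
     (\<forall>l\<in>\<Lambda>'. local_analytic_diffeo (h l)) \<and>
     (\<forall>i\<in>{1,2}. \<forall>j\<in>{1,2}. analytic_family \<Lambda>' (b i j)) \<and>
     (\<exists>r>0. \<forall>l\<in>\<Lambda>'. \<forall>x\<in>polydisk r r.
        hinv l (h l x) = x \<and> h l (hinv l x) = x \<and> g l x = hinv l (f l (h l x)) \<and>
        g l x = cone_normal_form p q p' q' (\<mu>1 l) (\<mu>2 l) (\<lambda>i j. b i j l) x)"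

text \<open>The passage from characters to parameters: \<open>\<omega> l\<close> is evaluation at the parameter value \<open>l\<close>. Everything in the conclusion except
the dependence of a prescribed type on the parameter is obtained here for all algebras at once.\<close>

lemma family_normal_form:
  fixes \<mu>1 \<mu>2 \<nu>1 \<nu>2 :: "'a::comm_banach_algebra" and p q p' q' :: nat
    and \<omega> :: "'p::topological_space \<Rightarrow> 'a \<Rightarrow> complex"
  assumes F: "germs full F1 F2" and \<mu>\<nu>: "\<mu>1 * \<nu>1 = 1" "\<mu>2 * \<nu>2 = 1"
    and AB: "0 < A" "0 < B" "norm \<mu>1 < \<kappa> * A" "norm \<mu>2 < \<kappa> * B" "norm \<nu>1 < \<kappa> / A" "norm \<nu>2 < \<kappa> / B"
    and UV: "U = below p q \<and> V = above p' q' \<or> U = above p' q' \<and> V = below p q"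
    and \<kappa>\<theta>: "1 < \<kappa>" "0 \<le> \<theta>" "\<theta> < 1" "contracts U \<kappa> \<theta> A B" "contracts V \<kappa> \<theta> (1 / A) (1 / B)"
    and det: "int q' * int p - int q * int p' = 1"
    and \<omega>: "\<And>l. l \<in> \<Lambda> \<Longrightarrow> character (\<omega> l)" "\<And>a. continuous_on \<Lambda> (\<lambda>l. \<omega> l a)" "\<Lambda> \<noteq> {}"
    and f: "0 < \<rho>" "\<And>l x. l \<in> \<Lambda> \<Longrightarrow> x \<in> polydisk \<rho> \<rho> \<Longrightarrow> f l x = gmap \<mu>1 \<mu>2 F1 F2 (\<omega> l) x"
    and m: "\<And>l. l \<in> \<Lambda> \<Longrightarrow> \<omega> l \<mu>1 = m1 l" "\<And>l. l \<in> \<Lambda> \<Longrightarrow> \<omega> l \<mu>2 = m2 l"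
  obtains H HI G and B :: "nat \<Rightarrow> nat \<Rightarrow> ('a \<Rightarrow> complex) \<Rightarrow> complex \<times> complex \<Rightarrow> complex" where
    "expands (\<lambda>\<omega> x. fst (H \<omega> x))" "expands (\<lambda>\<omega> x. snd (H \<omega> x))"
    "expands (\<lambda>\<omega> x. fst (G \<omega> x))" "expands (\<lambda>\<omega> x. snd (G \<omega> x))" "\<And>i j. expands (B i j)"
    "normal_form_family \<Lambda> f m1 m2 p q p' q' (\<lambda>l. H (\<omega> l)) (\<lambda>l. HI (\<omega> l)) (\<lambda>l. G (\<omega> l)) (\<lambda>i j l. B i j (\<omega> l))"
proof -
  obtain H HI G and B :: "nat \<Rightarrow> nat \<Rightarrow> ('a \<Rightarrow> complex) \<Rightarrow> complex \<times> complex \<Rightarrow> complex" where e: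
    "expands (\<lambda>\<omega> x. fst (H \<omega> x))" "expands (\<lambda>\<omega> x. snd (H \<omega> x))"
    "expands (\<lambda>\<omega> x. fst (HI \<omega> x))" "expands (\<lambda>\<omega> x. snd (HI \<omega> x))"
    "expands (\<lambda>\<omega> x. fst (G \<omega> x))" "expands (\<lambda>\<omega> x. snd (G \<omega> x))"
    "\<And>i j. expands (B i j)" "small_map H" "small_map HI"
    "HI \<odot> H \<doteq> idm" "H \<odot> HI \<doteq> idm" "G \<doteq> HI \<odot> gmap \<mu>1 \<mu>2 F1 F2 \<odot> H"
    "G \<doteq> (\<lambda>\<omega>. cone_normal_form p q p' q' (\<omega> \<mu>1) (\<omega> \<mu>2) (\<lambda>i j. B i j \<omega>))"
    by (rule normal_form_expands[OF F \<mu>\<nu> AB UV \<kappa>\<theta> det], rule that)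
  note fam = expands_analytic_family[where \<omega> = \<omega> and \<Lambda> = \<Lambda>, OF _ \<omega>]
  have aH: "analytic_map_family \<Lambda> (\<lambda>l. H (\<omega> l))" and aI: "analytic_map_family \<Lambda> (\<lambda>l. HI (\<omega> l))"
    and aG: "analytic_map_family \<Lambda> (\<lambda>l. G (\<omega> l))"
    unfolding analytic_map_family_def using e(1-6) by (auto intro!: fam)
  have at0: "analytic_map_at_zero (K (\<omega> l))" if "analytic_map_family \<Lambda> (\<lambda>l. K (\<omega> l))" "l \<in> \<Lambda>" for K l
    using that unfolding analytic_map_family_def analytic_family_def analytic_map_at_zero_def analytic_at_zero_def
    by (fast)
  have z: "K (\<omega> l) 0 = 0" if K: "small_map K" and l: "l \<in> \<Lambda>" for K l
  proof -
    have "K (\<omega> l) 0 \<in> polydisk r r" if r: "r > 0" for r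
    proof -
      have "near0 (\<lambda>\<omega> x. K \<omega> x \<in> polydisk r r)" using K r by (auto simp: small_map_def)
      then obtain s where "s > 0" "\<And>x. x \<in> polydisk s s \<Longrightarrow> K (\<omega> l) x \<in> polydisk r r"
        using \<omega>(1)[OF l] unfolding near0_def by blast
      then show ?thesis using polydisk_iff[of 0 s s] by simp
    qed
    then have "norm (fst (K (\<omega> l) 0)) < r" "norm (snd (K (\<omega> l) 0)) < r" if "r > 0" for r using that by (auto simp: polydisk_iff)
    then have "norm (fst (K (\<omega> l) 0)) = 0" "norm (snd (K (\<omega> l) 0)) = 0"
      by (metis less_irrefl norm_ge_zero order_le_less)+
    then show ?thesis by (simp add: prod_eq_iff)
  qed
  have "near0 (\<lambda>\<omega> x. H \<omega> x \<in> polydisk \<rho> \<rho>)" using e(8) f(1) by (auto simp: small_map_def)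
  from near0_conj[OF this near0_conj[OF near0_conj[OF e(10,11)[unfolded near_eq_def]] near0_conj[OF e(12,13)[unfolded near_eq_def]]]]
  obtain r where r: "r > 0" "\<And>\<omega> x. character \<omega> \<Longrightarrow> x \<in> polydisk r r \<Longrightarrow> H \<omega> x \<in> polydisk \<rho> \<rho> \<and>
       HI \<omega> (H \<omega> x) = x \<and> H \<omega> (HI \<omega> x) = x \<and> G \<omega> x = HI \<omega> (gmap \<mu>1 \<mu>2 F1 F2 \<omega> (H \<omega> x)) \<and>
       G \<omega> x = cone_normal_form p q p' q' (\<omega> \<mu>1) (\<omega> \<mu>2) (\<lambda>i j. B i j \<omega>) x"
    unfolding near0_def after_def idm_def by blast
  have diffeo: "local_analytic_diffeo (H (\<omega> l))" if l: "l \<in> \<Lambda>" for l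
    unfolding local_analytic_diffeo_def
  proof (intro conjI exI[of _ "HI (\<omega> l)"] z e(8,9) l at0 aH aI)
    have "open (polydisk r r)" "0 \<in> polydisk r r" using r(1) by (auto simp: polydisk_def open_Times zero_prod_def)
    then show "\<forall>\<^sub>F x in nhds 0. HI (\<omega> l) (H (\<omega> l) x) = x \<and> H (\<omega> l) (HI (\<omega> l) x) = x"
      unfolding eventually_nhds using r(2)[OF \<omega>(1)[OF l]] by blast
  qed
  have aB: "analytic_family \<Lambda> (\<lambda>l. B i j (\<omega> l))" for i j using e(7) by (rule fam)
  have conj: "HI (\<omega> l) (H (\<omega> l) x) = x \<and> H (\<omega> l) (HI (\<omega> l) x) = x \<and>
      G (\<omega> l) x = HI (\<omega> l) (f l (H (\<omega> l) x)) \<and>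
      G (\<omega> l) x = cone_normal_form p q p' q' (m1 l) (m2 l) (\<lambda>i j. B i j (\<omega> l)) x"
    if l: "l \<in> \<Lambda>" and x: "x \<in> polydisk r r" for l x
  proof -
    note rr = r(2)[OF \<omega>(1)[OF l] x]
    have "f l (H (\<omega> l) x) = gmap \<mu>1 \<mu>2 F1 F2 (\<omega> l) (H (\<omega> l) x)" using rr l by (intro f) auto
    then show ?thesis using rr unfolding m[OF l] by metis
  qed
  have "normal_form_family \<Lambda> f m1 m2 p q p' q' (\<lambda>l. H (\<omega> l)) (\<lambda>l. HI (\<omega> l)) (\<lambda>l. G (\<omega> l)) (\<lambda>i j l. B i j (\<omega> l))"
    unfolding normal_form_family_def using aH aI aG diffeo aB r(1) conj by blast
  then show ?thesis by (rule that[OF e(1,2,5,6,7)])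
qed

section \<open>Continuous dependence on the parameter\<close>

instantiation bcontfun :: (topological_space, real_normed_algebra_1) "{times, one}"
begin

definition times_bcontfun :: "('a \<Rightarrow>\<^sub>C 'b) \<Rightarrow> ('a \<Rightarrow>\<^sub>C 'b) \<Rightarrow> ('a \<Rightarrow>\<^sub>C 'b)"
  where "times_bcontfun f g = Bcontfun (\<lambda>x. apply_bcontfun f x * apply_bcontfun g x)"

definition one_bcontfun :: "'a \<Rightarrow>\<^sub>C 'b" where "one_bcontfun = const_bcontfun 1"

instance ..

end

lemma bcontfun_one [simp]: "apply_bcontfun 1 x = 1"
  by (simp add: one_bcontfun_def const_bcontfun.rep_eq)

lemma bcontfun_times [simp]: "apply_bcontfun (f * g) x = apply_bcontfun f x * apply_bcontfun g x"
proof -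
  have "(\<lambda>x. apply_bcontfun f x * apply_bcontfun g x) \<in> bcontfun"
  proof (rule bcontfun_normI)
    show "continuous_on UNIV (\<lambda>x. apply_bcontfun f x * apply_bcontfun g x)" by (intro continuous_intros) auto
    show "norm (apply_bcontfun f x * apply_bcontfun g x) \<le> norm f * norm g" for x
      by (intro order.trans[OF norm_mult_ineq] mult_mono norm_bounded) auto
  qed
  then show ?thesis by (simp add: times_bcontfun_def Bcontfun_inverse)
qed

instance bcontfun :: (topological_space, "{real_normed_algebra_1,comm_ring_1}") "{real_normed_algebra_1,comm_ring_1}"
proof
  fix f g h :: "'a \<Rightarrow>\<^sub>C 'b" and r :: real
  show "f * g * h = f * (g * h)" "f * g = g * f" "1 * f = f" "f * 1 = f"
    "(f + g) * h = f * h + g * h" "f * (g + h) = f * g + f * h"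
    "r *\<^sub>R f * g = r *\<^sub>R (f * g)" "f * r *\<^sub>R g = r *\<^sub>R (f * g)"
    by (auto intro!: bcontfun_eqI simp: algebra_simps)
  show "(0 :: 'a \<Rightarrow>\<^sub>C 'b) \<noteq> 1"
  proof
    assume "(0 :: 'a \<Rightarrow>\<^sub>C 'b) = 1"
    then have "apply_bcontfun (0 :: 'a \<Rightarrow>\<^sub>C 'b) undefined = apply_bcontfun 1 undefined" by simp
    then show False by simp
  qed
  show "norm (f * g) \<le> norm f * norm g"
    by (rule norm_bound) (auto intro!: order.trans[OF norm_mult_ineq] mult_mono norm_bounded)
  have "norm (1 :: 'a \<Rightarrow>\<^sub>C 'b) \<le> 1" by (rule norm_bound) simp
  moreover have "1 \<le> norm (1 :: 'a \<Rightarrow>\<^sub>C 'b)" using norm_bounded[of "1 :: 'a \<Rightarrow>\<^sub>C 'b" undefined] by simp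
  ultimately show "norm (1 :: 'a \<Rightarrow>\<^sub>C 'b) = 1" by simp
qed

instance bcontfun :: (metric_space, banach) banach ..

instance bcontfun :: (metric_space, comm_banach_algebra) comm_banach_algebra ..

lemma character_eval: "character (\<lambda>a :: 'p::metric_space \<Rightarrow>\<^sub>C complex. apply_bcontfun a l)"
  unfolding character_def
  by (auto intro!: bounded_linear_intro[where K = 1] norm_bounded)

text \<open>A function on a closed convex set extends to a bounded continuous function on the whole space by composition with the nearest-point projection. In
this way the algebra of bounded continuous functions on all of space serves for every neighbourhood of the base parameter.\<close>

definition clamp :: "'p::euclidean_space set \<Rightarrow> ('p \<Rightarrow> complex) \<Rightarrow> ('p \<Rightarrow>\<^sub>C complex)" where
  "clamp K \<phi> = Bcontfun (\<lambda>l. \<phi> (closest_point K l))"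

lemma clamp:
  fixes K :: "'p::euclidean_space set"
  assumes K: "closed K" "convex K" "K \<noteq> {}" and \<phi>: "continuous_on K \<phi>" "\<And>l. l \<in> K \<Longrightarrow> norm (\<phi> l) \<le> b"
  shows "apply_bcontfun (clamp K \<phi>) l = \<phi> (closest_point K l)" "norm (clamp K \<phi>) \<le> b"
    "l \<in> K \<Longrightarrow> apply_bcontfun (clamp K \<phi>) l = \<phi> l"
proof -
  have c: "closest_point K l \<in> K" for l by (rule closest_point_in_set[OF K(1,3)])
  have "(\<lambda>l. \<phi> (closest_point K l)) \<in> bcontfun"
  proof (rule bcontfun_normI)
    show "continuous_on UNIV (\<lambda>l. \<phi> (closest_point K l))"
      by (rule continuous_on_compose2[OF \<phi>(1) continuous_on_closest_point[OF K(2,1,3)]]) (use c in auto)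
  qed (use \<phi>(2) c in auto)
  then show *: "apply_bcontfun (clamp K \<phi>) l = \<phi> (closest_point K l)" for l
    by (simp add: clamp_def Bcontfun_inverse)
  show "norm (clamp K \<phi>) \<le> b" by (rule norm_bound) (use * \<phi>(2) c in auto)
  show "l \<in> K \<Longrightarrow> apply_bcontfun (clamp K \<phi>) l = \<phi> l" by (simp add: * closest_point_self)
qed

lemma near_bounds:
  fixes z w :: complex
  assumes "1 < \<kappa>" "0 < norm z" "dist w z < norm z * (\<kappa> - 1) / \<kappa>"
  shows "norm w \<le> \<kappa> * norm z" "norm (inverse w) \<le> \<kappa> / norm z" "w \<noteq> 0"
proof -
  have d: "norm (w - z) < norm z * (\<kappa> - 1) / \<kappa>" using assms by (simp add: dist_norm)
  have e: "norm z * (\<kappa> - 1) / \<kappa> = norm z - norm z / \<kappa>" using assms by (simp add: field_simps)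
  have "norm z * (\<kappa> - 1) / \<kappa> \<le> norm z * (\<kappa> - 1)"
    using divide_left_mono[of 1 \<kappa> "norm z * (\<kappa> - 1)"] assms by simp
  then have "norm z * (\<kappa> - 1) / \<kappa> \<le> \<kappa> * norm z - norm z" by (simp add: algebra_simps)
  then show "norm w \<le> \<kappa> * norm z" using d norm_triangle_ineq2[of w z] by linarith
  have l: "norm z / \<kappa> \<le> norm w" using d e norm_triangle_ineq2[of z w] by (simp add: norm_minus_commute)
  have p: "0 < norm z / \<kappa>" using assms by simp
  then show "w \<noteq> 0" using l by auto
  have "inverse (norm w) \<le> inverse (norm z / \<kappa>)" by (rule le_imp_inverse_le[OF l p])
  then show "norm (inverse w) \<le> \<kappa> / norm z" by (simp add: norm_inverse)
qed

lemma parameter_space_closed_convex: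
  assumes "parameter_space (P :: (complex ^ 'm) set)"
  shows "closed P" "convex P"
proof -
  have "closed {l :: complex ^ 'm. \<forall>i. l $ i \<in> \<real>}"
  proof -
    have "{l :: complex ^ 'm. \<forall>i. l $ i \<in> \<real>} = (\<Inter>i. (\<lambda>l. l $ i) -` \<real>)" by auto
    also have "closed \<dots>"
      by (intro closed_INT ballI closed_vimage closed_complex_Reals continuous_on_component continuous_on_id)
    finally show ?thesis .
  qed
  moreover have "convex {l :: complex ^ 'm. \<forall>i. l $ i \<in> \<real>}"
    unfolding convex_def by (auto simp: scaleR_conv_of_real[where 'a = complex] intro!: Reals_add Reals_mult)
  ultimately show "closed P" "convex P" using assms by (auto simp: parameter_space_def)
qed

lemma germs_fullI:
  assumes "germ c" "germ d" "\<And>k. fst k + snd k < 2 \<Longrightarrow> c k = 0" "\<And>k. fst k + snd k < 2 \<Longrightarrow> d k = 0"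
  shows "germs full c d"
proof -
  have "fst k + snd k < 2" if "k \<notin> exps1 full \<or> k \<notin> exps2 full" for k
    using that by (auto simp: shifted_def full_def toZ_def zero_prod_def)
  then show ?thesis unfolding germs_def using assms by blast
qed

text \<open>One component of the family, as a series over the algebra of bounded continuous functions. On a small neighbourhood the supremum norms of the
eigenvalue and of its inverse are close to the moduli of their values at the base parameter.\<close>

lemma continuous_component:
  fixes K :: "'p::euclidean_space set" and \<mu> :: "'p \<Rightarrow> complex" and c :: "nat \<times> nat \<Rightarrow> 'p \<Rightarrow> complex"
  defines "I \<equiv> {i :: nat \<times> nat. 2 \<le> fst i + snd i}"
  assumes K: "closed K" "convex K" "K \<noteq> {}" and \<kappa>: "1 < \<kappa>'" "\<kappa>' < \<kappa>" and z: "z \<noteq> (0 :: complex)"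
    and \<mu>: "continuous_on K \<mu>" "\<And>l. l \<in> K \<Longrightarrow> dist (\<mu> l) z < norm z * (\<kappa>' - 1) / \<kappa>'"
    and c: "\<And>i. i \<in> I \<Longrightarrow> continuous_on K (c i)" "\<And>i l. i \<in> I \<Longrightarrow> l \<in> K \<Longrightarrow> norm (c i l) \<le> S i"
    and S: "0 < \<rho>" "(\<lambda>i. S i * weight \<rho> \<rho> i) summable_on I"
  obtains m n and C :: "nat \<times> nat \<Rightarrow> 'p \<Rightarrow>\<^sub>C complex" where "m * n = 1"
    "norm m < \<kappa> * norm z" "norm n < \<kappa> / norm z" "germ C" "\<And>k. fst k + snd k < 2 \<Longrightarrow> C k = 0"
    "\<And>l. l \<in> K \<Longrightarrow> apply_bcontfun m l = \<mu> l"
    "\<And>l x s. l \<in> K \<Longrightarrow> ((\<lambda>i. c i l * mpow x i) has_sum s) I \<Longrightarrow> ev (\<lambda>a. apply_bcontfun a l) C x = s"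
proof -
  have z0: "0 < norm z" using z by simp
  have b: "norm (\<mu> l) \<le> \<kappa>' * norm z" "norm (inverse (\<mu> l)) \<le> \<kappa>' / norm z" "\<mu> l \<noteq> 0" if "l \<in> K" for l
    using near_bounds[OF \<kappa>(1) z0 \<mu>(2)[OF that]] by auto
  have conti: "continuous_on K (\<lambda>l. inverse (\<mu> l))" using b by (auto intro!: continuous_intros \<mu>)
  define m where "m = clamp K \<mu>"
  define n where "n = clamp K (\<lambda>l. inverse (\<mu> l))"
  define C where "C i = (if i \<in> I then clamp K (c i) else 0)" for i
  have cm: "apply_bcontfun m l = \<mu> (closest_point K l)" "norm m \<le> \<kappa>' * norm z"
    "l \<in> K \<Longrightarrow> apply_bcontfun m l = \<mu> l" for l
    unfolding m_def by (rule clamp[OF K \<mu>(1) b(1)]; assumption)+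
  have cn: "apply_bcontfun n l = inverse (\<mu> (closest_point K l))" "norm n \<le> \<kappa>' / norm z" for l
    unfolding n_def by (rule clamp[OF K conti b(2)]; assumption)+
  have cC: "norm (C i) \<le> S i" "l \<in> K \<Longrightarrow> apply_bcontfun (C i) l = c i l" if i: "i \<in> I" for i l
    using clamp(2)[OF K c(1)[OF i] c(2)[OF i]] clamp(3)[OF K c(1)[OF i] c(2)[OF i]] i by (simp_all add: C_def)
  have C0: "C i = 0" if "i \<notin> I" for i using that by (simp add: C_def)
  show ?thesis
  proof (rule that)
    show "m * n = 1"
      using b(3)[OF closest_point_in_set[OF K(1,3)]] by (auto intro!: bcontfun_eqI simp: cm(1) cn(1))
    have "\<kappa>' * norm z < \<kappa> * norm z" "\<kappa>' / norm z < \<kappa> / norm z"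
      using \<kappa> z0 by (auto intro: divide_strict_right_mono)
    then show "norm m < \<kappa> * norm z" "norm n < \<kappa> / norm z" using cm(2) cn(2) by linarith+
    have "(\<lambda>i. norm (C i) * weight \<rho> \<rho> i) summable_on I"
      by (rule summable_on_comparison_test[OF S(2)]) (use S(1) cC in \<open>auto intro!: mult_right_mono\<close>)
    also have "?this \<longleftrightarrow> (\<lambda>i. norm (C i) * weight \<rho> \<rho> i) summable_on UNIV"
      by (rule summable_on_cong_neutral) (use C0 in auto)
    finally show "germ C" using S(1) by (auto simp: germ_def wconv_def)
    show "C k = 0" if "fst k + snd k < 2" for k using that by (intro C0) (simp add: I_def)
    show "ev (\<lambda>a. apply_bcontfun a l) C x = s" if l: "l \<in> K" and s: "((\<lambda>i. c i l * mpow x i) has_sum s) I" for l x s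
    proof -
      have "((\<lambda>i. apply_bcontfun (C i) l * mpow x i) has_sum s) UNIV"
        using s by (rule has_sum_cong_neutral[THEN iffD1, rotated -1]) (use cC(2)[OF _ l] C0 in auto)
      then show ?thesis by (simp add: ev_def infsumI)
    qed
  qed (rule cm(3))
qed

lemma has_sum_components:
  assumes "((\<lambda>i. cscale (mpow x i) (a i)) has_sum (y - (m1 * fst x, m2 * snd x))) I"
  shows "((\<lambda>i. fst (a i) * mpow x i) has_sum (fst y - m1 * mpow x (1, 0))) I"
    "((\<lambda>i. snd (a i) * mpow x i) has_sum (snd y - m2 * mpow x (0, 1))) I"
proof -
  have "fst (a i) * mpow x i = fst (cscale (mpow x i) (a i))" "snd (a i) * mpow x i = snd (cscale (mpow x i) (a i))" for i
    by (simp_all add: cscale_def)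
  moreover have "fst y - m1 * mpow x (1, 0) = fst (y - (m1 * fst x, m2 * snd x))"
    "snd y - m2 * mpow x (0, 1) = snd (y - (m1 * fst x, m2 * snd x))" by (simp_all add: mpow_def)
  ultimately show "((\<lambda>i. fst (a i) * mpow x i) has_sum (fst y - m1 * mpow x (1, 0))) I"
    "((\<lambda>i. snd (a i) * mpow x i) has_sum (snd y - m2 * mpow x (0, 1))) I"
    using has_sum_bounded_linear[OF bounded_linear_fst assms] has_sum_bounded_linear[OF bounded_linear_snd assms]
    by (simp_all only:)
qed

lemma parameter_neighbourhood:
  assumes "\<exists>U. openin (top_of_set P) U \<and> l0 \<in> U \<and> U \<subseteq> \<Lambda>"
  obtains T where "open T" "l0 \<in> T" "l0 \<in> P" "P \<inter> T \<subseteq> \<Lambda>"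
  using assms by (auto simp: openin_open)

theorem continuous_normal_form:
  fixes P \<Lambda> :: "(complex ^ 'm) set" and l0 :: "complex ^ 'm"
    and f :: "complex ^ 'm \<Rightarrow> complex \<times> complex \<Rightarrow> complex \<times> complex"
    and \<mu>1 \<mu>2 :: "complex ^ 'm \<Rightarrow> complex"
    and a :: "nat \<times> nat \<Rightarrow> complex ^ 'm \<Rightarrow> complex \<times> complex" and p q p' q' :: nat
  assumes P: "parameter_space P" and nb: "\<exists>U. openin (top_of_set P) U \<and> l0 \<in> U \<and> U \<subseteq> \<Lambda>"
    and \<mu>: "continuous_on \<Lambda> \<mu>1" "continuous_on \<Lambda> \<mu>2" "\<mu>1 l0 \<noteq> 0" "\<mu>2 l0 \<noteq> 0"
    and r: "r1 > 0" "r2 > 0"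
    and sc: "sup_convergent \<Lambda> (polydisk r1 r2) {i. fst i + snd i \<ge> 2} a"
    and f: "\<And>l x. l \<in> \<Lambda> \<Longrightarrow> x \<in> polydisk r1 r2 \<Longrightarrow>
           ((\<lambda>i. cscale (mpow x i) (a i l)) has_sum
              (f l x - (\<mu>1 l * fst x, \<mu>2 l * snd x))) {i. fst i + snd i \<ge> 2}"
    and UV: "U = below p q \<and> V = above p' q' \<or> U = above p' q' \<and> V = below p q"
    and \<kappa>\<theta>: "1 < \<kappa>" "0 \<le> \<theta>" "\<theta> < 1" "contracts U \<kappa> \<theta> (norm (\<mu>1 l0)) (norm (\<mu>2 l0))"
      "contracts V \<kappa> \<theta> (1 / norm (\<mu>1 l0)) (1 / norm (\<mu>2 l0))"
    and det: "int q' * int p - int q * int p' = 1"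
  obtains \<Lambda>' h hinv g b where "openin (top_of_set P) \<Lambda>'" "l0 \<in> \<Lambda>'" "\<Lambda>' \<subseteq> \<Lambda>"
    "normal_form_family \<Lambda>' f \<mu>1 \<mu>2 p q p' q' h hinv g b"
proof -
  obtain T where T: "open T" "l0 \<in> T" "l0 \<in> P" "P \<inter> T \<subseteq> \<Lambda>" by (rule parameter_neighbourhood[OF nb])
  have l0: "l0 \<in> \<Lambda>" using T by blast
  define A where "A = norm (\<mu>1 l0)"
  define B where "B = norm (\<mu>2 l0)"
  have AB: "0 < A" "0 < B" using \<mu> by (auto simp: A_def B_def)
  \<comment> \<open>Supremum norms only satisfy weak inequalities, so a smaller factor is used to reach strict ones for \<open>\<kappa>\<close>.\<close>
  define \<kappa>' where "\<kappa>' = (1 + \<kappa>) / 2"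
  have \<kappa>': "1 < \<kappa>'" "\<kappa>' < \<kappa>" using \<kappa>\<theta>(1) by (auto simp: \<kappa>'_def)
  obtain e0 where e0: "0 < e0" "cball l0 e0 \<subseteq> T" using T(1,2) by (auto simp: open_contains_cball)
  have "0 < A * (\<kappa>' - 1) / \<kappa>'" using AB \<kappa>' by simp
  then obtain e1 where e1: "0 < e1" "\<And>l. l \<in> \<Lambda> \<Longrightarrow> dist l l0 < e1 \<Longrightarrow> dist (\<mu>1 l) (\<mu>1 l0) < A * (\<kappa>' - 1) / \<kappa>'"
    using \<mu>(1) l0 unfolding continuous_on_iff by metis
  have "0 < B * (\<kappa>' - 1) / \<kappa>'" using AB \<kappa>' by simp
  then obtain e2 where e2: "0 < e2" "\<And>l. l \<in> \<Lambda> \<Longrightarrow> dist l l0 < e2 \<Longrightarrow> dist (\<mu>2 l) (\<mu>2 l0) < B * (\<kappa>' - 1) / \<kappa>'"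
    using \<mu>(2) l0 unfolding continuous_on_iff by metis
  define \<epsilon> where "\<epsilon> = min e0 (min e1 e2) / 2"
  have \<epsilon>: "0 < \<epsilon>" "\<epsilon> < e0" "\<epsilon> < e1" "\<epsilon> < e2" using e0 e1 e2 by (auto simp: \<epsilon>_def)
  define K where "K = P \<inter> cball l0 \<epsilon>"
  have K: "closed K" "convex K" "K \<noteq> {}"
    using parameter_space_closed_convex[OF P] T(3) \<epsilon>(1) unfolding K_def
    by (auto intro!: closed_Int convex_Int)
  have "cball l0 \<epsilon> \<subseteq> cball l0 e0" using \<epsilon> by auto
  then have K\<Lambda>: "K \<subseteq> \<Lambda>" using T e0 unfolding K_def by blast
  have d: "dist (\<mu>1 l) (\<mu>1 l0) < norm (\<mu>1 l0) * (\<kappa>' - 1) / \<kappa>'" "dist (\<mu>2 l) (\<mu>2 l0) < norm (\<mu>2 l0) * (\<kappa>' - 1) / \<kappa>'"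
    if "l \<in> K" for l
    using e1(2)[of l] e2(2)[of l] that K\<Lambda> \<epsilon> by (auto simp: K_def A_def B_def dist_commute)
  have cont: "continuous_on K \<mu>1" "continuous_on K \<mu>2" using \<mu> K\<Lambda> continuous_on_subset by blast+
  let ?I = "{i :: nat \<times> nat. 2 \<le> fst i + snd i}"
  define S where "S i = (SUP l\<in>\<Lambda>. norm (a i l))" for i
  have ac: "continuous_on \<Lambda> (a i)" "bounded (a i ` \<Lambda>)" if "i \<in> ?I" for i
    using sc that unfolding sup_convergent_def by blast+
  have aS: "norm (a i l) \<le> S i" if "i \<in> ?I" "l \<in> \<Lambda>" for i l
    unfolding S_def
  proof (rule cSUP_upper[OF that(2)])
    show "bdd_above ((\<lambda>l. norm (a i l)) ` \<Lambda>)"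
      using ac(2)[OF that(1)] bounded_norm_comp[of "a i" \<Lambda>] by (intro bounded_imp_bdd_above) simp
  qed
  have comp_le: "norm (fst z) \<le> norm z" "norm (snd z) \<le> norm z" for z :: "complex \<times> complex"
    by (cases z; simp add: norm_fst_le norm_snd_le)+
  have k1: "continuous_on K (\<lambda>l. fst (a i l))" "continuous_on K (\<lambda>l. snd (a i l))" if "i \<in> ?I" for i
    using continuous_on_subset[OF ac(1)[OF that] K\<Lambda>] by (auto intro!: continuous_intros)
  have k2: "norm (fst (a i l)) \<le> S i" "norm (snd (a i l)) \<le> S i" if "i \<in> ?I" "l \<in> K" for i l
    using aS[OF that(1), of l] K\<Lambda> that(2) comp_le[of "a i l"] by force+
  define \<rho> where "\<rho> = min r1 r2 / 2"
  have \<rho>: "0 < \<rho>" "\<rho> < r1" "\<rho> < r2" using r by (auto simp: \<rho>_def min_def)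
  have "(of_real \<rho>, of_real \<rho>) \<in> polydisk r1 r2" using \<rho> by (simp add: polydisk_iff)
  then have "(\<lambda>i. S i * norm (mpow (of_real \<rho>, of_real \<rho>) i)) summable_on ?I"
    using sc unfolding sup_convergent_def S_def by blast
  moreover have "norm (mpow (of_real \<rho>, of_real \<rho>) i) = weight \<rho> \<rho> i" for i
    using \<rho> by (simp add: mpow_def weight_def norm_mult norm_power)
  ultimately have Ss: "(\<lambda>i. S i * weight \<rho> \<rho> i) summable_on ?I" by simp
  obtain m1 n1 and C1 :: "nat \<times> nat \<Rightarrow> (complex ^ 'm) \<Rightarrow>\<^sub>C complex" where c1: "m1 * n1 = 1"
    "norm m1 < \<kappa> * norm (\<mu>1 l0)" "norm n1 < \<kappa> / norm (\<mu>1 l0)" "germ C1" "\<And>k. fst k + snd k < 2 \<Longrightarrow> C1 k = 0"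
    "\<And>l. l \<in> K \<Longrightarrow> apply_bcontfun m1 l = \<mu>1 l"
    "\<And>l x s. l \<in> K \<Longrightarrow> ((\<lambda>i. fst (a i l) * mpow x i) has_sum s) ?I \<Longrightarrow> ev (\<lambda>a. apply_bcontfun a l) C1 x = s"
    by (rule continuous_component[OF K \<kappa>' \<mu>(3) cont(1) d(1) k1(1) k2(1) \<rho>(1) Ss], assumption+, rule that)
  obtain m2 n2 and C2 :: "nat \<times> nat \<Rightarrow> (complex ^ 'm) \<Rightarrow>\<^sub>C complex" where c2: "m2 * n2 = 1"
    "norm m2 < \<kappa> * norm (\<mu>2 l0)" "norm n2 < \<kappa> / norm (\<mu>2 l0)" "germ C2" "\<And>k. fst k + snd k < 2 \<Longrightarrow> C2 k = 0"
    "\<And>l. l \<in> K \<Longrightarrow> apply_bcontfun m2 l = \<mu>2 l"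
    "\<And>l x s. l \<in> K \<Longrightarrow> ((\<lambda>i. snd (a i l) * mpow x i) has_sum s) ?I \<Longrightarrow> ev (\<lambda>a. apply_bcontfun a l) C2 x = s"
    by (rule continuous_component[OF K \<kappa>' \<mu>(4) cont(2) d(2) k1(2) k2(2) \<rho>(1) Ss], assumption+, rule that)
  have F: "germs full C1 C2" by (rule germs_fullI[OF c1(4) c2(4) c1(5) c2(5)])
  define \<Lambda>' where "\<Lambda>' = P \<inter> ball l0 \<epsilon>"
  have \<Lambda>': "openin (top_of_set P) \<Lambda>'" "l0 \<in> \<Lambda>'" "\<Lambda>' \<subseteq> K"
    using T \<epsilon> by (auto simp: \<Lambda>'_def K_def intro!: openin_open_Int)
  have fg: "f l x = gmap m1 m2 C1 C2 (\<lambda>a. apply_bcontfun a l) x" if l: "l \<in> \<Lambda>'" and x: "x \<in> polydisk \<rho> \<rho>" for l x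
  proof -
    have lK: "l \<in> K" using l \<Lambda>' by blast
    have "x \<in> polydisk r1 r2" using x \<rho> by (auto simp: polydisk_iff)
    then have "((\<lambda>i. cscale (mpow x i) (a i l)) has_sum (f l x - (\<mu>1 l * fst x, \<mu>2 l * snd x))) ?I"
      using lK K\<Lambda> by (intro f) auto
    note hs = has_sum_components[OF this]
    show ?thesis
      by (simp add: gmap_def c1(7)[OF lK hs(1)] c2(7)[OF lK hs(2)] c1(6)[OF lK] c2(6)[OF lK] mpow_def)
  qed
  have m: "apply_bcontfun m1 l = \<mu>1 l" "apply_bcontfun m2 l = \<mu>2 l" if "l \<in> \<Lambda>'" for l
    using that \<Lambda>' c1(6) c2(6) by blast+
  have ne: "\<Lambda>' \<noteq> {}" using \<Lambda>' by blast
  obtain h hinv g b where "normal_form_family \<Lambda>' f \<mu>1 \<mu>2 p q p' q' h hinv g b"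
    by (rule family_normal_form[where \<omega> = "\<lambda>l a. apply_bcontfun a l" and \<Lambda> = \<Lambda>' and f = f,
          OF F c1(1) c2(1) AB[unfolded A_def B_def] c1(2) c2(2) c1(3) c2(3) UV \<kappa>\<theta> det character_eval
            continuous_on_apply_bcontfun ne \<rho>(1) fg m],
        assumption, assumption, assumption, assumption, rule that)
  then show ?thesis using that \<Lambda>' K\<Lambda> by blast
qed

section \<open>Analytic dependence on the parameter\<close>

lemma l1_character_has_sum:
  fixes m :: "'i \<Rightarrow> complex" and a :: "('i, complex) l1"
  assumes "\<And>i. norm (m i) \<le> 1"
  shows "((\<lambda>i. cf a i * m i) has_sum (\<Sum>\<^sub>\<infinity>i. cf a i * m i)) UNIV" "norm (\<Sum>\<^sub>\<infinity>i. cf a i * m i) \<le> norm a"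
proof -
  have le: "norm (cf a i * m i) \<le> norm (cf a i)" for i
    using mult_left_mono[OF assms, of "norm (cf a i)" i] by (simp add: norm_mult)
  have "(\<lambda>i. norm (cf a i * m i)) summable_on UNIV"
    by (rule summable_on_comparison_test[OF cf_abs_summable le]) auto
  then show *: "((\<lambda>i. cf a i * m i) has_sum (\<Sum>\<^sub>\<infinity>i. cf a i * m i)) UNIV"
    by (intro has_sum_infsum) (rule abs_summable_summable)
  show "norm (\<Sum>\<^sub>\<infinity>i. cf a i * m i) \<le> norm a"
    unfolding norm_l1_def by (rule norm_infsum_le[OF * has_sum_infsum[OF cf_abs_summable] le])
qed

text \<open>A multiplicative function bounded by \<open>1\<close> on the monoid extends to a character of the algebra.\<close>

lemma l1_character:
  fixes m :: "'i::comm_monoid_add \<Rightarrow> complex"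
  assumes m: "\<And>i. norm (m i) \<le> 1" and m0: "m 0 = 1" and madd: "\<And>i j. m (i + j) = m i * m j"
  shows "character (\<lambda>a. \<Sum>\<^sub>\<infinity>i. cf a i * m i)"
proof -
  let ?c = "\<lambda>a. \<Sum>\<^sub>\<infinity>i. cf a i * m i"
  note hs = l1_character_has_sum(1)[where m = m, OF m]
  have bl: "bounded_linear ?c"
  proof (rule bounded_linear_intro[where K = 1])
    show "?c (a + b) = ?c a + ?c b" for a b
      by (rule has_sum_unique[OF hs]) (use has_sum_add[OF hs[of a] hs[of b]] in \<open>simp add: distrib_right\<close>)
    show "?c (r *\<^sub>R a) = r *\<^sub>R ?c a" for r a
      by (rule has_sum_unique[OF hs]) (use has_sum_scaleR[OF hs[of a], of r] in simp)
    show "norm (?c a) \<le> norm a * 1" for a using l1_character_has_sum(2)[where m = m, OF m] by simp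
  qed
  have single: "?c (single i a) = a * m i" for i a
    by (rule has_sum_unique[OF hs], rule has_sum_finite_neutralI[of "{i}"]) (auto simp: cf_single)
  have "?c (a * b) = ?c a * ?c b" for a b
  proof (rule bounded_linear_l1_eqI[where f = "\<lambda>a. ?c (a * b)" and g = "\<lambda>a. ?c a * ?c b"])
    fix i x
    show "?c (single i x * b) = ?c (single i x) * ?c b"
      by (rule bounded_linear_l1_eqI[where f = "\<lambda>b. ?c (single i x * b)" and g = "\<lambda>b. ?c (single i x) * ?c b"])
        (auto intro!: bl bounded_linear_compose[OF bl bounded_linear_mult_right]
          bounded_linear_compose[OF bounded_linear_mult_right bl]
        simp: single_times_single single madd)
  qed (auto intro!: bl bounded_linear_compose[OF bl bounded_linear_mult_left]
          bounded_linear_compose[OF bounded_linear_mult_left bl])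
  moreover have "?c 1 = 1" unfolding one_l1_def single m0 by simp
  ultimately show ?thesis
    unfolding character_def using bl l1_character_has_sum(2)[where m = m, OF m] by blast
qed

text \<open>Finite sums of monomials approximate an element in norm, hence uniformly in the parameter.\<close>

lemma l1_character_continuous:
  fixes m :: "'p::topological_space \<Rightarrow> 'i \<Rightarrow> complex" and a :: "('i, complex) l1"
  assumes m: "\<And>l i. l \<in> \<Lambda> \<Longrightarrow> norm (m l i) \<le> 1" and cont: "\<And>i. continuous_on \<Lambda> (\<lambda>l. m l i)"
  shows "continuous_on \<Lambda> (\<lambda>l. \<Sum>\<^sub>\<infinity>i. cf a i * m l i)"
proof (rule uniform_limit_theorem)
  show "uniform_limit \<Lambda> (\<lambda>S l. \<Sum>i\<in>S. cf a i * m l i) (\<lambda>l. \<Sum>\<^sub>\<infinity>i. cf a i * m l i) (finite_subsets_at_top UNIV)"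
  proof (rule uniform_limitI)
    fix e :: real assume "0 < e"
    have "((\<lambda>S. \<Sum>i\<in>S. single i (cf a i)) \<longlongrightarrow> a) (finite_subsets_at_top UNIV)"
      using l1_has_sum_single[of a] by (simp add: has_sum_def)
    from tendstoD[OF this \<open>0 < e\<close>]
    have ev: "\<forall>\<^sub>F S in finite_subsets_at_top UNIV. dist (\<Sum>i\<in>S. single i (cf a i)) a < e" .
    have "\<forall>\<^sub>F S in finite_subsets_at_top (UNIV :: 'i set). finite S"
      by (intro eventually_finite_subsets_at_top_weakI)
    with ev have "\<forall>\<^sub>F S in finite_subsets_at_top UNIV. finite S \<and> dist (\<Sum>i\<in>S. single i (cf a i)) a < e"
      by eventually_elim simp
    then show "\<forall>\<^sub>F S in finite_subsets_at_top UNIV. \<forall>l\<in>\<Lambda>. dist (\<Sum>i\<in>S. cf a i * m l i) (\<Sum>\<^sub>\<infinity>i. cf a i * m l i) < e"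
    proof (rule eventually_mono, intro ballI)
      fix S l assume S: "finite S \<and> dist (\<Sum>i\<in>S. single i (cf a i)) a < e" and l: "l \<in> \<Lambda>"
      let ?b = "\<Sum>i\<in>S. single i (cf a i)"
      have cb: "cf ?b i = (if i \<in> S then cf a i else 0)" for i
      proof -
        have "cf ?b i = (\<Sum>j\<in>S. cf (single j (cf a j)) i)"
          using bounded_linear.linear[OF bounded_linear_cf, of i] by (rule linear_sum)
        then show ?thesis using S by (simp add: cf_single)
      qed
      have "((\<lambda>i. cf (a - ?b) i * m l i) has_sum ((\<Sum>\<^sub>\<infinity>i. cf a i * m l i) - (\<Sum>i\<in>S. cf a i * m l i))) UNIV"
      proof -
        have 1: "((\<lambda>i. cf ?b i * m l i) has_sum (\<Sum>i\<in>S. cf a i * m l i)) UNIV"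
          by (rule has_sum_finite_neutralI[of S]) (use S in \<open>auto simp: cb\<close>)
        show ?thesis
          using has_sum_add[OF l1_character_has_sum(1)[where m = "m l" and a = a, OF m[OF l]] has_sum_uminusI[OF 1]]
          by (simp add: left_diff_distrib)
      qed
      then have "norm ((\<Sum>\<^sub>\<infinity>i. cf a i * m l i) - (\<Sum>i\<in>S. cf a i * m l i)) \<le> norm (a - ?b)"
        using l1_character_has_sum(2)[where m = "m l" and a = "a - ?b", OF m[OF l]] by (simp add: infsumI)
      then show "dist (\<Sum>i\<in>S. cf a i * m l i) (\<Sum>\<^sub>\<infinity>i. cf a i * m l i) < e"
        using S by (simp add: dist_norm norm_minus_commute)
    qed
  qed
  show "\<forall>\<^sub>F S in finite_subsets_at_top UNIV. continuous_on \<Lambda> (\<lambda>l. \<Sum>i\<in>S. cf a i * m l i)"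
    by (intro always_eventually allI continuous_intros cont)
qed simp

text \<open>The Neumann series, with control of the norm of the inverse.\<close>

lemma near_scalar_inverse:
  fixes m :: "('i::comm_monoid_add, complex) l1" and \<alpha> :: complex
  assumes \<alpha>: "\<alpha> \<noteq> 0" and \<tau>: "0 \<le> \<tau>" "\<tau> < 1" and m: "norm (m - single 0 \<alpha>) \<le> \<tau> * norm \<alpha>"
  obtains n where "m * n = 1" "norm n \<le> 1 / (norm \<alpha> * (1 - \<tau>))"
proof -
  let ?i = "single 0 (inverse \<alpha>) :: ('i, complex) l1"
  define y where "y = - (?i * (m - single 0 \<alpha>))"
  have i: "?i * single 0 \<alpha> = 1" using \<alpha> by (simp add: single_times_single one_l1_def)
  have im: "?i * m = 1 - y" by (simp add: y_def right_diff_distrib i)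
  have "norm y \<le> norm (inverse \<alpha>) * (\<tau> * norm \<alpha>)"
    unfolding y_def norm_minus_cancel by (rule order.trans[OF norm_mult_ineq]) (auto intro: mult_mono m)
  also have "norm (inverse \<alpha>) * (\<tau> * norm \<alpha>) = \<tau>" using \<alpha> by (simp add: norm_inverse)
  finally have y: "norm y \<le> \<tau>" .
  then have y1: "norm y < 1" using \<tau> by simp
  define S where "S = (\<Sum>n. y ^ n)"
  have sm: "summable (\<lambda>n. y ^ n)" by (rule complete_algebra_summable_geometric[OF y1])
  have sn: "summable (\<lambda>n. norm (y ^ n))"
    by (rule summable_comparison_test'[where g = "\<lambda>n. \<tau> ^ n" and N = 0])
      (use \<tau> y in \<open>auto intro!: summable_geometric order.trans[OF norm_power_ineq] power_mono\<close>)
  have "y * S = S - 1"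
  proof -
    have "y * S = (\<Sum>n. y * y ^ n)" unfolding S_def by (rule suminf_mult[OF sm, symmetric])
    also have "\<dots> = S - y ^ 0" unfolding S_def using suminf_split_head[OF sm] by simp
    finally show ?thesis by simp
  qed
  then have yS: "(1 - y) * S = 1" by (simp add: left_diff_distrib)
  have "norm S \<le> (\<Sum>n. norm (y ^ n))" unfolding S_def by (rule summable_norm[OF sn])
  also have "\<dots> \<le> (\<Sum>n. \<tau> ^ n)"
    by (rule suminf_le[OF _ sn]) (use \<tau> y in \<open>auto intro!: summable_geometric order.trans[OF norm_power_ineq] power_mono\<close>)
  also have "\<dots> = 1 / (1 - \<tau>)" using \<tau> by (intro suminf_geometric) auto
  finally have nS: "norm S \<le> 1 / (1 - \<tau>)" .
  show ?thesis
  proof (rule that[of "?i * S"])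
    have "m * (?i * S) = (?i * m) * S" by (simp add: mult_ac)
    then show "m * (?i * S) = 1" by (simp add: im yS)
    have "norm (?i * S) \<le> norm (inverse \<alpha>) * (1 / (1 - \<tau>))"
      by (rule order.trans[OF norm_mult_ineq]) (use mult_left_mono[OF nS, of "norm (inverse \<alpha>)"] in simp)
    then show "norm (?i * S) \<le> 1 / (norm \<alpha> * (1 - \<tau>))" by (simp add: norm_inverse divide_inverse)
  qed
qed

text \<open>Monomials in the parameter, normalised so that they are bounded by \<open>1\<close> on the box of size \<open>\<rho>\<close>. The algebra is thus the same for
all \<open>\<rho>\<close>, while its characters depend on \<open>\<rho>\<close>.\<close>

definition pmon :: "real \<Rightarrow> complex ^ 'm \<Rightarrow> complex ^ 'm \<Rightarrow> ('m \<Rightarrow> nat) \<Rightarrow> complex" where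
  "pmon \<rho> l0 l j = (\<Prod>i\<in>UNIV. ((l $ i - l0 $ i) / of_real \<rho>) ^ j i)"

definition pchar :: "real \<Rightarrow> complex ^ 'm \<Rightarrow> complex ^ 'm \<Rightarrow> (('m \<Rightarrow> nat), complex) l1 \<Rightarrow> complex" where
  "pchar \<rho> l0 l a = (\<Sum>\<^sub>\<infinity>j. cf a j * pmon \<rho> l0 l j)"

definition pbox :: "real \<Rightarrow> complex ^ 'm \<Rightarrow> (complex ^ 'm) set" where
  "pbox \<rho> l0 = {l. \<forall>i. norm (l $ i - l0 $ i) < \<rho>}"

definition pabs :: "('m::finite \<Rightarrow> nat) \<Rightarrow> nat" where "pabs j = (\<Sum>i\<in>UNIV. j i)"

lemma open_pbox: "open (pbox \<rho> l0)"
proof -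
  have "pbox \<rho> l0 = (\<Inter>i\<in>UNIV. {l. norm (l $ i - l0 $ i) < \<rho>})" by (auto simp: pbox_def)
  also have "open \<dots>"
    by (intro open_INT ballI open_Collect_less continuous_intros) auto
  finally show ?thesis .
qed

lemma pmon_scaled: "0 < \<rho> \<Longrightarrow> of_real (\<rho> ^ pabs j) * pmon \<rho> l0 l j = (\<Prod>i\<in>UNIV. (l $ i - l0 $ i) ^ j i)"
  by (simp add: pmon_def pabs_def power_sum power_divide prod_dividef)

lemma norm_pmon_le:
  assumes "0 < \<rho>" "l \<in> pbox \<rho> l0"
  shows "norm (pmon \<rho> l0 l j) \<le> 1"
  unfolding pmon_def prod_norm[symmetric]
proof (rule prod_le_1)
  fix i
  have "norm ((l $ i - l0 $ i) / of_real \<rho>) \<le> 1" using assms by (simp add: pbox_def norm_divide less_imp_le)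
  then show "0 \<le> norm (((l $ i - l0 $ i) / of_real \<rho>) ^ j i) \<and> norm (((l $ i - l0 $ i) / of_real \<rho>) ^ j i) \<le> 1"
    unfolding norm_power by (auto intro: power_le_one)
qed

lemma pchar_character:
  assumes "0 < \<rho>" "l \<in> pbox \<rho> l0"
  shows "character (pchar \<rho> l0 l)"
proof -
  have "character (\<lambda>a. \<Sum>\<^sub>\<infinity>j. cf a j * pmon \<rho> l0 l j)"
    by (rule l1_character[OF norm_pmon_le[OF assms]]) (simp_all add: pmon_def power_add prod.distrib)
  then show ?thesis by (simp add: pchar_def[abs_def])
qed

lemma pchar_continuous:
  assumes "0 < \<rho>" "\<Lambda> \<subseteq> pbox \<rho> l0"
  shows "continuous_on \<Lambda> (\<lambda>l. pchar \<rho> l0 l a)"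
  unfolding pchar_def
proof (rule l1_character_continuous)
  show "norm (pmon \<rho> l0 l j) \<le> 1" if "l \<in> \<Lambda>" for l j using norm_pmon_le[OF assms(1)] assms(2) that by blast
  show "continuous_on \<Lambda> (\<lambda>l. pmon \<rho> l0 l j)" for j
    unfolding pmon_def using assms(1) by (intro continuous_intros) auto
qed

lemma pchar_has_sum:
  assumes "0 < \<rho>" "l \<in> pbox \<rho> l0"
  shows "((\<lambda>j. cf a j * pmon \<rho> l0 l j) has_sum pchar \<rho> l0 l a) UNIV"
  unfolding pchar_def by (rule l1_character_has_sum(1)[OF norm_pmon_le[OF assms]])

text \<open>On the box of size \<open>\<rho>\<close> the norms of the coefficients dominate their parameter series, so the iterated sum is an absolutely convergent double
sum and may be rearranged.\<close>

lemma expands_jointly_analytic: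
  fixes F :: "((('m::finite \<Rightarrow> nat, complex) l1) \<Rightarrow> complex) \<Rightarrow> complex \<times> complex \<Rightarrow> complex"
  assumes F: "expands F" and \<rho>: "0 < \<rho>"
  shows "jointly_analytic P l0 (\<lambda>l. F (pchar \<rho> l0 l))"
proof -
  obtain r c where r: "r > 0" "wconv c r r"
    "\<And>\<omega> x. character \<omega> \<Longrightarrow> x \<in> polydisk r r \<Longrightarrow> ((\<lambda>k. \<omega> (c k) * mpow x k) has_sum F \<omega> x) UNIV"
    using F unfolding expands_def by blast
  define s where "s = min r \<rho>"
  define C where "C = (\<lambda>(j, k). cf (c k) j / of_real (\<rho> ^ pabs j))"
  have "((\<lambda>(j, k). C (j, k) * (\<Prod>i\<in>UNIV. (l $ i - l0 $ i) ^ j i) * mpow x k) has_sum F (pchar \<rho> l0 l) x) UNIV"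
    if l: "\<forall>i. norm (l $ i - l0 $ i) < s" and x: "x \<in> polydisk s s" for l x
  proof -
    have lb: "l \<in> pbox \<rho> l0" using l by (auto simp: pbox_def s_def)
    have xr: "x \<in> polydisk r r" using x by (auto simp: polydisk_iff s_def)
    define g where "g = (\<lambda>(k, j). cf (c k) j * pmon \<rho> l0 l j * mpow x k)"
    have inner: "((\<lambda>j. g (k, j)) has_sum pchar \<rho> l0 l (c k) * mpow x k) UNIV" for k
      unfolding g_def prod.case by (rule has_sum_cmult_left[OF pchar_has_sum[OF \<rho> lb]])
    have "(\<lambda>y. norm (g y)) summable_on UNIV \<times> UNIV"
    proof (rule summable_on_comparison_test)
      have "(\<lambda>y. norm ((\<lambda>(k, j). norm (cf (c k) j) * weight r r k) y)) summable_on UNIV \<times> UNIV"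
        unfolding Infinite_Sum.abs_summable_on_Sigma_iff prod.case
      proof (intro conjI ballI)
        have e: "norm (norm (cf (c k) j) * weight r r k) = norm (cf (c k) j) * weight r r k" for k j
          using r(1) by (simp add: abs_mult)
        show "(\<lambda>j. norm (norm (cf (c k) j) * weight r r k)) summable_on UNIV" for k
          unfolding e by (intro summable_on_cmult_left cf_abs_summable)
        have e2: "norm (\<Sum>\<^sub>\<infinity>j. norm (cf (c k) j) * weight r r k) = norm (c k) * weight r r k" for k
          using r(1) by (simp add: infsum_cmult_left' norm_l1_def[symmetric] abs_mult)
        show "(\<lambda>k. norm (\<Sum>\<^sub>\<infinity>j. norm (norm (cf (c k) j) * weight r r k))) summable_on UNIV"
          unfolding e e2 using r(2) by (simp add: wconv_def)
      qed
      then show "(\<lambda>(k, j). norm (cf (c k) j) * weight r r k) summable_on UNIV \<times> UNIV"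
        by (rule abs_summable_summable)
      show "norm (g y) \<le> (\<lambda>(k, j). norm (cf (c k) j) * weight r r k) y" for y
      proof (cases y)
        case (Pair k j)
        have "norm (mpow x k) \<le> weight r r k" using xr by (intro norm_mpow_le) (auto simp: polydisk_iff)
        moreover have "norm (cf (c k) j) * norm (pmon \<rho> l0 l j) \<le> norm (cf (c k) j) * 1"
          by (intro mult_left_mono norm_pmon_le[OF \<rho> lb]) simp
        ultimately show ?thesis by (auto simp: Pair g_def norm_mult intro!: mult_mono)
      qed
    qed simp
    then have "g summable_on UNIV \<times> UNIV" by (rule abs_summable_summable)
    from has_sum_SigmaI[OF inner r(3)[OF pchar_character[OF \<rho> lb] xr] this]
    have "(g has_sum F (pchar \<rho> l0 l) x) UNIV" by simp
    then have "((\<lambda>y. g (prod.swap y)) has_sum F (pchar \<rho> l0 l) x) UNIV"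
      by (subst has_sum_reindex_bij_betw[where g = prod.swap and A = UNIV and B = UNIV]) (auto simp: bij_swap)
    moreover have "g (prod.swap y) = (\<lambda>(j, k). C (j, k) * (\<Prod>i\<in>UNIV. (l $ i - l0 $ i) ^ j i) * mpow x k) y" for y
      using \<rho> by (cases y) (simp add: g_def C_def pmon_scaled[OF \<rho>, symmetric] del: of_real_power)
    ultimately show ?thesis by simp
  qed
  moreover have "s > 0" using r \<rho> by (simp add: s_def)
  ultimately show ?thesis unfolding jointly_analytic_def by blast
qed

text \<open>The factor \<open>\<rho> ^ pabs j\<close> compensates the normalisation in \<open>pmon\<close>.\<close>

definition pcoef :: "real \<Rightarrow> (('m::finite \<Rightarrow> nat) \<times> (nat \<times> nat) \<Rightarrow> complex) \<Rightarrow> nat \<times> nat \<Rightarrow> ('m \<Rightarrow> nat, complex) l1" where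
  "pcoef \<rho> c k = Abs_l1 (\<lambda>j. of_real (\<rho> ^ pabs j) * c (j, k))"

context
  fixes P :: "(complex ^ 'm) set" and l0 :: "complex ^ 'm" and r \<rho> :: real
    and c :: "('m \<Rightarrow> nat) \<times> (nat \<times> nat) \<Rightarrow> complex" and F :: "complex ^ 'm \<Rightarrow> complex \<times> complex \<Rightarrow> complex"
  assumes P: "parameter_space P" "l0 \<in> P"
    and F: "\<And>l x. l \<in> P \<Longrightarrow> \<forall>i. norm (l $ i - l0 $ i) < r \<Longrightarrow> x \<in> polydisk r r \<Longrightarrow>
       ((\<lambda>(j, k). c (j, k) * (\<Prod>i\<in>UNIV. (l $ i - l0 $ i) ^ j i) * mpow x k) has_sum F l x) UNIV"
    and \<rho>: "0 < \<rho>" "\<rho> < r"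
begin

text \<open>Convergence at the single point with all coordinates of the parameter displaced by \<open>\<rho>\<close> and \<open>x = (\<rho>, \<rho>)\<close> gives absolute convergence; this
point is admissible for real parameters, too.\<close>

lemma pcoef_summable:
  "(\<lambda>y. norm ((\<lambda>(k, j). norm (c (j, k)) * \<rho> ^ pabs j * weight \<rho> \<rho> k) y)) summable_on UNIV \<times> UNIV"
proof -
  define l where "l = (\<chi> i. l0 $ i + of_real \<rho>)"
  have "l \<in> P" using P by (auto simp: parameter_space_def l_def)
  moreover have "\<forall>i. norm (l $ i - l0 $ i) < r" using \<rho> by (simp add: l_def)
  moreover have "(of_real \<rho>, of_real \<rho>) \<in> polydisk r r" using \<rho> by (simp add: polydisk_iff)
  ultimately have "(\<lambda>(j, k). c (j, k) * (\<Prod>i\<in>UNIV. (l $ i - l0 $ i) ^ j i) * mpow (of_real \<rho>, of_real \<rho>) k) summable_on UNIV"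
    using F by (meson has_sum_imp_summable)
  then have "(\<lambda>y. norm ((\<lambda>(j, k). c (j, k) * (\<Prod>i\<in>UNIV. (l $ i - l0 $ i) ^ j i) * mpow (of_real \<rho>, of_real \<rho>) k) y)) summable_on UNIV"
    by (subst (asm) summable_on_iff_abs_summable_on_complex)
  moreover have "norm ((\<lambda>(j, k). c (j, k) * (\<Prod>i\<in>UNIV. (l $ i - l0 $ i) ^ j i) * mpow (of_real \<rho>, of_real \<rho>) k) y)
      = norm ((\<lambda>(k, j). norm (c (j, k)) * \<rho> ^ pabs j * weight \<rho> \<rho> k) (prod.swap y))" for y
    using \<rho> by (cases y) (simp add: l_def norm_mult norm_power mpow_def weight_def pabs_def power_sum prod_norm[symmetric] abs_mult abs_prod)
  ultimately have "(\<lambda>y. norm ((\<lambda>(k, j). norm (c (j, k)) * \<rho> ^ pabs j * weight \<rho> \<rho> k) (prod.swap y))) summable_on UNIV"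
    by simp
  then have "(\<lambda>y. norm ((\<lambda>(k, j). norm (c (j, k)) * \<rho> ^ pabs j * weight \<rho> \<rho> k) y)) summable_on UNIV"
    by (subst (asm) summable_on_reindex_bij_betw[where g = prod.swap and B = UNIV]) (auto simp: bij_swap)
  then show ?thesis by simp
qed

lemma weight_pos: "0 < weight \<rho> \<rho> k" using \<rho> by (simp add: weight_def)

lemma cf_pcoef: "cf (pcoef \<rho> c k) j = of_real (\<rho> ^ pabs j) * c (j, k)"
proof -
  have "(\<lambda>j. norm (norm (c (j, k)) * \<rho> ^ pabs j * weight \<rho> \<rho> k)) summable_on UNIV"
    using pcoef_summable unfolding Infinite_Sum.abs_summable_on_Sigma_iff prod.case by blast
  moreover have "norm (norm (c (j, k)) * \<rho> ^ pabs j * weight \<rho> \<rho> k) = norm (of_real (\<rho> ^ pabs j) * c (j, k)) * weight \<rho> \<rho> k" for j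
    using \<rho> weight_pos[of k] by (simp add: abs_mult norm_mult norm_power)
  ultimately have "(\<lambda>j. norm (of_real (\<rho> ^ pabs j) * c (j, k)) * weight \<rho> \<rho> k) summable_on UNIV" by simp
  then have "(\<lambda>j. norm (of_real (\<rho> ^ pabs j) * c (j, k))) summable_on UNIV"
    using weight_pos[of k] by (subst (asm) summable_on_cmult_left') auto
  then show ?thesis by (simp add: pcoef_def Abs_l1_inverse)
qed

lemma wconv_pcoef: "wconv (pcoef \<rho> c) \<rho> \<rho>"
proof -
  have "(\<lambda>k. norm (\<Sum>\<^sub>\<infinity>j. norm (norm (c (j, k)) * \<rho> ^ pabs j * weight \<rho> \<rho> k))) summable_on UNIV"
    using pcoef_summable unfolding Infinite_Sum.abs_summable_on_Sigma_iff by simp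
  moreover have "norm (\<Sum>\<^sub>\<infinity>j. norm (norm (c (j, k)) * \<rho> ^ pabs j * weight \<rho> \<rho> k)) = norm (pcoef \<rho> c k) * weight \<rho> \<rho> k" for k
  proof -
    have e: "norm (norm (c (j, k)) * \<rho> ^ pabs j * weight \<rho> \<rho> k) = norm (cf (pcoef \<rho> c k) j) * weight \<rho> \<rho> k" for j
      using \<rho> weight_pos[of k] by (simp add: cf_pcoef abs_mult norm_mult norm_power)
    show ?thesis unfolding e using weight_pos[of k]
      by (simp add: infsum_cmult_left' norm_l1_def[symmetric] abs_mult)
  qed
  ultimately show ?thesis by (simp add: wconv_def)
qed

lemma pcoef_has_sum:
  assumes l: "l \<in> P" "l \<in> pbox \<rho> l0" and x: "x \<in> polydisk \<rho> \<rho>"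
  shows "((\<lambda>k. pchar \<rho> l0 l (pcoef \<rho> c k) * mpow x k) has_sum F l x) UNIV"
proof -
  have "((\<lambda>(j, k). c (j, k) * (\<Prod>i\<in>UNIV. (l $ i - l0 $ i) ^ j i) * mpow x k) has_sum F l x) UNIV"
  proof (rule F[OF l(1)])
    show "\<forall>i. norm (l $ i - l0 $ i) < r" using l(2) \<rho>(2) unfolding pbox_def by (auto intro: less_trans)
    show "x \<in> polydisk r r" using x \<rho>(2) by (auto simp: polydisk_iff)
  qed
  then have "((\<lambda>y. (\<lambda>(j, k). c (j, k) * (\<Prod>i\<in>UNIV. (l $ i - l0 $ i) ^ j i) * mpow x k) (prod.swap y)) has_sum F l x) UNIV"
    by (subst has_sum_reindex_bij_betw[where g = prod.swap and A = UNIV and B = UNIV]) (auto simp: bij_swap)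
  then have *: "((\<lambda>y. (\<lambda>(j, k). c (j, k) * (\<Prod>i\<in>UNIV. (l $ i - l0 $ i) ^ j i) * mpow x k) (prod.swap y)) has_sum F l x) (UNIV \<times> UNIV)"
    by simp
  show ?thesis
  proof (rule has_sum_SigmaD[OF *])
    fix k
    show "((\<lambda>j. (\<lambda>(j, k). c (j, k) * (\<Prod>i\<in>UNIV. (l $ i - l0 $ i) ^ j i) * mpow x k) (prod.swap (k, j)))
      has_sum pchar \<rho> l0 l (pcoef \<rho> c k) * mpow x k) UNIV"
      using has_sum_cmult_left[OF pchar_has_sum[OF \<rho>(1) l(2), of "pcoef \<rho> c k"], of "mpow x k"]
      by (simp add: cf_pcoef pmon_scaled[OF \<rho>(1), symmetric] mult_ac del: of_real_power)
  qed
qed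

end

text \<open>The constant term is the value at the base parameter, and every other term carries at least one factor \<open>\<rho>\<close>. Hence the coefficient
tends to a constant in the norm of the algebra when \<open>\<rho>\<close> shrinks.\<close>

lemma pcoef_tail:
  fixes c :: "('m::finite \<Rightarrow> nat) \<times> (nat \<times> nat) \<Rightarrow> complex"
  assumes cf: "\<And>j. cf (pcoef \<rho> c k) j = of_real (\<rho> ^ pabs j) * c (j, k)"
      "\<And>j. cf (pcoef \<rho>0 c k) j = of_real (\<rho>0 ^ pabs j) * c (j, k)"
    and \<rho>: "0 < \<rho>" "\<rho> \<le> \<rho>0"
  shows "norm (pcoef \<rho> c k - single 0 (cf (pcoef \<rho> c k) 0)) \<le> \<rho> / \<rho>0 * norm (pcoef \<rho>0 c k)"
proof -
  let ?w = "pcoef \<rho> c k - single 0 (cf (pcoef \<rho> c k) 0)"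
  have le: "norm (cf ?w j) \<le> \<rho> / \<rho>0 * norm (cf (pcoef \<rho>0 c k) j)" for j
  proof (cases "j = 0")
    case False
    then obtain i where i: "j i \<noteq> 0" by (auto simp: fun_eq_iff)
    have "j i \<le> pabs j" unfolding pabs_def by (rule member_le_sum) auto
    with i have "1 \<le> pabs j" by linarith
    have "\<rho> ^ pabs j = (\<rho> / \<rho>0) ^ pabs j * \<rho>0 ^ pabs j" using \<rho> by (simp add: power_divide)
    also have "\<dots> \<le> (\<rho> / \<rho>0) ^ 1 * \<rho>0 ^ pabs j"
      using \<rho> \<open>1 \<le> pabs j\<close> by (intro mult_right_mono power_decreasing) auto
    finally have "\<rho> ^ pabs j * norm (c (j, k)) \<le> (\<rho> / \<rho>0 * \<rho>0 ^ pabs j) * norm (c (j, k))"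
      by (intro mult_right_mono) auto
    then show ?thesis using False \<rho> by (simp add: cf_single cf norm_mult norm_power mult.assoc)
  qed (use \<rho> in \<open>simp add: cf_single\<close>)
  have "norm ?w \<le> (\<Sum>\<^sub>\<infinity>j. \<rho> / \<rho>0 * norm (cf (pcoef \<rho>0 c k) j))"
    unfolding norm_l1_def[of ?w] by (rule infsum_mono[OF cf_abs_summable summable_on_cmult_right[OF cf_abs_summable] le])
  also have "\<dots> = \<rho> / \<rho>0 * norm (pcoef \<rho>0 c k)" by (subst infsum_cmult_right') (simp add: norm_l1_def)
  finally show ?thesis .
qed

lemma pchar_center:
  assumes "0 < \<rho>"
  shows "pchar \<rho> l0 l0 a = cf a 0"
proof -
  have "pmon \<rho> l0 l0 j = (if j = 0 then 1 else 0)" for j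
    by (auto simp: pmon_def fun_eq_iff power_0_left)
  then have "((\<lambda>j. cf a j * pmon \<rho> l0 l0 j) has_sum cf a 0) UNIV"
    by (intro has_sum_finite_neutralI[of "{0}"]) auto
  then show ?thesis unfolding pchar_def by (rule infsumI)
qed

text \<open>Restriction to a coordinate axis reduces this to the identity theorem in one variable.\<close>

lemma power_series_axis_zero:
  fixes D :: "nat \<times> nat \<Rightarrow> complex"
  assumes r: "0 < r" and D: "\<And>x. x \<in> polydisk r r \<Longrightarrow> ((\<lambda>k. D k * mpow x k) has_sum 0) UNIV"
  shows "D (n, 0) = 0" "D (0, n) = 0"
proof -
  have uniq: "d n = 0" if d: "\<And>z. norm z < r \<Longrightarrow> ((\<lambda>n. d n * z ^ n) has_sum 0) UNIV" for d :: "nat \<Rightarrow> complex"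
  proof -
    have sums: "(\<lambda>n. d n * z ^ n) sums 0" if "norm z < r" for z
      using d[OF that] by (rule has_sum_imp_sums)
    have "Abs_fps d = 0"
    proof (rule eval_fps_eqD)
      have "fps_conv_radius (Abs_fps d) \<ge> ereal (norm (of_real (r / 2) :: complex))"
        unfolding fps_conv_radius_def
        by (rule conv_radius_geI) (use sums[of "of_real (r/2)"] r in \<open>auto simp: sums_iff\<close>)
      then show "fps_conv_radius (Abs_fps d) > 0" using r by (auto intro: less_le_trans[rotated])
      show "fps_conv_radius (0 :: complex fps) > 0" by simp
      have "eventually (\<lambda>z :: complex. z \<in> ball 0 r) (nhds 0)" using r by (intro eventually_nhds_in_open) auto
      then show "eventually (\<lambda>z. eval_fps (Abs_fps d) z = eval_fps 0 z) (nhds 0)"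
        by eventually_elim (use sums in \<open>auto simp: eval_fps_def sums_iff\<close>)
    qed
    then have "fps_nth (Abs_fps d) n = fps_nth 0 n" by simp
    then show ?thesis by simp
  qed
  show "D (n, 0) = 0"
  proof (rule uniq[where d = "\<lambda>n. D (n, 0)"])
    fix z :: complex assume z: "norm z < r"
    have "((\<lambda>k. D k * mpow (z, 0) k) has_sum 0) UNIV" using z r by (intro D) (simp add: polydisk_iff)
    also have "?this \<longleftrightarrow> ((\<lambda>k. D k * mpow (z, 0) k) has_sum 0) (range (\<lambda>n. (n, 0)))"
      by (rule has_sum_cong_neutral) (auto simp: mpow_def image_iff power_0_left)
    also have "\<dots> \<longleftrightarrow> ((\<lambda>n. D (n, 0) * z ^ n) has_sum 0) UNIV"
      by (subst has_sum_reindex) (auto simp: inj_on_def o_def mpow_def)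
    finally show "((\<lambda>n. D (n, 0) * z ^ n) has_sum 0) UNIV" .
  qed
  show "D (0, n) = 0"
  proof (rule uniq[where d = "\<lambda>n. D (0, n)"])
    fix z :: complex assume z: "norm z < r"
    have "((\<lambda>k. D k * mpow (0, z) k) has_sum 0) UNIV" using z r by (intro D) (simp add: polydisk_iff)
    also have "?this \<longleftrightarrow> ((\<lambda>k. D k * mpow (0, z) k) has_sum 0) (range (\<lambda>n. (0, n)))"
      by (rule has_sum_cong_neutral) (auto simp: mpow_def image_iff power_0_left)
    also have "\<dots> \<longleftrightarrow> ((\<lambda>n. D (0, n) * z ^ n) has_sum 0) UNIV"
      by (subst has_sum_reindex) (auto simp: inj_on_def o_def mpow_def)
    finally show "((\<lambda>n. D (0, n) * z ^ n) has_sum 0) UNIV" .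
  qed
qed

lemma linear_part_unique:
  fixes d e :: "nat \<times> nat \<Rightarrow> complex"
  assumes r: "0 < r" and d: "\<And>x. x \<in> polydisk r r \<Longrightarrow> ((\<lambda>k. d k * mpow x k) has_sum s x) UNIV"
    and e: "\<And>x. x \<in> polydisk r r \<Longrightarrow> ((\<lambda>k. e k * mpow x k) has_sum (s x - a * mpow x e0)) {k. 2 \<le> fst k + snd k}"
    and k: "fst k + snd k < 2" and e0: "fst e0 + snd e0 = 1"
  shows "d k = (if k = e0 then a else 0)"
proof -
  define D where "D = (\<lambda>k. d k - (if k = e0 then a else 0) - (if 2 \<le> fst k + snd k then e k else 0))"
  have D: "((\<lambda>k. D k * mpow x k) has_sum 0) UNIV" if x: "x \<in> polydisk r r" for x
  proof -
    have 1: "((\<lambda>k. (if k = e0 then a else 0) * mpow x k) has_sum a * mpow x e0) UNIV"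
      by (rule has_sum_finite_neutralI[of "{e0}"]) auto
    have 2: "((\<lambda>k. (if 2 \<le> fst k + snd k then e k else 0) * mpow x k) has_sum (s x - a * mpow x e0)) UNIV"
      using e[OF x] by (rule has_sum_cong_neutral[THEN iffD1, rotated -1]) auto
    show ?thesis
      using has_sum_add[OF has_sum_add[OF d[OF x] has_sum_uminusI[OF 1]] has_sum_uminusI[OF 2]]
      by (simp add: D_def left_diff_distrib)
  qed
  \<comment> \<open>Exponents of order less than two lie on the coordinate axes.\<close>
  obtain i j where ij: "k = (i, j)" by (cases k)
  then have "i = 0 \<or> j = 0" using k by (cases i) auto
  then have "D k = 0" using power_series_axis_zero[OF r D] ij by auto
  then show ?thesis using k by (simp add: D_def)
qed

text \<open>The counterpart of \<open>continuous_component\<close> for analytic families. The size \<open>\<rho>\<close> of the box remains free, because the two components must use the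
same characters. The linear coefficients of the double series agree with the given eigenvalue by uniqueness of power
series.\<close>

lemma analytic_component:
  fixes P :: "(complex ^ 'm) set" and F :: "complex ^ 'm \<Rightarrow> complex \<times> complex \<Rightarrow> complex"
  assumes P: "parameter_space P" "l0 \<in> P" and ja: "jointly_analytic P l0 F"
    and \<mu>: "\<mu> l0 \<noteq> 0" and \<kappa>: "1 < \<kappa>" and r: "0 < r" and T: "T \<subseteq> P" "l0 \<in> T" and e0: "fst e0 + snd e0 = 1"
    and F: "\<And>l x. l \<in> T \<Longrightarrow> x \<in> polydisk r r \<Longrightarrow>
      ((\<lambda>k. c k l * mpow x k) has_sum (F l x - \<mu> l * mpow x e0)) {k. 2 \<le> fst k + snd k}"
  obtains \<rho>1 where "0 < \<rho>1"
    "\<And>\<rho>. 0 < \<rho> \<Longrightarrow> \<rho> \<le> \<rho>1 \<Longrightarrow> \<exists>m n C. m * n = 1 \<and> norm m < \<kappa> * norm (\<mu> l0) \<and> norm n < \<kappa> / norm (\<mu> l0) \<and>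
       germ C \<and> (\<forall>k. fst k + snd k < 2 \<longrightarrow> C k = 0) \<and>
       (\<forall>l\<in>T \<inter> pbox \<rho> l0. pchar \<rho> l0 l m = \<mu> l \<and>
          (\<forall>x\<in>polydisk \<rho> \<rho>. ev (pchar \<rho> l0 l) C x = F l x - \<mu> l * mpow x e0))"
proof -
  obtain ra C0 where ra: "0 < ra" "\<And>l x. l \<in> P \<Longrightarrow> \<forall>i. norm (l $ i - l0 $ i) < ra \<Longrightarrow> x \<in> polydisk ra ra \<Longrightarrow>
     ((\<lambda>(j, k). C0 (j, k) * (\<Prod>i\<in>UNIV. (l $ i - l0 $ i) ^ j i) * mpow x k) has_sum F l x) UNIV"
    using ja unfolding jointly_analytic_def by blast
  define A where "A = norm (\<mu> l0)"
  have A: "0 < A" using \<mu> by (simp add: A_def)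
  \<comment> \<open>A relative error \<open>\<tau>\<close> of the eigenvalue in the algebra changes the bounds for it and for its inverse by less than the factor \<open>\<kappa>\<close>.\<close>
  define \<tau> where "\<tau> = (\<kappa> - 1) / (2 * \<kappa>)"
  have \<tau>: "0 < \<tau>" "\<tau> < 1" "1 + \<tau> < \<kappa>" "1 / (1 - \<tau>) < \<kappa>"
  proof -
    show "0 < \<tau>" "\<tau> < 1" using \<kappa> by (auto simp: \<tau>_def)
    have "0 < (2 * \<kappa> - 1) * (\<kappa> - 1)" using \<kappa> by simp
    then show "1 + \<tau> < \<kappa>" using \<kappa> by (simp add: \<tau>_def field_simps)
    have "1 - \<tau> = (\<kappa> + 1) / (2 * \<kappa>)" using \<kappa> by (simp add: \<tau>_def field_simps)
    moreover have "2 * \<kappa> / (\<kappa> + 1) < \<kappa>" using \<kappa> by (simp add: pos_divide_less_eq)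
    ultimately show "1 / (1 - \<tau>) < \<kappa>" by simp
  qed
  define \<rho>0 where "\<rho>0 = ra / 2"
  have \<rho>0: "0 < \<rho>0" "\<rho>0 < ra" using ra by (auto simp: \<rho>0_def)
  define N where "N = norm (pcoef \<rho>0 C0 e0) + 1"
  have N: "0 < N" "norm (pcoef \<rho>0 C0 e0) \<le> N" unfolding N_def by (auto intro: add_nonneg_pos)
  \<comment> \<open>For boxes of size at most \<open>\<rho>1\<close> the relative error in \<open>pcoef_tail\<close> is at most \<open>\<tau>\<close>; the 1 in \<open>N\<close> avoids division by zero.\<close>
  define \<rho>1 where "\<rho>1 = \<rho>0 * min 1 (\<tau> * A / N)"
  have m0: "0 < min 1 (\<tau> * A / N)" using \<tau> A N by simp
  have \<rho>1: "0 < \<rho>1" "\<rho>1 \<le> \<rho>0" "\<rho>1 / \<rho>0 * N \<le> \<tau> * A"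
  proof -
    show "0 < \<rho>1" unfolding \<rho>1_def by (rule mult_pos_pos[OF \<rho>0(1) m0])
    show "\<rho>1 \<le> \<rho>0" using mult_left_mono[of "min 1 (\<tau> * A / N)" 1 \<rho>0] \<rho>0 unfolding \<rho>1_def by simp
    have "\<rho>1 / \<rho>0 = min 1 (\<tau> * A / N)" using \<rho>0 by (simp add: \<rho>1_def)
    then have "\<rho>1 / \<rho>0 * N \<le> \<tau> * A / N * N" using N(1) by (intro mult_right_mono) auto
    then show "\<rho>1 / \<rho>0 * N \<le> \<tau> * A" using N(1) by simp
  qed
  show ?thesis
  proof (rule that[OF \<rho>1(1)])
    fix \<rho> assume \<rho>: "0 < \<rho>" "\<rho> \<le> \<rho>1"
    have \<rho>': "\<rho> < ra" "\<rho> \<le> \<rho>0" using \<rho> \<rho>1 \<rho>0 by auto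
    have cf: "cf (pcoef \<rho> C0 k) j = of_real (\<rho> ^ pabs j) * C0 (j, k)" "cf (pcoef \<rho>0 C0 k) j = of_real (\<rho>0 ^ pabs j) * C0 (j, k)" for j k
      by (rule cf_pcoef[OF P ra(2) \<rho>(1) \<rho>'(1)], assumption+) (rule cf_pcoef[OF P ra(2) \<rho>0], assumption+)
    have w: "wconv (pcoef \<rho> C0) \<rho> \<rho>" by (rule wconv_pcoef[OF P ra(2) \<rho>(1) \<rho>'(1)])
    have hs: "((\<lambda>k. pchar \<rho> l0 l (pcoef \<rho> C0 k) * mpow x k) has_sum F l x) UNIV"
      if "l \<in> T" "l \<in> pbox \<rho> l0" "x \<in> polydisk \<rho> \<rho>" for l x
      using that T(1) by (intro pcoef_has_sum[OF P ra(2) \<rho>(1) \<rho>'(1)]) auto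
    have px: "x \<in> polydisk \<rho> \<rho>" "x \<in> polydisk r r" if "x \<in> polydisk (min \<rho> r) (min \<rho> r)" for x
      using that \<rho>(1) r by (auto simp: polydisk_iff)
    have \<sigma>: "0 < min \<rho> r" using \<rho>(1) r by simp
    have lin: "pchar \<rho> l0 l (pcoef \<rho> C0 k) = (if k = e0 then \<mu> l else 0)"
      if l: "l \<in> T" "l \<in> pbox \<rho> l0" and k: "fst k + snd k < 2" for l k
      by (rule linear_part_unique[OF \<sigma> hs[OF l px(1)] F[OF l(1) px(2)] k e0])
    define m where "m = pcoef \<rho> C0 e0"
    have m: "pchar \<rho> l0 l m = \<mu> l" if "l \<in> T" "l \<in> pbox \<rho> l0" for l
      using lin[OF that, of e0] e0 by (simp add: m_def)
    have l0: "l0 \<in> pbox \<rho> l0" using \<rho>(1) by (simp add: pbox_def)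
    have cm: "cf m 0 = \<mu> l0" using m[OF T(2) l0] by (simp add: pchar_center[OF \<rho>(1)])
    have t: "norm (m - single 0 (\<mu> l0)) \<le> \<tau> * A"
    proof -
      have "norm (m - single 0 (\<mu> l0)) \<le> \<rho> / \<rho>0 * norm (pcoef \<rho>0 C0 e0)"
        unfolding cm[symmetric] m_def by (rule pcoef_tail[OF cf \<rho>(1) \<rho>'(2)])
      also have "\<dots> \<le> \<rho>1 / \<rho>0 * N" using \<rho> \<rho>0 N by (intro mult_mono divide_right_mono) auto
      finally show ?thesis using \<rho>1(3) by linarith
    qed
    obtain n where n: "m * n = 1" "norm n \<le> 1 / (A * (1 - \<tau>))"
      using near_scalar_inverse[OF \<mu> less_imp_le[OF \<tau>(1)] \<tau>(2) t[unfolded A_def]] unfolding A_def by metis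
    have "norm m \<le> norm (m - single 0 (\<mu> l0)) + norm (single (0 :: 'm \<Rightarrow> nat) (\<mu> l0))"
      using norm_triangle_ineq[of "m - single 0 (\<mu> l0)" "single 0 (\<mu> l0)"] by simp
    also have "\<dots> \<le> (1 + \<tau>) * A" using t by (simp add: A_def algebra_simps)
    also have "\<dots> < \<kappa> * A" using \<tau>(3) A by (intro mult_strict_right_mono) auto
    finally have nm: "norm m < \<kappa> * A" .
    have nn: "norm n < \<kappa> / A"
      using n(2) divide_strict_right_mono[OF \<tau>(4) A] by (simp add: mult.commute)
    define C where "C = (\<lambda>k. if 2 \<le> fst k + snd k then pcoef \<rho> C0 k else 0)"
    have "wconv C \<rho> \<rho>"
      unfolding wconv_def by (rule summable_on_comparison_test[OF w[unfolded wconv_def]]) (use \<rho> in \<open>auto simp: C_def\<close>)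
    then have gC: "germ C" using \<rho>(1) by (auto simp: germ_def)
    have evC: "ev (pchar \<rho> l0 l) C x = F l x - \<mu> l * mpow x e0"
      if l: "l \<in> T" "l \<in> pbox \<rho> l0" and x: "x \<in> polydisk \<rho> \<rho>" for l x
    proof -
      have "((\<lambda>k. (if k = e0 then \<mu> l else 0) * mpow x k) has_sum \<mu> l * mpow x e0) UNIV"
        by (rule has_sum_finite_neutralI[of "{e0}"]) auto
      from has_sum_add[OF hs[OF l x] has_sum_uminusI[OF this]]
      have "((\<lambda>k. pchar \<rho> l0 l (pcoef \<rho> C0 k) * mpow x k - (if k = e0 then \<mu> l else 0) * mpow x k) has_sum F l x - \<mu> l * mpow x e0) UNIV" by simp
      moreover have "pchar \<rho> l0 l (pcoef \<rho> C0 k) * mpow x k - (if k = e0 then \<mu> l else 0) * mpow x k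
        = pchar \<rho> l0 l (C k) * mpow x k" for k
        using lin[OF l, of k] e0 char_simps(4)[OF pchar_character[OF \<rho>(1) l(2)]] by (auto simp: C_def)
      ultimately show ?thesis by (simp add: ev_def infsumI)
    qed
    show "\<exists>m n C. m * n = 1 \<and> norm m < \<kappa> * norm (\<mu> l0) \<and> norm n < \<kappa> / norm (\<mu> l0) \<and>
       germ C \<and> (\<forall>k. fst k + snd k < 2 \<longrightarrow> C k = 0) \<and>
       (\<forall>l\<in>T \<inter> pbox \<rho> l0. pchar \<rho> l0 l m = \<mu> l \<and>
          (\<forall>x\<in>polydisk \<rho> \<rho>. ev (pchar \<rho> l0 l) C x = F l x - \<mu> l * mpow x e0))"
      using n(1) nm nn gC m evC unfolding A_def
      by (intro exI[of _ m] exI[of _ n] exI[of _ C]) (auto simp: C_def)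
  qed
qed

theorem analytic_normal_form:
  fixes P \<Lambda> :: "(complex ^ 'm) set" and l0 :: "complex ^ 'm"
    and f :: "complex ^ 'm \<Rightarrow> complex \<times> complex \<Rightarrow> complex \<times> complex"
    and \<mu>1 \<mu>2 :: "complex ^ 'm \<Rightarrow> complex"
    and a :: "nat \<times> nat \<Rightarrow> complex ^ 'm \<Rightarrow> complex \<times> complex" and p q p' q' :: nat
  assumes P: "parameter_space P" and nb: "\<exists>U. openin (top_of_set P) U \<and> l0 \<in> U \<and> U \<subseteq> \<Lambda>"
    and \<mu>: "\<mu>1 l0 \<noteq> 0" "\<mu>2 l0 \<noteq> 0"
    and r12: "r1 > 0" "r2 > 0"
    and f: "\<And>l x. l \<in> \<Lambda> \<Longrightarrow> x \<in> polydisk r1 r2 \<Longrightarrow>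
           ((\<lambda>i. cscale (mpow x i) (a i l)) has_sum
              (f l x - (\<mu>1 l * fst x, \<mu>2 l * snd x))) {i. fst i + snd i \<ge> 2}"
    and ja: "jointly_analytic_map P l0 f"
    and UV: "U = below p q \<and> V = above p' q' \<or> U = above p' q' \<and> V = below p q"
    and \<kappa>\<theta>: "1 < \<kappa>" "0 \<le> \<theta>" "\<theta> < 1" "contracts U \<kappa> \<theta> (norm (\<mu>1 l0)) (norm (\<mu>2 l0))"
      "contracts V \<kappa> \<theta> (1 / norm (\<mu>1 l0)) (1 / norm (\<mu>2 l0))"
    and det: "int q' * int p - int q * int p' = 1"
  obtains \<Lambda>' h hinv g b where "openin (top_of_set P) \<Lambda>'" "l0 \<in> \<Lambda>'" "\<Lambda>' \<subseteq> \<Lambda>"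
    "normal_form_family \<Lambda>' f \<mu>1 \<mu>2 p q p' q' h hinv g b"
    "jointly_analytic_map P l0 h" "jointly_analytic_map P l0 g" "\<And>i j. jointly_analytic P l0 (b i j)"
proof -
  obtain T where T: "open T" "l0 \<in> T" "l0 \<in> P" "P \<inter> T \<subseteq> \<Lambda>" by (rule parameter_neighbourhood[OF nb])
  define r where "r = min r1 r2"
  have r: "0 < r" "\<And>x. x \<in> polydisk r r \<Longrightarrow> x \<in> polydisk r1 r2" using r12 by (auto simp: r_def polydisk_iff)
  have PT: "P \<inter> T \<subseteq> P" "l0 \<in> P \<inter> T" using T by auto
  have hs: "((\<lambda>k. fst (a k l) * mpow x k) has_sum (fst (f l x) - \<mu>1 l * mpow x (1, 0))) {k. 2 \<le> fst k + snd k}"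
    "((\<lambda>k. snd (a k l) * mpow x k) has_sum (snd (f l x) - \<mu>2 l * mpow x (0, 1))) {k. 2 \<le> fst k + snd k}"
    if "l \<in> P \<inter> T" "x \<in> polydisk r r" for l x
    by (rule has_sum_components[OF f[of l x]]; use that T r(2) in blast)+
  have ja12: "jointly_analytic P l0 (\<lambda>l x. fst (f l x))" "jointly_analytic P l0 (\<lambda>l x. snd (f l x))"
    using ja by (simp_all add: jointly_analytic_map_def)
  have e: "fst (1 :: nat, 0 :: nat) + snd (1 :: nat, 0 :: nat) = 1" "fst (0 :: nat, 1 :: nat) + snd (0 :: nat, 1 :: nat) = 1" by simp_all
  obtain \<rho>1 where \<rho>1: "0 < \<rho>1" "\<And>\<rho>. 0 < \<rho> \<Longrightarrow> \<rho> \<le> \<rho>1 \<Longrightarrow>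
       \<exists>m n C. m * n = 1 \<and> norm m < \<kappa> * norm (\<mu>1 l0) \<and> norm n < \<kappa> / norm (\<mu>1 l0) \<and>
       germ C \<and> (\<forall>k. fst k + snd k < 2 \<longrightarrow> C k = 0) \<and>
       (\<forall>l\<in>(P \<inter> T) \<inter> pbox \<rho> l0. pchar \<rho> l0 l m = \<mu>1 l \<and>
          (\<forall>x\<in>polydisk \<rho> \<rho>. ev (pchar \<rho> l0 l) C x = fst (f l x) - \<mu>1 l * mpow x (1, 0)))"
    by (rule analytic_component[OF P T(3) ja12(1) \<mu>(1) \<kappa>\<theta>(1) r(1) PT e(1) hs(1)], assumption+, rule that)
  obtain \<rho>2 where \<rho>2: "0 < \<rho>2" "\<And>\<rho>. 0 < \<rho> \<Longrightarrow> \<rho> \<le> \<rho>2 \<Longrightarrow>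
       \<exists>m n C. m * n = 1 \<and> norm m < \<kappa> * norm (\<mu>2 l0) \<and> norm n < \<kappa> / norm (\<mu>2 l0) \<and>
       germ C \<and> (\<forall>k. fst k + snd k < 2 \<longrightarrow> C k = 0) \<and>
       (\<forall>l\<in>(P \<inter> T) \<inter> pbox \<rho> l0. pchar \<rho> l0 l m = \<mu>2 l \<and>
          (\<forall>x\<in>polydisk \<rho> \<rho>. ev (pchar \<rho> l0 l) C x = snd (f l x) - \<mu>2 l * mpow x (0, 1)))"
    by (rule analytic_component[OF P T(3) ja12(2) \<mu>(2) \<kappa>\<theta>(1) r(1) PT e(2) hs(2)], assumption+, rule that)
  define \<rho> where "\<rho> = min \<rho>1 \<rho>2"
  have \<rho>: "0 < \<rho>" "\<rho> \<le> \<rho>1" "\<rho> \<le> \<rho>2" using \<rho>1(1) \<rho>2(1) by (auto simp: \<rho>_def)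
  define \<Lambda>' where "\<Lambda>' = (P \<inter> T) \<inter> pbox \<rho> l0"
  have "openin (top_of_set P) (P \<inter> (T \<inter> pbox \<rho> l0))" using T(1) open_pbox by (intro openin_open_Int open_Int)
  then have \<Lambda>': "openin (top_of_set P) \<Lambda>'" "l0 \<in> \<Lambda>'" "\<Lambda>' \<subseteq> \<Lambda>" "\<Lambda>' \<subseteq> pbox \<rho> l0"
    using T \<rho>(1) by (auto simp: \<Lambda>'_def pbox_def Int_assoc)
  obtain m1 n1 C1 where c1: "m1 * n1 = 1" "norm m1 < \<kappa> * norm (\<mu>1 l0)" "norm n1 < \<kappa> / norm (\<mu>1 l0)" "germ C1"
    "\<And>k. fst k + snd k < 2 \<Longrightarrow> C1 k = 0" "\<And>l. l \<in> \<Lambda>' \<Longrightarrow> pchar \<rho> l0 l m1 = \<mu>1 l"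
    "\<And>l x. l \<in> \<Lambda>' \<Longrightarrow> x \<in> polydisk \<rho> \<rho> \<Longrightarrow> ev (pchar \<rho> l0 l) C1 x = fst (f l x) - \<mu>1 l * mpow x (1, 0)"
    using \<rho>1(2)[OF \<rho>(1,2)] unfolding \<Lambda>'_def by blast
  obtain m2 n2 C2 where c2: "m2 * n2 = 1" "norm m2 < \<kappa> * norm (\<mu>2 l0)" "norm n2 < \<kappa> / norm (\<mu>2 l0)" "germ C2"
    "\<And>k. fst k + snd k < 2 \<Longrightarrow> C2 k = 0" "\<And>l. l \<in> \<Lambda>' \<Longrightarrow> pchar \<rho> l0 l m2 = \<mu>2 l"
    "\<And>l x. l \<in> \<Lambda>' \<Longrightarrow> x \<in> polydisk \<rho> \<rho> \<Longrightarrow> ev (pchar \<rho> l0 l) C2 x = snd (f l x) - \<mu>2 l * mpow x (0, 1)"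
    using \<rho>2(2)[OF \<rho>(1,3)] unfolding \<Lambda>'_def by blast
  have F: "germs full C1 C2" by (rule germs_fullI[OF c1(4) c2(4) c1(5) c2(5)])
  have ch: "character (pchar \<rho> l0 l)" if "l \<in> \<Lambda>'" for l using pchar_character[OF \<rho>(1)] \<Lambda>'(4) that by blast
  have fg: "f l x = gmap m1 m2 C1 C2 (pchar \<rho> l0 l) x" if l: "l \<in> \<Lambda>'" and x: "x \<in> polydisk \<rho> \<rho>" for l x
    by (simp add: gmap_def c1(6,7)[OF l] c2(6,7)[OF l] x) (simp add: mpow_def)
  have ne: "\<Lambda>' \<noteq> {}" using \<Lambda>' by blast
  have AB: "0 < norm (\<mu>1 l0)" "0 < norm (\<mu>2 l0)" using \<mu> by simp_all
  obtain H HI G and b :: "nat \<Rightarrow> nat \<Rightarrow> (('m \<Rightarrow> nat, complex) l1 \<Rightarrow> complex) \<Rightarrow> complex \<times> complex \<Rightarrow> complex" where nf: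
    "expands (\<lambda>\<omega> x. fst (H \<omega> x))" "expands (\<lambda>\<omega> x. snd (H \<omega> x))"
    "expands (\<lambda>\<omega> x. fst (G \<omega> x))" "expands (\<lambda>\<omega> x. snd (G \<omega> x))" "\<And>i j. expands (b i j)"
    "normal_form_family \<Lambda>' f \<mu>1 \<mu>2 p q p' q' (\<lambda>l. H (pchar \<rho> l0 l)) (\<lambda>l. HI (pchar \<rho> l0 l))
      (\<lambda>l. G (pchar \<rho> l0 l)) (\<lambda>i j l. b i j (pchar \<rho> l0 l))"
    by (rule family_normal_form[where \<omega> = "pchar \<rho> l0" and \<Lambda> = \<Lambda>' and f = f,
          OF F c1(1) c2(1) AB c1(2) c2(2) c1(3) c2(3) UV \<kappa>\<theta> det ch pchar_continuous[OF \<rho>(1) \<Lambda>'(4)] ne \<rho>(1) fg c1(6) c2(6)],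
        assumption, assumption, assumption, assumption, assumption, rule that)
  show ?thesis
  proof (rule that[OF \<Lambda>'(1-3) nf(6)])
    show "jointly_analytic_map P l0 (\<lambda>l. H (pchar \<rho> l0 l))" "jointly_analytic_map P l0 (\<lambda>l. G (pchar \<rho> l0 l))"
      unfolding jointly_analytic_map_def
      using expands_jointly_analytic[OF nf(1) \<rho>(1), of P l0] expands_jointly_analytic[OF nf(2) \<rho>(1), of P l0]
        expands_jointly_analytic[OF nf(3) \<rho>(1), of P l0] expands_jointly_analytic[OF nf(4) \<rho>(1), of P l0] by auto
    show "jointly_analytic P l0 (\<lambda>l. b i j (pchar \<rho> l0 l))" for i j
      by (rule expands_jointly_analytic[OF nf(5) \<rho>(1)])
  qed
qed

section \<open>The normal form theorem\<close>

theorem theorem3p1: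
  fixes P \<Lambda> :: "(complex ^ 'm) set" and l0 :: "complex ^ 'm"
    and f :: "complex ^ 'm \<Rightarrow> complex \<times> complex \<Rightarrow> complex \<times> complex"
    and \<mu>1 \<mu>2 :: "complex ^ 'm \<Rightarrow> complex"
    and a :: "nat \<times> nat \<Rightarrow> complex ^ 'm \<Rightarrow> complex \<times> complex"
    and r1 r2 R :: real
    and d qs ps :: "nat \<Rightarrow> nat" and k p q p' q' :: nat
  assumes "parameter_space P"
    and "\<Lambda> \<subseteq> P" and "\<exists>U. openin (top_of_set P) U \<and> l0 \<in> U \<and> U \<subseteq> \<Lambda>"
    and "continuous_on \<Lambda> \<mu>1" and "bounded (\<mu>1 ` \<Lambda>)"
    and "continuous_on \<Lambda> \<mu>2" and "bounded (\<mu>2 ` \<Lambda>)"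
    and "\<And>l. l \<in> \<Lambda> \<Longrightarrow> \<mu>1 l \<noteq> \<mu>2 l"
    and "r1 > 0" and "r2 > 0"
    and "sup_convergent \<Lambda> (polydisk r1 r2) {i. fst i + snd i \<ge> 2} a"
    and "\<And>l x. l \<in> \<Lambda> \<Longrightarrow> x \<in> polydisk r1 r2 \<Longrightarrow>
           ((\<lambda>i. cscale (mpow x i) (a i l)) has_sum
              (f l x - (\<mu>1 l * fst x, \<mu>2 l * snd x))) {i. fst i + snd i \<ge> 2}"
    and "\<And>l. l \<in> \<Lambda> \<Longrightarrow> local_analytic_diffeo (f l)"
    and "\<And>l. l \<in> \<Lambda> \<Longrightarrow> norm (\<mu>1 l) \<noteq> 1 \<and> norm (\<mu>2 l) \<noteq> 1"
    and "ln (norm (\<mu>1 l0)) / ln (norm (\<mu>2 l0)) = - R" and "R > 0" and "R \<notin> \<rat>"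
    and "cfrac_expansion d R" and "cfrac_convergents d qs ps"
    and "q = qs (2 * k + 1)" and "p = ps (2 * k + 1)"
    and "q' = qs (2 * k + 2)" and "p' = ps (2 * k + 2)"
  shows "\<exists>\<Lambda>' h hinv g. \<exists>b :: nat \<Rightarrow> nat \<Rightarrow> complex ^ 'm \<Rightarrow> complex \<times> complex \<Rightarrow> complex.
     openin (top_of_set P) \<Lambda>' \<and> l0 \<in> \<Lambda>' \<and> \<Lambda>' \<subseteq> \<Lambda> \<and>
     analytic_map_family \<Lambda>' h \<and> analytic_map_family \<Lambda>' hinv \<and> analytic_map_family \<Lambda>' g \<and>
     (\<forall>l\<in>\<Lambda>'. local_analytic_diffeo (h l)) \<and>
     (\<forall>i\<in>{1,2}. \<forall>j\<in>{1,2}. analytic_family \<Lambda>' (b i j)) \<and>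
     (\<exists>r>0. \<forall>l\<in>\<Lambda>'. \<forall>x\<in>polydisk r r.
        hinv l (h l x) = x \<and> h l (hinv l x) = x \<and>
        g l x = hinv l (f l (h l x)) \<and>
        (let u = mpow x (p, q); u' = mpow x (p', q') in
          g l x =
            (fst x * (\<mu>1 l + u * b 1 1 l (u, u') + u' * b 2 1 l (u, u')),
             snd x * (\<mu>2 l + u * b 1 2 l (u, u') + u' * b 2 2 l (u, u'))))) \<and>
     (jointly_analytic_map P l0 f \<longrightarrow>
        jointly_analytic_map P l0 h \<and> jointly_analytic_map P l0 g \<and>
        (\<forall>i\<in>{1,2}. \<forall>j\<in>{1,2}. jointly_analytic P l0 (b i j)))"
proof -
  have \<mu>0: "\<mu>1 l0 \<noteq> 0" "\<mu>2 l0 \<noteq> 0" using assms(15,16) by auto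
  define A where "A = norm (\<mu>1 l0)"
  define B where "B = norm (\<mu>2 l0)"
  have AB: "0 < A" "0 < B" "ln A / ln B = - R" using \<mu>0 assms(15) by (auto simp: A_def B_def)
  note br = convergents_bracket[OF assms(18,19,17), of k, folded assms(20-23)]
  obtain U V \<kappa> \<theta> where UV: "U = below p q \<and> V = above p' q' \<or> U = above p' q' \<and> V = below p q"
    "1 < \<kappa>" "0 \<le> \<theta>" "\<theta> < 1" "contracts U \<kappa> \<theta> A B" "contracts V \<kappa> \<theta> (1 / A) (1 / B)"
    by (rule contracts_exists[OF br(1-4) assms(16) AB])
  note UV' = UV(1-4) UV(5,6)[unfolded A_def B_def]
  show ?thesis
  \<comment> \<open>The conjugacy is built over a different algebra in each case, and the last part of the claim only concerns the first one.\<close>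
  proof (cases "jointly_analytic_map P l0 f")
    case True
    obtain \<Lambda>' h hinv g b where n: "openin (top_of_set P) \<Lambda>'" "l0 \<in> \<Lambda>'" "\<Lambda>' \<subseteq> \<Lambda>"
      "normal_form_family \<Lambda>' f \<mu>1 \<mu>2 p q p' q' h hinv g b"
      "jointly_analytic_map P l0 h" "jointly_analytic_map P l0 g" "\<And>i j. jointly_analytic P l0 (b i j)"
      by (rule analytic_normal_form[OF assms(1,3) \<mu>0 assms(9,10,12) True UV' br(5)], assumption, assumption, rule that)
    show ?thesis
      using n unfolding normal_form_family_def cone_normal_form_def Let_def
      by (intro exI[of _ \<Lambda>'] exI[of _ h] exI[of _ hinv] exI[of _ g] exI[of _ b]) blast
  next
    case False
    obtain \<Lambda>' h hinv g b where n: "openin (top_of_set P) \<Lambda>'" "l0 \<in> \<Lambda>'" "\<Lambda>' \<subseteq> \<Lambda>"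
      "normal_form_family \<Lambda>' f \<mu>1 \<mu>2 p q p' q' h hinv g b"
      by (rule continuous_normal_form[OF assms(1,3,4,6) \<mu>0 assms(9-12) UV' br(5)], assumption, assumption, rule that)
    show ?thesis
      using n False unfolding normal_form_family_def cone_normal_form_def Let_def
      by (intro exI[of _ \<Lambda>'] exI[of _ h] exI[of _ hinv] exI[of _ g] exI[of _ b]) blast
  qed
qed

end
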